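(* Satisfiability checking w.r.t. loosely guarded programs is NEXPTIME-hard: the problem of deciding, given a loosely guarded program $P$ and a predicate $q$ in $P$, whether $q$ is satisfiable w.r.t. $P$, is NEXPTIME-hard.
   Context: Terms are constants and variables (no function symbols). A literal is an atom $q(\mathbf{t})$ or a naf-atom $\mathrm{not}\,q(\mathbf{t})$. Equality is a binary predicate; $t\neq s$ stands for $\mathrm{not}\,(t=s)$. A regular atom is an atom that is not an equality atom. For a set $\alpha$ of literals, $\alpha^+$ is the set of atoms in $\alpha$ and $\alpha^-=\{a \mid \mathrm{not}\,a\in\alpha\}$; for a set $X$ of atoms, $\mathrm{not}\,X=\{\mathrm{not}\,a\mid a\in X\}$. A rule is $\alpha\leftarrow\beta$ with $\alpha,\beta$ finite sets of literals, $|\alpha^+|\le 1$, and $\alpha^+$ containing no equality atom ($\alpha$ is read disjunctively, $\beta$ conjunctively; $\alpha$ may be empty). A program is a finite set of rules. A free rule is a rule $q(\mathbf{t})\vee\mathrm{not}\,q(\mathbf{t})\leftarrow$ (empty body). A universe $U$ for $P$ is a non-empty countable superset of the set of constants of $P$. $P_U$ is the ground program obtained by substituting variables of $P$ by elements of $U$ in all possible ways. For a set $I$ of ground regular atoms, $I\models a$ iff $a\in I$ for regular $a$; $I\models t=s$ iff $t,s$ are the same element; $I\models \mathrm{not}\,a$ iff $I\not\models a$; $I\models X$ iff $I$ satisfies every element of $X$. $I$ satisfies a ground rule $\alpha\leftarrow\beta$ if $I\models l$ for some $l\in\alpha$ whenever $I\models\beta$. For a ground program without $\mathrm{not}$, an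 answer set is a subset-minimal model. For a ground program $Q$, the GL-reduct is $Q^I=\{\alpha^+\leftarrow\beta^+ \mid \alpha\leftarrow\beta\in Q,\ I\models\mathrm{not}\,\beta^-,\ I\models\alpha^-\}$, and $I$ is an answer set of $Q$ if it is an answer set of $Q^I$. An open answer set of $P$ is a pair $(U,M)$ with $U$ a universe for $P$, $M$ a set of ground regular atoms over the predicates of $P$ and $U$, and $M$ an answer set of $P_U$. An $n$-ary predicate $q$ is satisfiable w.r.t. $P$ if there is an open answer set $(U,M)$ of $P$ and $\mathbf{x}\in U^n$ with $q(\mathbf{x})\in M$. A rule $r:\alpha\leftarrow\beta$ is loosely guarded if there is $\gamma_b\subseteq\beta^+$ (a body guard) such that every two (not necessarily distinct) variables of $r$ appear together in an atom of $\gamma_b$. A program is loosely guarded if every non-free rule in it is loosely guarded. *)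

theory Defs
  imports Main "HOL-Library.Countable_Set" "HOL-Computational_Algebra.Polynomial"
begin

section \<open>Programs and open answer sets\<close>

datatype (consts_trm: 'c, vars_trm: 'v) trm = Const 'c | Var 'v

text \<open>Atoms with predicate symbols from \<open>'p\<close> and arguments from \<open>'t\<close>. With \<open>'t = ('c, 'v) trm\<close> these
  are the atoms of programs; with \<open>'t = 'c\<close> they are ground atoms.\<close>

datatype (preds_atom: 'p, args_atom: 't) atom = Reg 'p "'t list" | Eq 't 't

datatype (atoms_lit: 'a) lit = Pos 'a | Naf 'a

text \<open>The pair \<open>(\<alpha>, \<beta>)\<close> is the rule \<open>\<alpha> \<leftarrow> \<beta>\<close>.\<close>

type_synonym 'a rule = "'a lit set \<times> 'a lit set"
type_synonym ('p, 'c, 'v) rl = "('p, ('c, 'v) trm) atom rule"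
type_synonym ('p, 'c) ground_rl = "('p, 'c) atom rule"

definition pos :: "'a lit set \<Rightarrow> 'a set" where
  "pos \<alpha> = {a. Pos a \<in> \<alpha>}"

definition neg :: "'a lit set \<Rightarrow> 'a set" where
  "neg \<alpha> = {a. Naf a \<in> \<alpha>}"

definition atoms_rule :: "'a rule \<Rightarrow> 'a set" where
  "atoms_rule r = \<Union> (atoms_lit ` (fst r \<union> snd r))"

definition atoms_prog :: "'a rule set \<Rightarrow> 'a set" where
  "atoms_prog P = \<Union> (atoms_rule ` P)"

definition vars_atom :: "('p, ('c, 'v) trm) atom \<Rightarrow> 'v set" where
  "vars_atom a = \<Union> (vars_trm ` args_atom a)"

definition vars_rule :: "('p, 'c, 'v) rl \<Rightarrow> 'v set" where
  "vars_rule r = \<Union> (vars_atom ` atoms_rule r)"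

definition consts_prog :: "('p, 'c, 'v) rl set \<Rightarrow> 'c set" where
  "consts_prog P = \<Union> (consts_trm ` \<Union> (args_atom ` atoms_prog P))"

definition preds_prog :: "('p, 'c, 'v) rl set \<Rightarrow> 'p set" where
  "preds_prog P = \<Union> (preds_atom ` atoms_prog P)"

definition is_rule :: "('p, 'c, 'v) rl \<Rightarrow> bool" where
  "is_rule r \<longleftrightarrow> finite (fst r) \<and> finite (snd r) \<and> card (pos (fst r)) \<le> 1
     \<and> (\<forall>s t. Eq s t \<notin> pos (fst r))"

text \<open>The last conjunct says that each predicate symbol has a fixed arity.\<close>

definition is_program :: "('p, 'c, 'v) rl set \<Rightarrow> bool" where
  "is_program P \<longleftrightarrow> finite P \<and> (\<forall>r\<in>P. is_rule r)
     \<and> (\<exists>ar. \<forall>p ts. Reg p ts \<in> atoms_prog P \<longrightarrow> length ts = ar p)"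

definition free_rule :: "('p, 'c, 'v) rl \<Rightarrow> bool" where
  "free_rule r \<longleftrightarrow> (\<exists>q ts. r = ({Pos (Reg q ts), Naf (Reg q ts)}, {}))"

definition loosely_guarded_rule :: "('p, 'c, 'v) rl \<Rightarrow> bool" where
  "loosely_guarded_rule r \<longleftrightarrow>
     (\<exists>\<gamma> \<subseteq> pos (snd r). \<forall>x\<in>vars_rule r. \<forall>y\<in>vars_rule r.
        \<exists>a\<in>\<gamma>. x \<in> vars_atom a \<and> y \<in> vars_atom a)"

definition loosely_guarded :: "('p, 'c, 'v) rl set \<Rightarrow> bool" where
  "loosely_guarded P \<longleftrightarrow> (\<forall>r\<in>P. \<not> free_rule r \<longrightarrow> loosely_guarded_rule r)"

text \<open>A universe adds new elements from the type of constants.\<close>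

definition universe :: "('p, 'c, 'v) rl set \<Rightarrow> 'c set \<Rightarrow> bool" where
  "universe P U \<longleftrightarrow> U \<noteq> {} \<and> countable U \<and> consts_prog P \<subseteq> U"

fun subst_trm :: "('v \<Rightarrow> 'c) \<Rightarrow> ('c, 'v) trm \<Rightarrow> 'c" where
  "subst_trm \<sigma> (Const c) = c"
| "subst_trm \<sigma> (Var v) = \<sigma> v"

definition subst_lit :: "('v \<Rightarrow> 'c) \<Rightarrow> ('p, ('c, 'v) trm) atom lit \<Rightarrow> ('p, 'c) atom lit" where
  "subst_lit \<sigma> = map_lit (map_atom id (subst_trm \<sigma>))"

definition ground_prog :: "('p, 'c, 'v) rl set \<Rightarrow> 'c set \<Rightarrow> ('p, 'c) ground_rl set" where
  "ground_prog P U =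
     {(subst_lit \<sigma> ` \<alpha>, subst_lit \<sigma> ` \<beta>) | \<sigma> \<alpha> \<beta>. (\<alpha>, \<beta>) \<in> P \<and> range \<sigma> \<subseteq> U}"

text \<open>An interpretation is a set of ground regular atoms; the pair \<open>(q, xs)\<close> stands for \<open>Reg q xs\<close>.\<close>

type_synonym ('p, 'c) interp = "('p \<times> 'c list) set"

fun sat_atom :: "('p, 'c) interp \<Rightarrow> ('p, 'c) atom \<Rightarrow> bool" where
  "sat_atom I (Reg q xs) \<longleftrightarrow> (q, xs) \<in> I"
| "sat_atom I (Eq s t) \<longleftrightarrow> s = t"

fun sat_lit :: "('p, 'c) interp \<Rightarrow> ('p, 'c) atom lit \<Rightarrow> bool" where
  "sat_lit I (Pos a) \<longleftrightarrow> sat_atom I a"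
| "sat_lit I (Naf a) \<longleftrightarrow> \<not> sat_atom I a"

definition sat_rule :: "('p, 'c) interp \<Rightarrow> ('p, 'c) ground_rl \<Rightarrow> bool" where
  "sat_rule I r \<longleftrightarrow> ((\<forall>l\<in>snd r. sat_lit I l) \<longrightarrow> (\<exists>l\<in>fst r. sat_lit I l))"

definition model :: "('p, 'c) interp \<Rightarrow> ('p, 'c) ground_rl set \<Rightarrow> bool" where
  "model I Q \<longleftrightarrow> (\<forall>r\<in>Q. sat_rule I r)"

definition minimal_model :: "('p, 'c) interp \<Rightarrow> ('p, 'c) ground_rl set \<Rightarrow> bool" where
  "minimal_model I Q \<longleftrightarrow> model I Q \<and> (\<forall>J. J \<subset> I \<longrightarrow> \<not> model J Q)"

definition reduct :: "('p, 'c) ground_rl set \<Rightarrow> ('p, 'c) interp \<Rightarrow> ('p, 'c) ground_rl set" where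
  "reduct Q I = {(Pos ` pos \<alpha>, Pos ` pos \<beta>) | \<alpha> \<beta>. (\<alpha>, \<beta>) \<in> Q
     \<and> (\<forall>a\<in>neg \<beta>. \<not> sat_atom I a) \<and> (\<forall>a\<in>neg \<alpha>. sat_atom I a)}"

definition answer_set :: "('p, 'c) ground_rl set \<Rightarrow> ('p, 'c) interp \<Rightarrow> bool" where
  "answer_set Q I \<longleftrightarrow> minimal_model I (reduct Q I)"

text \<open>All ground regular atoms over the predicates of \<open>P\<close>, with the arities they have in \<open>P\<close>.\<close>

definition base :: "('p, 'c, 'v) rl set \<Rightarrow> 'c set \<Rightarrow> ('p, 'c) interp" where
  "base P U = {(q, xs). \<exists>ts. Reg q ts \<in> atoms_prog P \<and> length xs = length ts \<and> set xs \<subseteq> U}"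

definition open_answer_set :: "('p, 'c, 'v) rl set \<Rightarrow> 'c set \<Rightarrow> ('p, 'c) interp \<Rightarrow> bool" where
  "open_answer_set P U M \<longleftrightarrow> universe P U \<and> M \<subseteq> base P U \<and> answer_set (ground_prog P U) M"

text \<open>The arity of \<open>q\<close> is respected because \<open>M \<subseteq> base P U\<close>.\<close>

definition satisfiable :: "('p, 'c, 'v) rl set \<Rightarrow> 'p \<Rightarrow> bool" where
  "satisfiable P q \<longleftrightarrow> (\<exists>U M xs. open_answer_set P U M \<and> set xs \<subseteq> U \<and> (q, xs) \<in> M)"


section \<open>Turing machines and complexity\<close>

text \<open>Multi-tape machines whose tapes are infinite to the right. Tape symbols are natural numbers,
  \<open>0\<close> is the blank. An element \<open>((s, as), (s', bs))\<close> of \<open>delta\<close> applies in state \<open>s\<close> when the tapes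
  show the symbols \<open>as\<close>; \<open>bs\<close> gives for each tape the symbol written and the move. Since \<open>delta\<close> is
  finite, only finitely many states and symbols matter.\<close>

datatype move = Left | Stay | Right

record tm =
  tapes :: nat
  start :: nat
  accept :: nat
  delta :: "((nat \<times> nat list) \<times> (nat \<times> (nat \<times> move) list)) set"

definition wf_tm :: "tm \<Rightarrow> bool" where
  "wf_tm M \<longleftrightarrow> tapes M \<ge> 1 \<and> finite (delta M) \<and>
     (\<forall>s as s' bs. ((s, as), (s', bs)) \<in> delta M \<longrightarrow>
        length as = tapes M \<and> length bs = tapes M \<and> s \<noteq> accept M)"

definition deterministic :: "tm \<Rightarrow> bool" where
  "deterministic M \<longleftrightarrow> single_valued (delta M)"

type_synonym tape = "(nat \<Rightarrow> nat) \<times> nat"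
type_synonym config = "nat \<times> tape list"
type_synonym word = "nat list"

fun read :: "tape \<Rightarrow> nat" where
  "read (f, h) = f h"

text \<open>A left move on the leftmost cell leaves the head where it is.\<close>

fun act :: "tape \<Rightarrow> nat \<times> move \<Rightarrow> tape" where
  "act (f, h) (a, m) =
     (f(h := a), case m of Left \<Rightarrow> h - 1 | Stay \<Rightarrow> h | Right \<Rightarrow> h + 1)"

definition step :: "tm \<Rightarrow> (config \<times> config) set" where
  "step M = {((s, tps), (s', map2 act tps bs)) | s tps s' bs.
     ((s, map read tps), (s', bs)) \<in> delta M}"

definition contents :: "word \<Rightarrow> nat \<Rightarrow> nat" where
  "contents w i = (if i < length w then w ! i else 0)"

definition init :: "tm \<Rightarrow> word \<Rightarrow> config" where
  "init M w = (start M, (contents w, 0) # replicate (tapes M - 1) (\<lambda>_. 0, 0))"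

text \<open>Every computation of \<open>M\<close> on a word \<open>w\<close> over \<open>\<Sigma>\<close> has at most \<open>T (length w)\<close> steps, and \<open>w\<close> is
  in \<open>L\<close> iff some computation reaches the accepting state.\<close>

definition decides_in_time :: "tm \<Rightarrow> nat set \<Rightarrow> word set \<Rightarrow> (nat \<Rightarrow> nat) \<Rightarrow> bool" where
  "decides_in_time M \<Sigma> L T \<longleftrightarrow> (\<forall>w\<in>lists \<Sigma>.
     (\<forall>t c. (init M w, c) \<in> step M ^^ t \<longrightarrow> t \<le> T (length w)) \<and>
     (w \<in> L \<longleftrightarrow> (\<exists>c. (init M w, c) \<in> (step M)\<^sup>* \<and> fst c = accept M)))"

definition alphabet :: "nat set \<Rightarrow> bool" where
  "alphabet \<Sigma> \<longleftrightarrow> finite \<Sigma> \<and> 0 \<notin> \<Sigma>"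

definition NEXPTIME :: "nat set \<Rightarrow> word set set" where
  "NEXPTIME \<Sigma> = {L. L \<subseteq> lists \<Sigma> \<and>
     (\<exists>M (p :: nat poly). wf_tm M \<and> decides_in_time M \<Sigma> L (\<lambda>n. 2 ^ poly p n))}"

text \<open>The output is the content of the last tape when the machine halts.\<close>

definition polytime_computable :: "nat set \<Rightarrow> (word \<Rightarrow> word) \<Rightarrow> bool" where
  "polytime_computable \<Sigma> f \<longleftrightarrow> (\<exists>M (p :: nat poly). wf_tm M \<and> deterministic M \<and>
     (\<forall>w\<in>lists \<Sigma>. 0 \<notin> set (f w) \<and>
        (\<exists>t c. t \<le> poly p (length w) \<and> (init M w, c) \<in> step M ^^ t \<and> c \<notin> Domain (step M) \<and>
           fst (last (snd c)) = contents (f w))))"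

text \<open>A decision problem is given by the set of words that encode its instances and the subset of
  those that encode yes-instances. Hardness is with respect to polynomial-time many-one reductions,
  which have to produce instances.\<close>

definition NEXPTIME_hard :: "word set \<Rightarrow> word set \<Rightarrow> bool" where
  "NEXPTIME_hard Inst Yes \<longleftrightarrow> (\<forall>\<Sigma> L. alphabet \<Sigma> \<and> L \<in> NEXPTIME \<Sigma> \<longrightarrow>
     (\<exists>f. polytime_computable \<Sigma> f \<and> (\<forall>w\<in>lists \<Sigma>. f w \<in> Inst \<and> (w \<in> L \<longleftrightarrow> f w \<in> Yes))))"


section \<open>Encoding of programs as words\<close>

text \<open>Predicate symbols, constants and variables are named by bit strings. A program is written as a
  list of rules, each consisting of two lists of literals. The symbols \<open>1\<close> and \<open>2\<close> are the bits;
  \<open>3\<close>, ..., \<open>11\<close> are tags that open a new syntactic item, which makes the encoding injective.\<close>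

type_synonym name = "bool list"
type_synonym syn_lit = "(name, (name, name) trm) atom lit"
type_synonym syn_rule = "syn_lit list \<times> syn_lit list"

definition enc_name :: "name \<Rightarrow> word" where
  "enc_name = map (\<lambda>b. if b then 2 else 1)"

fun enc_trm :: "(name, name) trm \<Rightarrow> word" where
  "enc_trm (Const c) = 3 # enc_name c"
| "enc_trm (Var v) = 4 # enc_name v"

fun enc_atom :: "(name, (name, name) trm) atom \<Rightarrow> word" where
  "enc_atom (Reg q ts) = 5 # enc_name q @ concat (map enc_trm ts)"
| "enc_atom (Eq s t) = 6 # enc_trm s @ enc_trm t"

fun enc_lit :: "syn_lit \<Rightarrow> word" where
  "enc_lit (Pos a) = 7 # enc_atom a"
| "enc_lit (Naf a) = 8 # enc_atom a"

fun enc_rule :: "syn_rule \<Rightarrow> word" where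
  "enc_rule (hs, bs) = 9 # concat (map enc_lit hs) @ 10 # concat (map enc_lit bs)"

definition enc_instance :: "syn_rule list \<Rightarrow> name \<Rightarrow> word" where
  "enc_instance rs q = concat (map enc_rule rs) @ 11 # enc_name q"

definition program_of :: "syn_rule list \<Rightarrow> (name, name, name) rl set" where
  "program_of rs = set (map (map_prod set set) rs)"

definition loosely_guarded_instances :: "word set" where
  "loosely_guarded_instances = {enc_instance rs q | rs q.
     is_program (program_of rs) \<and> loosely_guarded (program_of rs) \<and> q \<in> preds_prog (program_of rs)}"

definition satisfiable_loosely_guarded_instances :: "word set" where
  "satisfiable_loosely_guarded_instances = {enc_instance rs q | rs q.
     is_program (program_of rs) \<and> loosely_guarded (program_of rs) \<and> q \<in> preds_prog (program_of rs)
     \<and> satisfiable (program_of rs) q}"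

lemma enc_name_cancel:
  assumes "enc_name a @ u = enc_name b @ v" "u = [] \<or> hd u \<ge> 3" "v = [] \<or> hd v \<ge> 3"
  shows "a = b \<and> u = v"
  using assms
proof (induction a arbitrary: b)
  case Nil
  then show ?case by (cases b) (auto simp: enc_name_def split: if_splits)
next
  case (Cons x a)
  then show ?case by (cases b) (auto simp: enc_name_def split: if_splits)
qed

lemma enc_trm_cancel:
  assumes "enc_trm s @ u = enc_trm t @ v" "u = [] \<or> hd u \<ge> 3" "v = [] \<or> hd v \<ge> 3"
  shows "s = t \<and> u = v"
  using assms enc_name_cancel[of _ u _ v] by (cases s; cases t) auto

text \<open>If every item of a list is encoded by a word that starts with a symbol in \<open>A\<close> and can be split
  off in front of a word starting with a symbol in \<open>A \<union> B\<close>, then the list can be split off in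
  front of a word starting with a symbol in \<open>B\<close>.\<close>

lemma concat_cancel:
  fixes enc :: "'a \<Rightarrow> word"
  assumes tag: "\<And>x. enc x \<noteq> [] \<and> hd (enc x) \<in> A"
    and item: "\<And>x y u v. \<lbrakk>enc x @ u = enc y @ v; u = [] \<or> hd u \<in> A \<union> B; v = [] \<or> hd v \<in> A \<union> B\<rbrakk>
      \<Longrightarrow> x = y \<and> u = v"
    and disj: "A \<inter> B = {}"
  shows "\<lbrakk>concat (map enc xs) @ u = concat (map enc ys) @ v; u = [] \<or> hd u \<in> B; v = [] \<or> hd v \<in> B\<rbrakk>
    \<Longrightarrow> xs = ys \<and> u = v"
proof (induction xs arbitrary: ys)
  case Nil
  show ?case
  proof (cases ys)
    case Nil
    then show ?thesis using Nil.prems by simp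
  next
    case (Cons y ys')
    then have "u \<noteq> []" "hd u \<in> A" using Nil.prems tag[of y] by auto
    then show ?thesis using Nil.prems disj by auto
  qed
next
  case (Cons x xs)
  have start: "concat (map enc zs) @ w = [] \<or> hd (concat (map enc zs) @ w) \<in> A \<union> B"
    if "w = [] \<or> hd w \<in> B" for zs w
    using that tag by (cases zs) auto
  show ?case
  proof (cases ys)
    case Nil
    then have "v \<noteq> []" "hd v \<in> A" using Cons.prems(1) tag[of x] by (auto dest: sym)
    then show ?thesis using Cons.prems(3) disj by auto
  next
    case (Cons y ys')
    then have "enc x @ (concat (map enc xs) @ u) = enc y @ (concat (map enc ys') @ v)"
      using Cons.prems(1) by simp
    then have "x = y \<and> concat (map enc xs) @ u = concat (map enc ys') @ v"
      using start Cons.prems(2,3) by (intro item) blast+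
    then show ?thesis using Cons.IH Cons.prems(2,3) Cons by blast
  qed
qed

lemma enc_trms_cancel:
  assumes "concat (map enc_trm ss) @ u = concat (map enc_trm ts) @ v"
    "u = [] \<or> hd u \<ge> 5" "v = [] \<or> hd v \<ge> 5"
  shows "ss = ts \<and> u = v"
proof (rule concat_cancel[where enc = enc_trm and A = "{3,4}" and B = "{5..}"])
  show "enc_trm t \<noteq> [] \<and> hd (enc_trm t) \<in> {3,4}" for t by (cases t) auto
  show "s = t \<and> u = v" if "enc_trm s @ u = enc_trm t @ v"
    "u = [] \<or> hd u \<in> {3,4} \<union> {5..}" "v = [] \<or> hd v \<in> {3,4} \<union> {5..}" for s t u v
    by (rule enc_trm_cancel) (use that in auto)
qed (use assms in auto)

lemma hd_enc_trms: "u = [] \<or> hd u \<ge> 5 \<Longrightarrow>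
    concat (map enc_trm ts) @ u = [] \<or> hd (concat (map enc_trm ts) @ u) \<ge> 3"
  by (cases ts; cases "hd ts") auto

lemma enc_atom_cancel:
  assumes "enc_atom a @ u = enc_atom b @ v" "u = [] \<or> hd u \<ge> 5" "v = [] \<or> hd v \<ge> 5"
  shows "a = b \<and> u = v"
proof (cases a; cases b)
  fix q ts q' ts' assume ab: "a = Reg q ts" "b = Reg q' ts'"
  then have "enc_name q @ (concat (map enc_trm ts) @ u) =
      enc_name q' @ (concat (map enc_trm ts') @ v)" using assms(1) by simp
  then have "q = q' \<and> concat (map enc_trm ts) @ u = concat (map enc_trm ts') @ v"
    by (rule enc_name_cancel) (use hd_enc_trms assms(2,3) in blast)+
  then show ?thesis using enc_trms_cancel assms(2,3) ab by blast
next
  fix s t s' t' assume ab: "a = Eq s t" "b = Eq s' t'"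
  have "concat (map enc_trm [s, t]) @ u = concat (map enc_trm [s', t']) @ v"
    using assms(1) ab by simp
  then have "[s, t] = [s', t'] \<and> u = v" using enc_trms_cancel assms(2,3) by blast
  then show ?thesis using ab by simp
qed (use assms(1) in auto)

lemma enc_lits_cancel:
  assumes "concat (map enc_lit ls) @ u = concat (map enc_lit ks) @ v"
    "u = [] \<or> hd u \<ge> 9" "v = [] \<or> hd v \<ge> 9"
  shows "ls = ks \<and> u = v"
proof (rule concat_cancel[where enc = enc_lit and A = "{7,8}" and B = "{9..}"])
  show "enc_lit l \<noteq> [] \<and> hd (enc_lit l) \<in> {7,8}" for l by (cases l) auto
  show "l = k \<and> u = v" if "enc_lit l @ u = enc_lit k @ v"
    "u = [] \<or> hd u \<in> {7,8} \<union> {9..}" "v = [] \<or> hd v \<in> {7,8} \<union> {9..}" for l k u v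
  proof -
    have "u = [] \<or> hd u \<ge> 5" "v = [] \<or> hd v \<ge> 5" using that(2,3) by auto
    then show ?thesis using that(1) enc_atom_cancel[of _ u _ v] by (cases l; cases k) auto
  qed
qed (use assms in auto)

lemma enc_rule_cancel:
  assumes "enc_rule r @ u = enc_rule r' @ v" "u = [] \<or> hd u \<ge> 9" "v = [] \<or> hd v \<ge> 9"
  shows "r = r' \<and> u = v"
proof -
  obtain hs bs hs' bs' where r: "r = (hs, bs)" "r' = (hs', bs')" by fastforce
  have "concat (map enc_lit hs) @ (10 # concat (map enc_lit bs) @ u) =
      concat (map enc_lit hs') @ (10 # concat (map enc_lit bs') @ v)" using assms(1) r by simp
  then have "hs = hs' \<and> 10 # concat (map enc_lit bs) @ u = 10 # concat (map enc_lit bs') @ v"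
    by (rule enc_lits_cancel) auto
  then show ?thesis using enc_lits_cancel assms(2,3) r by blast
qed

lemma enc_instance_inject:
  "enc_instance rs q = enc_instance rs' q' \<longleftrightarrow> rs = rs' \<and> q = q'"
proof
  assume eq: "enc_instance rs q = enc_instance rs' q'"
  have "rs = rs' \<and> 11 # enc_name q = 11 # enc_name q'"
  proof (rule concat_cancel[where enc = enc_rule and A = "{9}" and B = "{11}"])
    show "enc_rule r \<noteq> [] \<and> hd (enc_rule r) \<in> {9}" for r by (cases r) auto
    show "r = r' \<and> u = v" if "enc_rule r @ u = enc_rule r' @ v"
      "u = [] \<or> hd u \<in> {9} \<union> {11}" "v = [] \<or> hd v \<in> {9} \<union> {11}" for r r' u v
      by (rule enc_rule_cancel) (use that in auto)
  qed (use eq in \<open>auto simp: enc_instance_def\<close>)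
  then show "rs = rs' \<and> q = q'" using enc_name_cancel[of q "[]" q' "[]"] by simp
qed simp

end

theory Submission
  imports Defs "HOL-Library.Countable"
begin

text \<open>A nondeterministic computation of at most \<open>2 ^ p n\<close> steps is described by relations between
  numbers below \<open>2 ^ m\<close>, where \<open>m\<close> is polynomial in \<open>n\<close>: the content of cell \<open>x\<close> of tape \<open>k\<close> at
  time \<open>t\<close>, the head positions, the state and the instruction that is executed. A number is
  represented by \<open>m\<close> arguments, its bits. All predicates have arity \<open>4 * m\<close> and are made arbitrary
  by free rules, and the program consists otherwise of constraints that force the relations to
  contain the computation. The body guard of every constraint is an atom of a predicate \<open>Grd\<close>
  with all \<open>4 * m\<close> variables; constraints force \<open>Grd\<close> to hold for all tuples of bits, starting from
  \<open>Grd 0 \<dots> 0\<close> and setting one bit at a time.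

  Where a rule depends on a position \<open>j < m\<close> (setting bit \<open>j\<close>, the binary successor with \<open>j\<close>
  trailing ones, the input symbol at position \<open>j\<close>), its text before, at and after position \<open>j\<close> is
  uniform. Hence a program with a constant number of loops over \<open>m\<close> prints all rules, and it is
  compiled to a Turing machine whose states are the stacks of commands still to be executed.\<close>

section \<open>A programming language for Turing machines\<close>

text \<open>Free rules neutralise minimality: in the reduct, the free rule of a true atom becomes a
  fact and that of a false atom disappears, so every set of atoms that violates no constraint is an
  answer set. Programs therefore only have to state conditions on relations. The obstacle is the
  open universe, which may contain elements other than the two bits. The guard separates them: it is
  forced on all bit tuples, and the model built from an accepting computation makes it true nowhere
  else, so constraints say nothing about foreign elements. One guard atom with polynomially many
  variables covers exponentially many numbers. Acceptance is not asserted at any particular time.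
  Each time below \<open>2 ^ m\<close> must carry the accepting state or an executed instruction;
  since all computations are shorter than that, only acceptance can end the chain. On the printing
  side, the polynomial bound has to be turned into an actual length \<open>m\<close> by a machine.
  It is replaced by \<open>(n + a) ^ d\<close>, which \<open>d\<close> nested loops over a word of
  length \<open>n + a\<close> produce; the input itself adds the summand \<open>n\<close>.\<close>

datatype cmd = Wr nat nat | Mv nat move | Seq cmd cmd | Cond nat nat cmd cmd | Loop nat cmd

instance move :: countable by countable_datatype
instance cmd :: countable by countable_datatype

type_synonym store = "nat \<Rightarrow> tape"

text \<open>Each clause is made to be a single Turing machine step: it inspects one tape, changes at
  most one tape and rewrites the top of the stack. A loop remains on the stack below its body until
  its tape shows a blank.\<close>

fun stp :: "cmd list \<times> store \<Rightarrow> cmd list \<times> store" where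
  "stp ([], \<sigma>) = ([], \<sigma>)"
| "stp (Wr k a # ks, \<sigma>) = (ks, \<sigma>(k := act (\<sigma> k) (a, Stay)))"
| "stp (Mv k d # ks, \<sigma>) = (ks, \<sigma>(k := act (\<sigma> k) (read (\<sigma> k), d)))"
| "stp (Seq c c' # ks, \<sigma>) = (c # c' # ks, \<sigma>)"
| "stp (Cond k a c c' # ks, \<sigma>) = ((if read (\<sigma> k) = a then c else c') # ks, \<sigma>)"
| "stp (Loop k c # ks, \<sigma>) = (if read (\<sigma> k) = 0 then ks else c # Loop k c # ks, \<sigma>)"

text \<open>This is the transition function behind \<open>stp\<close>: it sees only the symbols
  under the heads, and tapes that are not concerned get their own symbol back. \<open>None\<close>
  on the empty stack makes the machine halt there.\<close>

fun nxt :: "cmd list \<Rightarrow> nat list \<Rightarrow> (cmd list \<times> (nat \<times> move) list) option" where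
  "nxt [] as = None"
| "nxt (Wr k a # ks) as = Some (ks, (map (\<lambda>a. (a, Stay)) as)[k := (a, Stay)])"
| "nxt (Mv k d # ks) as = Some (ks, (map (\<lambda>a. (a, Stay)) as)[k := (as ! k, d)])"
| "nxt (Seq c c' # ks) as = Some (c # c' # ks, map (\<lambda>a. (a, Stay)) as)"
| "nxt (Cond k a c c' # ks) as =
     Some ((if as ! k = a then c else c') # ks, map (\<lambda>a. (a, Stay)) as)"
| "nxt (Loop k c # ks) as =
     Some (if as ! k = 0 then ks else c # Loop k c # ks, map (\<lambda>a. (a, Stay)) as)"

fun tapes_of :: "cmd \<Rightarrow> nat set" where
  "tapes_of (Wr k a) = {k}"
| "tapes_of (Mv k d) = {k}"
| "tapes_of (Seq c c') = tapes_of c \<union> tapes_of c'"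
| "tapes_of (Cond k a c c') = insert k (tapes_of c \<union> tapes_of c')"
| "tapes_of (Loop k c) = insert k (tapes_of c)"

fun syms_of :: "cmd \<Rightarrow> nat set" where
  "syms_of (Wr k a) = {a}"
| "syms_of (Mv k d) = {}"
| "syms_of (Seq c c') = syms_of c \<union> syms_of c'"
| "syms_of (Cond k a c c') = syms_of c \<union> syms_of c'"
| "syms_of (Loop k c) = syms_of c"

lemma finite_syms_of: "finite (syms_of c)"
  by (induction c) auto

text \<open>The stacks that can occur while \<open>c\<close> is executed on top of the stack \<open>ks\<close>.\<close>

fun stacks :: "cmd \<Rightarrow> cmd list \<Rightarrow> cmd list set" where
  "stacks (Wr k a) ks = {Wr k a # ks, ks}"
| "stacks (Mv k d) ks = {Mv k d # ks, ks}"
| "stacks (Seq c c') ks = insert (Seq c c' # ks) (stacks c (c' # ks) \<union> stacks c' ks)"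
| "stacks (Cond k a c c') ks = insert (Cond k a c c' # ks) (stacks c ks \<union> stacks c' ks)"
| "stacks (Loop k c) ks = {Loop k c # ks, ks} \<union> stacks c (Loop k c # ks)"

lemma stacks_start: "c # ks \<in> stacks c ks"
  by (cases c) auto

lemma finite_stacks: "finite (stacks c ks)"
  by (induction c arbitrary: ks) auto

text \<open>The exit stack \<open>ks\<close> is a member of \<open>stacks c ks\<close>, but the step
  from it executes the head of \<open>ks\<close> and may leave the set; hence the premise
  \<open>ls \<noteq> ks\<close>. For a sequence, the exit stack of the first command is the entry
  stack of the second.\<close>

lemma stacks_step:
  assumes "ls \<in> stacks c ks" "ls \<noteq> ks"
  shows "fst (stp (ls, \<sigma>)) \<in> stacks c ks"
  using assms
proof (induction c arbitrary: ks)
  case (Seq c c')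
  then show ?case using stacks_start by (cases "ls = c' # ks") auto
next
  case (Cond k a c c')
  then show ?case using stacks_start by auto
next
  case (Loop k c)
  then show ?case using stacks_start[of c "Loop k c # ks"] by (cases "ls = Loop k c # ks") auto
qed auto

lemma stacks_ok:
  "ls \<in> stacks c ks \<Longrightarrow> \<Union> (tapes_of ` set ls) \<subseteq> tapes_of c \<union> \<Union> (tapes_of ` set ks) \<and>
     \<Union> (syms_of ` set ls) \<subseteq> syms_of c \<union> \<Union> (syms_of ` set ks)"
proof (induction c arbitrary: ks)
  case (Seq c c')
  from Seq.prems consider "ls = Seq c c' # ks" | "ls \<in> stacks c (c' # ks)" | "ls \<in> stacks c' ks" by auto
  then show ?case by cases (use Seq.IH(1)[of "c' # ks"] Seq.IH(2)[of ks] in auto)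
next
  case (Cond k a c c')
  from Cond.prems consider "ls = Cond k a c c' # ks" | "ls \<in> stacks c ks" | "ls \<in> stacks c' ks" by auto
  then show ?case by cases (use Cond.IH(1)[of ks] Cond.IH(2)[of ks] in auto)
next
  case (Loop k c)
  from Loop.prems consider "ls = Loop k c # ks" | "ls = ks" | "ls \<in> stacks c (Loop k c # ks)" by auto
  then show ?case by cases (use Loop.IH(1)[of "Loop k c # ks"] in auto)
qed auto

section \<open>Compilation of commands to a Turing machine\<close>

text \<open>The bound \<open>g\<close> on the symbols keeps \<open>delta\<close> finite. Stacks
  become states through \<open>to_nat\<close>.\<close>

definition machine :: "nat \<Rightarrow> nat \<Rightarrow> cmd \<Rightarrow> tm" where
  "machine n g c = \<lparr>tapes = n, start = to_nat [c], accept = to_nat ([] :: cmd list),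
     delta = {((to_nat ls, as), (to_nat ls', bs)) | ls as ls' bs. ls \<in> stacks c [] \<and>
       as \<in> {as. set as \<subseteq> {..g} \<and> length as = n} \<and> nxt ls as = Some (ls', bs)}\<rparr>"

definition conf :: "nat \<Rightarrow> cmd list \<times> store \<Rightarrow> config" where
  "conf n = (\<lambda>(ls, \<sigma>). (to_nat ls, map \<sigma> [0..<n]))"

lemma nxt_length: "nxt ls as = Some (ls', bs) \<Longrightarrow> length bs = length as"
  by (induction ls as rule: nxt.induct) auto

lemma wf_machine: "n \<ge> 1 \<Longrightarrow> wf_tm (machine n g c)"
proof -
  assume n: "n \<ge> 1"
  let ?D = "stacks c [] \<times> {as. set as \<subseteq> {..g} \<and> length as = n}"
  let ?F = "\<lambda>(ls, as). ((to_nat ls, as), apfst to_nat (the (nxt ls as)))"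
  have "x \<in> ?F ` ?D" if x: "x \<in> delta (machine n g c)" for x
  proof -
    obtain ls as ls' bs where x: "x = ((to_nat ls, as), (to_nat ls', bs))" "nxt ls as = Some (ls', bs)"
      "(ls, as) \<in> ?D" using x unfolding machine_def by auto
    then show ?thesis by (intro rev_image_eqI[OF x(3)]) auto
  qed
  then have "delta (machine n g c) \<subseteq> ?F ` ?D" by blast
  moreover have "finite ?D" using finite_lists_length_eq[of "{..g}" n] finite_stacks by simp
  ultimately have "finite (delta (machine n g c))" by (meson finite_subset finite_imageI)
  moreover have "length as = n \<and> length bs = n \<and> s \<noteq> to_nat ([] :: cmd list)"
    if d: "((s, as), (s', bs)) \<in> delta (machine n g c)" for s as s' bs
  proof -
    obtain ls ls' where "s = to_nat ls" "nxt ls as = Some (ls', bs)" "length as = n"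
      using d unfolding machine_def by auto
    then show ?thesis using nxt_length[of ls as ls' bs] by (cases ls) auto
  qed
  moreover have "tapes (machine n g c) = n" "accept (machine n g c) = to_nat ([] :: cmd list)"
    by (simp_all add: machine_def)
  ultimately show ?thesis using n unfolding wf_tm_def by (metis (no_types, lifting))
qed

lemma deterministic_machine: "deterministic (machine n g c)"
  by (auto simp: deterministic_def machine_def single_valued_def)

lemma act_read: "act t (read t, Stay) = t"
  by (cases t) auto

lemma machine_step:
  assumes ls: "ls \<in> stacks c []" "ls \<noteq> []" and n: "tapes_of c \<subseteq> {..<n}"
    and g: "\<And>k i. fst (\<sigma> k) i \<le> g"
  shows "(conf n (ls, \<sigma>), conf n (stp (ls, \<sigma>))) \<in> step (machine n g c)"
proof -
  define as where "as = map (\<lambda>k. read (\<sigma> k)) [0..<n]"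
  have tp: "\<Union> (tapes_of ` set ls) \<subseteq> {..<n}" using stacks_ok[OF ls(1)] n by auto
  have "read (\<sigma> k) \<le> g" for k using g[of k] by (cases "\<sigma> k") auto
  then have as: "as \<in> {as. set as \<subseteq> {..g} \<and> length as = n}" by (auto simp: as_def)
  have stay: "map2 act (map \<sigma> [0..<n]) (map (\<lambda>a. (a, Stay)) as) = map \<sigma> [0..<n]"
    by (rule nth_equalityI) (auto simp: as_def act_read)
  have upd: "map2 act (map \<sigma> [0..<n]) ((map (\<lambda>a. (a, Stay)) as)[k := x]) =
      map (\<sigma>(k := act (\<sigma> k) x)) [0..<n]" for k x
    by (rule nth_equalityI) (auto simp: as_def act_read nth_list_update)
  have "\<exists>bs. nxt ls as = Some (fst (stp (ls, \<sigma>)), bs) \<and>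
      map2 act (map \<sigma> [0..<n]) bs = map (snd (stp (ls, \<sigma>))) [0..<n]"
    using ls(2) tp by (cases "(ls, \<sigma>)" rule: stp.cases) (auto simp: stay upd, auto simp: as_def)
  then obtain bs where bs: "nxt ls as = Some (fst (stp (ls, \<sigma>)), bs)"
      "map2 act (map \<sigma> [0..<n]) bs = map (snd (stp (ls, \<sigma>))) [0..<n]" by blast
  have "((to_nat ls, as), (to_nat (fst (stp (ls, \<sigma>))), bs)) \<in> delta (machine n g c)"
    using ls as bs(1) by (auto simp: machine_def)
  moreover have "as = map read (map \<sigma> [0..<n])" by (simp add: as_def)
  ultimately have "((to_nat ls, map read (map \<sigma> [0..<n])), (to_nat (fst (stp (ls, \<sigma>))), bs))
      \<in> delta (machine n g c)" by simp
  then show ?thesis unfolding step_def conf_def split_beta fst_conv snd_conv bs(2)[symmetric] by blast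
qed

lemma stp_bounded:
  assumes "\<And>k i. fst (\<sigma> k) i \<le> g" "\<Union> (syms_of ` set ls) \<subseteq> {..g}"
  shows "fst (snd (stp (ls, \<sigma>)) k) i \<le> g"
proof -
  have *: "fst (act t (a, d)) i \<le> g" if "\<And>i. fst t i \<le> g" "a \<le> g" for t a d
    using that by (cases t) auto
  have "read (\<sigma> k) \<le> g" for k using assms(1)[of k] by (cases "\<sigma> k") auto
  then show ?thesis using assms by (cases "(ls, \<sigma>)" rule: stp.cases) (auto intro!: *)
qed

text \<open>\<open>stp\<close> idles on the empty stack whereas the machine halts there, so the
  machine may need fewer steps than \<open>t\<close>.\<close>

lemma machine_steps:
  assumes "ls \<in> stacks c []" "tapes_of c \<subseteq> {..<n}" "syms_of c \<subseteq> {..g}"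
    and "\<And>k i. fst (\<sigma> k) i \<le> g" "(stp ^^ t) (ls, \<sigma>) = ([], \<sigma>')"
  shows "\<exists>t'\<le>t. (conf n (ls, \<sigma>), conf n ([], \<sigma>')) \<in> step (machine n g c) ^^ t'"
  using assms
proof (induction t arbitrary: ls \<sigma>)
  case 0
  then show ?case by simp
next
  case (Suc t)
  show ?case
  proof (cases "ls = []")
    case True
    have "(stp ^^ u) ([], \<sigma>) = ([], \<sigma>)" for u by (induction u) auto
    then have "conf n (ls, \<sigma>) = conf n ([], \<sigma>')" using True Suc.prems(5) by (metis snd_conv)
    then show ?thesis by (intro exI[of _ 0]) auto
  next
    case False
    have 1: "(conf n (ls, \<sigma>), conf n (stp (ls, \<sigma>))) \<in> step (machine n g c)"
      by (rule machine_step[OF Suc.prems(1) False Suc.prems(2,4)])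
    have "\<Union> (syms_of ` set ls) \<subseteq> {..g}" 
      using subset_trans[OF _ Suc.prems(3)] stacks_ok[OF Suc.prems(1)] by simp
    then have "fst (snd (stp (ls, \<sigma>)) k) i \<le> g" for k i by (rule stp_bounded[OF Suc.prems(4)])
    moreover have "(stp ^^ t) (fst (stp (ls, \<sigma>)), snd (stp (ls, \<sigma>))) = ([], \<sigma>')"
      using Suc.prems(5) by (simp add: funpow_swap1 del: stp.simps)
    moreover have "fst (stp (ls, \<sigma>)) \<in> stacks c []" by (rule stacks_step[OF Suc.prems(1) False])
    ultimately obtain t' where "t' \<le> t"
      "(conf n (stp (ls, \<sigma>)), conf n ([], \<sigma>')) \<in> step (machine n g c) ^^ t'"
      using Suc.IH[of "fst (stp (ls, \<sigma>))" "snd (stp (ls, \<sigma>))"] Suc.prems(2,3) by auto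
    then show ?thesis using relpow_Suc_I2[OF 1] Suc_le_mono by blast
  qed
qed

section \<open>Execution time of commands\<close>

definition initial :: "word \<Rightarrow> store" where
  "initial w = (\<lambda>_. (\<lambda>_. 0, 0))(0 := (contents w, 0))"

text \<open>An upper bound on the execution time when every loop makes at most \<open>N\<close> iterations.\<close>

fun cost :: "nat \<Rightarrow> cmd \<Rightarrow> nat" where
  "cost N (Wr k a) = 1"
| "cost N (Mv k d) = 1"
| "cost N (Seq c c') = 1 + cost N c + cost N c'"
| "cost N (Cond k a c c') = 1 + cost N c + cost N c'"
| "cost N (Loop k c) = N * (cost N c + 1) + 1"

lemma cost_poly: "\<exists>p :: nat poly. \<forall>N. poly p N = cost N c"
proof (induction c)
  case (Seq c c')
  then obtain p q :: "nat poly" where "\<forall>N. poly p N = cost N c" "\<forall>N. poly q N = cost N c'" by auto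
  then show ?case by (intro exI[of _ "1 + p + q"]) auto
next
  case (Cond k a c c')
  then obtain p q :: "nat poly" where "\<forall>N. poly p N = cost N c" "\<forall>N. poly q N = cost N c'" by auto
  then show ?case by (intro exI[of _ "1 + p + q"]) auto
next
  case (Loop k c)
  then obtain p :: "nat poly" where "\<forall>N. poly p N = cost N c" by auto
  then show ?case by (intro exI[of _ "[:0, 1:] * (p + 1) + 1"]) auto
qed (auto intro: exI[of _ 1])

text \<open>One step number serves every stack below the command, which is what allows executions to
  be chained inside an unknown continuation.\<close>

definition runs :: "nat \<Rightarrow> cmd \<Rightarrow> store \<Rightarrow> store \<Rightarrow> bool" where
  "runs N c \<sigma> \<sigma>' \<longleftrightarrow> (\<exists>t\<le>cost N c. \<forall>ks. (stp ^^ t) (c # ks, \<sigma>) = (ks, \<sigma>'))"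

text \<open>For a fixed command the cost is a polynomial in the bound on loop iterations, so a
  polynomial bound on the iterations gives polynomial time by composition. Tape \<open>n\<close> is
  the last of the \<open>Suc n\<close> tapes and thus the output tape.\<close>

lemma polytime_computable_cmd:
  fixes q :: "nat poly"
  assumes "tapes_of c \<subseteq> {..n}" "finite \<Sigma>"
    and run: "\<And>w. w \<in> lists \<Sigma> \<Longrightarrow> 0 \<notin> set (f w) \<and>
      (\<exists>\<sigma>. runs (poly q (length w)) c (initial w) \<sigma> \<and> fst (\<sigma> n) = contents (f w))"
    and "n \<ge> 1"
  shows "polytime_computable \<Sigma> f"
proof -
  obtain p :: "nat poly" where p: "\<And>N. poly p N = cost N c" using cost_poly by blast
  \<comment> \<open>A command writes only symbols that occur in it or that it has just read on the
    same tape, so this bound is never exceeded.\<close>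
  define g where "g = Max (insert 0 (syms_of c \<union> \<Sigma>))"
  have fin: "finite (insert 0 (syms_of c \<union> \<Sigma>))" using assms(2) finite_syms_of by auto
  then have g: "syms_of c \<subseteq> {..g}" "\<Sigma> \<subseteq> {..g}" unfolding g_def by (auto intro: Max_ge)
  define M where "M = machine (Suc n) g c"
  have "wf_tm M" "deterministic M" using wf_machine deterministic_machine by (auto simp: M_def)
  moreover have "0 \<notin> set (f w) \<and> (\<exists>t ca. t \<le> poly (pcompose p q) (length w) \<and>
      (init M w, ca) \<in> step M ^^ t \<and> ca \<notin> Domain (step M) \<and> fst (last (snd ca)) = contents (f w))"
    if w: "w \<in> lists \<Sigma>" for w
  proof -
    obtain \<sigma> where \<sigma>: "runs (poly q (length w)) c (initial w) \<sigma>" "fst (\<sigma> n) = contents (f w)"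
      using run[OF w] by blast
    then obtain t where t: "t \<le> cost (poly q (length w)) c" "(stp ^^ t) ([c], initial w) = ([], \<sigma>)"
      by (auto simp: runs_def)
    have "fst (initial w k) i \<le> g" for k i using w g(2)
      by (auto simp: initial_def contents_def dest!: nth_mem)
    then obtain t' where t': "t' \<le> t" "(conf (Suc n) ([c], initial w), conf (Suc n) ([], \<sigma>)) \<in> step M ^^ t'"
      unfolding M_def using machine_steps[of "[c]" c "Suc n" g "initial w" t \<sigma>] stacks_start assms(1) g(1) t(2)
      by (auto simp: lessThan_Suc_atMost)
    have ini: "conf (Suc n) ([c], initial w) = init M w"
      using \<open>n \<ge> 1\<close> by (auto simp: conf_def init_def M_def machine_def initial_def
          upt_conv_Cons map_replicate_const replicate_Suc[symmetric] simp del: upt_Suc replicate_Suc)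
    have dom: "conf (Suc n) ([], \<sigma>) \<notin> Domain (step M)"
      by (auto simp: conf_def step_def M_def machine_def)
    show ?thesis
      using t(1) t' ini dom \<sigma>(2) run[OF w]
      by (intro conjI exI[of _ t'] exI[of _ "conf (Suc n) ([], \<sigma>)"]) (auto simp: poly_pcompose p conf_def)
  qed
  ultimately show ?thesis unfolding polytime_computable_def by blast
qed


section \<open>Programs of free rules and constraints\<close>

datatype sym = Val bool | Fam nat

text \<open>An argument slot of an atom template stands for \<open>m\<close> arguments, indexed by \<open>i < m\<close>. At split
  index \<open>j\<close>, the three symbols of the slot describe the arguments with \<open>i < j\<close>, \<open>i = j\<close> and
  \<open>i > j\<close>. The arguments of an atom are grouped by \<open>i\<close>, not by slot.\<close>

type_synonym slot = "sym \<times> sym \<times> sym"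
type_synonym 'p tatom = "'p \<times> slot list"
type_synonym 'p trule = "'p tatom lit list \<times> 'p tatom lit list"

fun sel :: "nat \<Rightarrow> nat \<Rightarrow> slot \<Rightarrow> sym" where
  "sel j i (a, b, c) = (if i < j then a else if i = j then b else c)"

text \<open>The index is in unary because the printer obtains it from a head position. The head
  looking at index \<open>i\<close> stands on cell \<open>Suc i\<close>, behind a blank in cell 0;
  hence \<open>Suc i\<close> ones.\<close>

definition vname :: "nat \<Rightarrow> nat \<Rightarrow> name" where
  "vname k i = replicate k False @ replicate (Suc i) True"

fun inst :: "nat \<Rightarrow> sym \<Rightarrow> (name, name) trm" where
  "inst i (Val b) = Const [b]"
| "inst i (Fam k) = Var (vname k i)"

text \<open>With this order, one pass over the tape of index marks prints all arguments of an
  atom.\<close>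

definition args :: "nat \<Rightarrow> nat \<Rightarrow> slot list \<Rightarrow> (name, name) trm list" where
  "args m j sl = concat (map (\<lambda>i. map (\<lambda>s. inst i (sel j i s)) sl) [0..<m])"

text \<open>Unary length is harmless: the predicates depend on the simulated machine only, so these
  names are constants of the printing program.\<close>

definition pname :: "'p :: countable \<Rightarrow> name" where
  "pname p = replicate (to_nat p) True"

definition tlit :: "nat \<Rightarrow> nat \<Rightarrow> 'p :: countable tatom lit \<Rightarrow> syn_lit" where
  "tlit m j = map_lit (\<lambda>(p, sl). Reg (pname p) (args m j sl))"

definition trule :: "nat \<Rightarrow> nat \<Rightarrow> 'p :: countable trule \<Rightarrow> syn_rule" where
  "trule m j = map_prod (map (tlit m j)) (map (tlit m j))"

definition tprog :: "nat \<Rightarrow> (nat \<Rightarrow> 'p :: countable trule list) \<Rightarrow> syn_rule list" where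
  "tprog m T = concat (map (\<lambda>j. map (trule m j) (T j)) [0..<m])"

text \<open>The natural number \<open>\<rho> k < 2 ^ m\<close> is represented by the values of the variables
  \<open>vname k i\<close>, least significant bit first.\<close>

fun sbit :: "(nat \<Rightarrow> nat) \<Rightarrow> nat \<Rightarrow> sym \<Rightarrow> bool" where
  "sbit \<rho> i (Val b) = b"
| "sbit \<rho> i (Fam k) = bit (\<rho> k) i"

definition sval :: "nat \<Rightarrow> nat \<Rightarrow> (nat \<Rightarrow> nat) \<Rightarrow> slot \<Rightarrow> nat" where
  "sval m j \<rho> s = horner_sum of_bool 2 (map (\<lambda>i. sbit \<rho> i (sel j i s)) [0..<m])"

definition cells :: "nat \<Rightarrow> nat list \<Rightarrow> name list" where
  "cells m ns = concat (map (\<lambda>i. map (\<lambda>n. [bit n i]) ns) [0..<m])"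

fun fams_sym :: "sym \<Rightarrow> nat set" where
  "fams_sym (Val b) = {}"
| "fams_sym (Fam k) = {k}"

fun fams :: "slot \<Rightarrow> nat set" where
  "fams (a, b, c) = fams_sym a \<union> fams_sym b \<union> fams_sym c"

fun tsat :: "('p \<Rightarrow> nat list \<Rightarrow> bool) \<Rightarrow> nat \<Rightarrow> nat \<Rightarrow> (nat \<Rightarrow> nat) \<Rightarrow> 'p tatom lit \<Rightarrow> bool" where
  "tsat R m j \<rho> (Pos (p, sl)) = R p (map (sval m j \<rho>) sl)"
| "tsat R m j \<rho> (Naf (p, sl)) = (\<not> R p (map (sval m j \<rho>) sl))"

section \<open>Slots as binary numbers\<close>

lemma sel_same [simp]: "sel j i (a, a, a) = a"
  by simp

lemma not_bit_nat: "x < 2 ^ m \<Longrightarrow> m \<le> i \<Longrightarrow> \<not> bit x i" for x :: nat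
  by (metis bit_take_bit_iff linorder_not_less take_bit_nat_eq_self)

lemma bit_sval: "bit (sval m j \<rho> s) i \<longleftrightarrow> i < m \<and> sbit \<rho> i (sel j i s)"
  by (auto simp: sval_def bit_horner_sum_bit_iff)

lemma sval_less: "sval m j \<rho> s < 2 ^ m"
proof -
  have "horner_sum of_bool 2 bs < (2 :: nat) ^ length bs" for bs
    by (induction bs) auto
  from this[of "map (\<lambda>i. sbit \<rho> i (sel j i s)) [0..<m]"] show ?thesis by (simp add: sval_def)
qed

lemma fams_sel: "fams_sym (sel j i s) \<subseteq> fams s"
  by (cases s) auto

lemma subst_args:
  assumes "\<And>s k i. \<lbrakk>s \<in> set sl; k \<in> fams s; i < m\<rbrakk> \<Longrightarrow> \<tau> (vname k i) = [bit (\<rho> k) i]"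
  shows "map (subst_trm \<tau>) (args m j sl) = cells m (map (sval m j \<rho>) sl)"
proof -
  have "subst_trm \<tau> (inst i (sel j i s)) = [bit (sval m j \<rho> s) i]" if "s \<in> set sl" "i < m" for s i
    using fams_sel[of j i s] assms[OF that(1) _ that(2)] that(2)
    by (cases "sel j i s") (auto simp: bit_sval)
  then have "map (\<lambda>s. subst_trm \<tau> (inst i (sel j i s))) sl = map (\<lambda>n. [bit n i]) (map (sval m j \<rho>) sl)"
    if "i < m" for i using that by simp
  then show ?thesis unfolding args_def cells_def map_concat map_map
    by (intro arg_cong[where f = concat] map_cong refl) (simp add: comp_def)
qed

lemma length_args: "length (args m j sl) = m * length sl"
  by (simp add: args_def length_concat comp_def sum_list_triv)

lemma length_cells: "length (cells m ns) = m * length ns"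
  by (simp add: cells_def length_concat comp_def sum_list_triv)

text \<open>The common length fixes the block size, so the concatenation can be split again; the
  bounds ensure that the \<open>m\<close> recorded bits determine the numbers.\<close>

lemma cells_inject:
  assumes "cells m xs = cells m ys" "length xs = length ys"
    and "\<forall>x\<in>set xs. x < 2 ^ m" "\<forall>y\<in>set ys. y < 2 ^ m"
  shows "xs = ys"
proof (rule nth_equalityI[OF assms(2)])
  fix k assume k: "k < length xs"
  have eq: "map (\<lambda>i. map (\<lambda>n. [bit n i]) xs) [0..<m] = map (\<lambda>i. map (\<lambda>n. [bit n i]) ys) [0..<m]"
    using assms(1,2) unfolding cells_def by (intro concat_injective) (auto simp: set_zip)
  have "bit (xs ! k) i = bit (ys ! k) i" if "i < m" for i
  proof -
    have "map (\<lambda>n. [bit n i]) xs = map (\<lambda>n. [bit n i]) ys"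
      using eq that by (auto dest!: spec[of _ i])
    then have "map (\<lambda>n. [bit n i]) xs ! k = map (\<lambda>n. [bit n i]) ys ! k" by simp
    then show ?thesis using k assms(2) by simp
  qed
  moreover have "\<not> bit (xs ! k) i" "\<not> bit (ys ! k) i" if "\<not> i < m" for i
    using not_bit_nat[of _ m i] assms(2-4) k that by simp_all
  ultimately show "xs ! k = ys ! k" by (intro bit_eqI) metis
qed

lemma pname_inject: "pname p = pname q \<longleftrightarrow> p = q"
  by (metis pname_def length_replicate to_nat_split inj_to_nat injD)

section \<open>The program of a family of constraint templates\<close>

definition free_vars :: "slot list" where
  "free_vars = map (\<lambda>k. (Fam k, Fam k, Fam k)) [0..<4]"

definition free :: "'p \<Rightarrow> 'p trule" where
  "free p = ([Pos (p, free_vars), Naf (p, free_vars)], [])"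

text \<open>\<open>both\<close> puts the two bit constants into the program and hence into every
  universe. It asks for the middle component of a slot, since index \<open>i = j\<close> always
  exists for \<open>j < m\<close>, while the ranges below and above \<open>j\<close> can be empty.
  In \<open>guarded\<close>, a constraint without the guard has to be ground; it is the one that
  starts the guard relation.\<close>

locale constraint_templates =
  fixes m :: nat and ps :: "'p :: countable list" and pg :: 'p
    and Cs :: "nat \<Rightarrow> 'p tatom lit list list"
  assumes pg: "pg \<in> set ps"
    and ok: "\<And>j c l p sl. \<lbrakk>j < m; c \<in> set (Cs j); l \<in> set c; (p, sl) \<in> atoms_lit l\<rbrakk> \<Longrightarrow>
      p \<in> set ps \<and> length sl = 4 \<and> (\<forall>s\<in>set sl. fams s \<subseteq> {..<4})"
    and guarded: "\<And>j c. \<lbrakk>j < m; c \<in> set (Cs j)\<rbrakk> \<Longrightarrow> Pos (pg, free_vars) \<in> set c \<or>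
      (\<forall>l\<in>set c. \<forall>(p, sl)\<in>atoms_lit l. \<forall>s\<in>set sl. fams s = {})"
    and both: "\<And>b. \<exists>j<m. \<exists>c\<in>set (Cs j). \<exists>l\<in>set c. \<exists>(p, sl)\<in>atoms_lit l. \<exists>s\<in>set sl. fst (snd s) = Val b"
begin

definition templates :: "nat \<Rightarrow> 'p trule list" where
  "templates j = map free ps @ map (Pair []) (Cs j)"

definition prog :: "(name, name, name) rl set" where
  "prog = program_of (tprog m templates)"

lemma prog_cases:
  assumes "r \<in> prog"
  obtains j p where "j < m" "p \<in> set ps" "r = ({Pos (Reg (pname p) (args m j free_vars)),
      Naf (Reg (pname p) (args m j free_vars))}, {})"
  | j c where "j < m" "c \<in> set (Cs j)" "r = ({}, tlit m j ` set c)"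
  using assms by (auto simp: prog_def program_of_def tprog_def templates_def trule_def free_def tlit_def)

lemma prog_free: "\<lbrakk>j < m; p \<in> set ps\<rbrakk> \<Longrightarrow>
    ({Pos (Reg (pname p) (args m j free_vars)), Naf (Reg (pname p) (args m j free_vars))}, {}) \<in> prog"
  by (force simp: prog_def program_of_def tprog_def templates_def trule_def free_def tlit_def)

lemma prog_constraint: "\<lbrakk>j < m; c \<in> set (Cs j)\<rbrakk> \<Longrightarrow> ({}, tlit m j ` set c) \<in> prog"
  by (force simp: prog_def program_of_def tprog_def templates_def trule_def)

lemma m_pos: "m > 0"
  using both[of True] by auto

lemma length_free_vars: "length free_vars = 4"
  by (simp add: free_vars_def)

lemma atoms_prog:
  assumes "a \<in> atoms_prog prog"
  shows "\<exists>p ts. p \<in> set ps \<and> a = Reg (pname p) ts \<and> length ts = 4 * m"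
proof -
  obtain r where r: "r \<in> prog" "a \<in> atoms_rule r" using assms by (auto simp: atoms_prog_def)
  show ?thesis using r(1)
  proof (cases rule: prog_cases)
    case (1 j p)
    then show ?thesis using r(2) by (auto simp: atoms_rule_def length_args length_free_vars)
  next
    case (2 j c)
    then obtain l where l: "l \<in> set c" "a \<in> atoms_lit (tlit m j l)" using r(2) unfolding atoms_rule_def by auto
    then obtain p sl where p: "(p, sl) \<in> atoms_lit l" "a = Reg (pname p) (args m j sl)"
      by (auto simp: tlit_def lit.set_map)
    then show ?thesis using ok[OF 2(1,2) l(1) p(1)] by (auto simp: length_args)
  qed
qed

lemma is_program_prog: "is_program prog"
  unfolding is_program_def
proof (intro conjI ballI exI[of _ "\<lambda>_. 4 * m"] allI impI)
  show "finite prog" by (simp add: prog_def program_of_def)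
  show "is_rule r" if "r \<in> prog" for r
    using that by (cases rule: prog_cases) (auto simp: is_rule_def pos_def card_le_Suc0_iff_eq)
  show "length ts = 4 * m" if "Reg p ts \<in> atoms_prog prog" for p ts
    using atoms_prog[OF that] by auto
qed

lemma vars_args: "\<Union> (vars_trm ` set (args m j sl)) =
    {vname k i | k i. i < m \<and> (\<exists>s\<in>set sl. k \<in> fams_sym (sel j i s))}"
proof -
  have "vars_trm (inst i s) = (\<lambda>k. vname k i) ` fams_sym s" for i s by (cases s) auto
  moreover have "\<Union> (vars_trm ` set (args m j sl)) = (\<Union>i\<in>{..<m}. \<Union>s\<in>set sl. vars_trm (inst i (sel j i s)))"
    by (auto simp: args_def)
  ultimately show ?thesis by auto
qed

text \<open>Every variable of a template is some \<open>vname k i\<close> with \<open>k < 4\<close>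
  and \<open>i < m\<close>, and all of these are arguments of the single guard atom, so that atom
  covers every pair.\<close>

lemma loosely_guarded_prog: "loosely_guarded prog"
  unfolding loosely_guarded_def
proof (intro ballI impI)
  fix r assume "r \<in> prog" "\<not> free_rule r"
  then obtain j c where r: "j < m" "c \<in> set (Cs j)" "r = ({}, tlit m j ` set c)"
    by (cases rule: prog_cases) (auto simp: free_rule_def)
  have vars: "\<exists>k i l p sl s. x = vname k i \<and> i < m \<and> l \<in> set c \<and> (p, sl) \<in> atoms_lit l \<and> s \<in> set sl \<and>
      k \<in> fams s" if x: "x \<in> vars_rule r" for x
  proof -
    obtain l where l: "l \<in> set c" "x \<in> \<Union> (vars_atom ` atoms_lit (tlit m j l))"
      using x unfolding r(3) vars_rule_def atoms_rule_def by auto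
    then obtain p sl where p: "(p, sl) \<in> atoms_lit l" "x \<in> \<Union> (vars_trm ` set (args m j sl))"
      by (simp add: tlit_def lit.set_map vars_atom_def split_beta) (metis prod.collapse)
    then obtain k i s where "x = vname k i" "i < m" "s \<in> set sl" "k \<in> fams_sym (sel j i s)"
      unfolding vars_args by blast
    then show ?thesis using l(1) p(1) fams_sel[of j i s] by blast
  qed
  from guarded[OF r(1,2)] show "loosely_guarded_rule r"
  proof
    assume g: "Pos (pg, free_vars) \<in> set c"
    let ?a = "Reg (pname pg) (args m j free_vars) :: (name, (name, name) trm) atom"
    have "Pos ?a \<in> snd r" using g by (force simp: r(3) tlit_def)
    moreover have "x \<in> vars_atom ?a" if "x \<in> vars_rule r" for x
    proof -
      obtain k i l p sl s where x: "x = vname k i" "i < m" "l \<in> set c" "(p, sl) \<in> atoms_lit l" "s \<in> set sl"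
        "k \<in> fams s" using vars[OF \<open>x \<in> vars_rule r\<close>] by blast
      then have "k < 4" using ok[OF r(1,2)] by blast
      then have "\<exists>s\<in>set free_vars. k \<in> fams_sym (sel j i s)"
        by (intro bexI[of _ "(Fam k, Fam k, Fam k)"]) (auto simp: free_vars_def)
      then show ?thesis using x(1,2) vars_args[of j free_vars] by (auto simp: vars_atom_def)
    qed
    ultimately show ?thesis unfolding loosely_guarded_rule_def
      by (intro exI[of _ "{?a}"]) (auto simp: pos_def)
  next
    assume "\<forall>l\<in>set c. \<forall>(p, sl)\<in>atoms_lit l. \<forall>s\<in>set sl. fams s = {}"
    then have "vars_rule r = {}" using vars by fastforce
    then show ?thesis by (auto simp: loosely_guarded_rule_def)
  qed
qed

lemma preds_prog: "pname pg \<in> preds_prog prog"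
proof -
  have "Reg (pname pg) (args m 0 free_vars) \<in> atoms_prog prog"
    using prog_free[OF m_pos pg] by (force simp: atoms_prog_def atoms_rule_def)
  then show ?thesis by (force simp: preds_prog_def)
qed

lemma consts_prog: "[b] \<in> consts_prog prog"
proof -
  obtain j c l p sl s where b: "j < m" "c \<in> set (Cs j)" "l \<in> set c" "(p, sl) \<in> atoms_lit l"
      "s \<in> set sl" "fst (snd s) = Val b" using both[of b] by blast
  have "Const [b] \<in> set (args m j sl)"
  proof -
    have "inst j (sel j j s) = Const [b]" using b(6) by (cases s) auto
    then show ?thesis using b(1,5) by (force simp: args_def)
  qed
  moreover have "Reg (pname p) (args m j sl) \<in> atoms_lit (tlit m j l)"
    using b(4) by (force simp: tlit_def lit.set_map)
  then have "Reg (pname p) (args m j sl) \<in> atoms_prog prog"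
    using prog_constraint[OF b(1,2)] b(3) by (force simp: atoms_prog_def atoms_rule_def)
  ultimately show ?thesis by (force simp: consts_prog_def)
qed

section \<open>Open answer sets and relations on numbers\<close>

text \<open>If the whole body held in \<open>M\<close>, the constraint would survive in the reduct
  with its positive body, which \<open>M\<close> then violates.\<close>

lemma model_constraint:
  assumes "model M (reduct Q M)" "({}, \<beta>) \<in> Q"
  shows "\<exists>l\<in>\<beta>. \<not> sat_lit M l"
proof (rule ccontr)
  assume a: "\<not> ?thesis"
  then have "\<forall>a\<in>neg \<beta>. \<not> sat_atom M a" by (force simp: neg_def)
  then have "(Pos ` pos {}, Pos ` pos \<beta>) \<in> reduct Q M"
    using assms(2) by (force simp: reduct_def neg_def)
  then have "\<exists>l\<in>Pos ` pos \<beta>. \<not> sat_lit M l"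
    using assms(1) by (force simp: model_def sat_rule_def pos_def)
  then show False using a by (force simp: pos_def)
qed

text \<open>The relations are read off from the atoms whose arguments are bits.
  \<open>\<rho>\<close> needs no bound here, because \<open>sval\<close> looks at the lowest
  \<open>m\<close> bits only.\<close>

lemma satisfiable_imp_relations:
  assumes "satisfiable prog q"
  shows "\<exists>R :: 'p \<Rightarrow> nat list \<Rightarrow> bool. \<forall>j<m. \<forall>c\<in>set (Cs j). \<forall>\<rho>. \<not> (\<forall>l\<in>set c. tsat R m j \<rho> l)"
proof -
  obtain U M where UM: "open_answer_set prog U M" using assms by (auto simp: satisfiable_def)
  then have U: "[b] \<in> U" for b using consts_prog by (auto simp: open_answer_set_def universe_def)
  have M: "model M (reduct (ground_prog prog U) M)"
    using UM by (auto simp: open_answer_set_def answer_set_def minimal_model_def)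
  define R where "R = (\<lambda>(p :: 'p) ns. (pname p, cells m ns) \<in> M)"
  have "\<not> (\<forall>l\<in>set c. tsat R m j \<rho> l)" if c: "j < m" "c \<in> set (Cs j)" for j c \<rho>
  proof -
    define \<tau> :: "name \<Rightarrow> name" where
      "\<tau> x = [bit (\<rho> (length (takeWhile Not x))) (length (dropWhile Not x) - 1)]" for x
    have \<tau>: "\<tau> (vname k i) = [bit (\<rho> k) i]" for k i
      by (simp add: \<tau>_def vname_def takeWhile_append dropWhile_append)
    have "(subst_lit \<tau> ` {}, subst_lit \<tau> ` tlit m j ` set c) \<in> ground_prog prog U"
      using prog_constraint[OF c] U unfolding ground_prog_def
      by (intro CollectI exI[of _ \<tau>] exI[of _ "{}"] exI[of _ "tlit m j ` set c"]) (auto simp: \<tau>_def)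
    then obtain l where l: "l \<in> set c" "\<not> sat_lit M (subst_lit \<tau> (tlit m j l))"
      using model_constraint[OF M] by (auto simp: image_image)
    moreover have "map (subst_trm \<tau>) (args m j sl) = cells m (map (sval m j \<rho>) sl)" for sl
      by (rule subst_args) (simp add: \<tau>)
    ultimately have "\<not> tsat R m j \<rho> l"
      by (cases l rule: lit.exhaust) (auto simp: subst_lit_def tlit_def R_def split: prod.splits)
    then show ?thesis using l(1) by blast
  qed
  then show ?thesis by blast
qed

text \<open>The universe consists of all names, but the atoms put into the model have bits as
  arguments only. A substitution that makes the guard true therefore describes four numbers, and
  \<open>R\<close> excludes the rest of the body; minimality comes from the free rules.\<close>

lemma satisfiable_if_relations:
  assumes R: "\<And>j c \<rho>. \<lbrakk>j < m; c \<in> set (Cs j); \<forall>k. \<rho> k < 2 ^ m\<rbrakk> \<Longrightarrow> \<not> (\<forall>l\<in>set c. tsat R m j \<rho> l)"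
    and Rg: "R pg [0, 0, 0, 0]"
  shows "satisfiable prog (pname pg)"
proof -
  let ?B = "\<lambda>ns. length ns = 4 \<and> (\<forall>n\<in>set ns. n < 2 ^ m)"
  define M where "M = {(pname p, cells m ns) | p ns. p \<in> set ps \<and> ?B ns \<and> R p ns}"
  let ?Q = "ground_prog prog UNIV"
  have M_iff: "(pname p, cells m ns) \<in> M \<longleftrightarrow> R p ns" if "p \<in> set ps" "?B ns" for p ns
  proof -
    have "ns' = ns" if "cells m ns = cells m ns'" "?B ns'" for ns'
      using cells_inject[OF that(1)] that(2) \<open>?B ns\<close> by auto
    then show ?thesis using that by (auto simp: M_def pname_inject)
  qed
  have Q_cases: "(\<exists>a. r = ({Pos a, Naf a}, {})) \<or> (\<exists>j c \<tau>. j < m \<and> c \<in> set (Cs j) \<and>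
      r = ({}, (\<lambda>l. subst_lit \<tau> (tlit m j l)) ` set c))" if Q: "r \<in> ?Q" for r
  proof -
    obtain \<tau> \<alpha> \<beta> where ab: "(\<alpha>, \<beta>) \<in> prog" "r = (subst_lit \<tau> ` \<alpha>, subst_lit \<tau> ` \<beta>)"
      using Q by (auto simp: ground_prog_def)
    from ab(1) show ?thesis
    proof (cases rule: prog_cases)
      case (1 j p)
      then show ?thesis using ab(2) by (auto simp: subst_lit_def)
    next
      case (2 j c)
      then show ?thesis using ab(2) by (intro disjI2) (auto simp: image_image)
    qed
  qed
  have constr: "\<exists>l\<in>set c. \<not> sat_lit M (subst_lit \<tau> (tlit m j l))" if c: "j < m" "c \<in> set (Cs j)" for j c \<tau>
  proof (rule ccontr)
    assume neg: "\<not> ?thesis"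
    \<comment> \<open>The true guard atom lies in \<open>M\<close>, so every variable of the
      constraint takes a bit as value and the bits assemble to \<open>\<rho>\<close>. A ground
      constraint accepts any \<open>\<rho>\<close>.\<close>
    have "\<exists>\<rho> :: nat \<Rightarrow> nat. (\<forall>k. \<rho> k < 2 ^ m) \<and> (\<forall>l\<in>set c. \<forall>(p, sl)\<in>atoms_lit l. \<forall>s\<in>set sl. \<forall>k\<in>fams s. \<forall>i<m.
        \<tau> (vname k i) = [bit (\<rho> k) i])"
      using guarded[OF c]
    proof
      assume g: "Pos (pg, free_vars) \<in> set c"
      then have "sat_lit M (subst_lit \<tau> (tlit m j (Pos (pg, free_vars))))" using neg by blast
      then obtain ns where ns: "?B ns" "map (subst_trm \<tau>) (args m j free_vars) = cells m ns"
        by (auto simp: subst_lit_def tlit_def M_def)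
      define \<rho> where "\<rho> k = (if k < 4 then ns ! k else 0)" for k
      have \<rho>: "\<rho> k < 2 ^ m" for k using ns(1) by (auto simp: \<rho>_def)
      have "map (\<lambda>i. map (\<lambda>s. subst_trm \<tau> (inst i (sel j i s))) free_vars) [0..<m] =
          map (\<lambda>i. map (\<lambda>n. [bit n i]) ns) [0..<m]"
        using ns unfolding args_def cells_def map_concat
        by (intro concat_injective) (auto simp: set_zip length_free_vars comp_def)
      then have "map (\<lambda>s. subst_trm \<tau> (inst i (sel j i s))) free_vars = map (\<lambda>n. [bit n i]) ns"
        if "i < m" for i using that by auto
      then have eq: "map (\<lambda>s. subst_trm \<tau> (inst i (sel j i s))) free_vars ! k = map (\<lambda>n. [bit n i]) ns ! k"
        if "i < m" for i k using that by metis
      have "\<tau> (vname k i) = [bit (\<rho> k) i]" if "i < m" "k < 4" for i k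
        using eq[OF that(1), of k] that(2) ns(1) by (simp add: free_vars_def \<rho>_def del: sel.simps)
      moreover have "k < 4" if "l \<in> set c" "(p, sl) \<in> atoms_lit l" "s \<in> set sl" "k \<in> fams s" for l p sl s k
        using ok[OF c that(1,2)] that(3,4) by auto
      ultimately show ?thesis using \<rho> by (intro exI[of _ \<rho>]) fastforce
    next
      assume "\<forall>l\<in>set c. \<forall>(p, sl)\<in>atoms_lit l. \<forall>s\<in>set sl. fams s = {}"
      then show ?thesis by (intro exI[of _ "\<lambda>_. 0"]) fastforce
    qed
    then obtain \<rho> :: "nat \<Rightarrow> nat" where \<rho>: "\<forall>k. \<rho> k < 2 ^ m" "\<And>l p sl s k i. \<lbrakk>l \<in> set c; (p, sl) \<in> atoms_lit l; s \<in> set sl;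
        k \<in> fams s; i < m\<rbrakk> \<Longrightarrow> \<tau> (vname k i) = [bit (\<rho> k) i]" by fast
    obtain l where l: "l \<in> set c" "\<not> tsat R m j \<rho> l" using R[OF c \<rho>(1)] by blast
    obtain p sl where p: "(p, sl) \<in> atoms_lit l" by (cases l) auto
    have eq: "map (subst_trm \<tau>) (args m j sl) = cells m (map (sval m j \<rho>) sl)"
      by (rule subst_args) (use \<rho>(2)[OF l(1) p] in blast)
    have "(pname p, cells m (map (sval m j \<rho>) sl)) \<in> M \<longleftrightarrow> R p (map (sval m j \<rho>) sl)"
      using ok[OF c l(1) p] by (intro M_iff) (auto simp: sval_less)
    then have "sat_lit M (subst_lit \<tau> (tlit m j l)) \<longleftrightarrow> tsat R m j \<rho> l"
      using p eq by (cases l rule: lit.exhaust) (auto simp: subst_lit_def tlit_def)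
    then show False using neg l by blast
  qed
  have "model M (reduct ?Q M)"
    unfolding model_def
  proof
    fix r assume "r \<in> reduct ?Q M"
    then obtain \<alpha> \<beta> where r: "(\<alpha>, \<beta>) \<in> ?Q" "r = (Pos ` pos \<alpha>, Pos ` pos \<beta>)"
      "\<forall>a\<in>neg \<beta>. \<not> sat_atom M a" "\<forall>a\<in>neg \<alpha>. sat_atom M a" by (auto simp: reduct_def)
    from Q_cases[OF r(1)] show "sat_rule M r"
    proof (elim disjE exE conjE)
      fix a assume "(\<alpha>, \<beta>) = ({Pos a, Naf a}, {})"
      then show ?thesis using r(2,4) by (auto simp: sat_rule_def pos_def neg_def)
    next
      fix j c \<tau> assume c: "j < m" "c \<in> set (Cs j)" "(\<alpha>, \<beta>) = ({}, (\<lambda>l. subst_lit \<tau> (tlit m j l)) ` set c)"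
      then obtain l where l: "l \<in> \<beta>" "\<not> sat_lit M l" using constr by blast
      then obtain a where "l = Pos a" using r(3) by (cases l) (auto simp: neg_def)
      then show ?thesis using l r(2) by (force simp: sat_rule_def pos_def)
    qed
  qed
  moreover have "\<not> model J (reduct ?Q M)" if J: "J \<subset> M" for J
  proof -
    \<comment> \<open>The free rule of an atom in \<open>M\<close> but not in \<open>J\<close>
      becomes a fact of the reduct, which \<open>J\<close> violates.\<close>
    obtain p ns where p: "(pname p, cells m ns) \<notin> J" "p \<in> set ps" "?B ns" "(pname p, cells m ns) \<in> M"
      using J by (auto simp: M_def)
    define \<tau> :: "name \<Rightarrow> name" where
      "\<tau> x = [bit (ns ! (length (takeWhile Not x))) (length (dropWhile Not x) - 1)]" for x
    have \<tau>: "\<tau> (vname k i) = [bit (ns ! k) i]" for k i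
      by (simp add: \<tau>_def vname_def takeWhile_append dropWhile_append)
    have "map (subst_trm \<tau>) (args m 0 free_vars) = cells m (map (sval m 0 (nth ns)) free_vars)"
      by (rule subst_args) (simp add: \<tau>)
    also have "map (sval m 0 (nth ns)) free_vars = ns"
    proof (rule nth_equalityI)
      show "map (sval m 0 (nth ns)) free_vars ! k = ns ! k" if "k < length (map (sval m 0 (nth ns)) free_vars)" for k
      proof (rule bit_eqI)
        fix i
        have k: "k < 4" using that by (simp add: free_vars_def)
        have "ns ! k < 2 ^ m" using k p(3) by auto
        then have "\<not> bit (ns ! k) i" if "\<not> i < m" using not_bit_nat that by simp
        then show "bit (map (sval m 0 (nth ns)) free_vars ! k) i = bit (ns ! k) i"
          using k by (auto simp: free_vars_def bit_sval simp del: sel.simps)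
      qed
    qed (simp add: p length_free_vars)
    finally have eq: "map (subst_trm \<tau>) (args m 0 free_vars) = cells m ns" .
    let ?a = "Reg (pname p) (cells m ns)"
    let ?b = "Reg (pname p) (args m 0 free_vars)"
    have "(subst_lit \<tau> ` {Pos ?b, Naf ?b}, subst_lit \<tau> ` {}) \<in> ?Q"
      using prog_free[OF m_pos p(2)] unfolding ground_prog_def by blast
    then have "({Pos ?a, Naf ?a}, {}) \<in> ?Q" by (simp add: subst_lit_def eq)
    then have "(Pos ` pos {Pos ?a, Naf ?a}, Pos ` pos {}) \<in> reduct ?Q M"
      unfolding reduct_def using p(4)
      by (intro CollectI exI[of _ "{Pos ?a, Naf ?a}"] exI[of _ "{}"]) (simp add: neg_def)
    then have "({Pos ?a}, {}) \<in> reduct ?Q M" by (simp add: pos_def)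
    then show ?thesis using p(1) by (force simp: model_def sat_rule_def)
  qed
  ultimately have "answer_set ?Q M" by (simp add: answer_set_def minimal_model_def)
  moreover have "M \<subseteq> base prog UNIV"
  proof -
    have "Reg (pname p) (args m 0 free_vars) \<in> atoms_prog prog" if "p \<in> set ps" for p
      using prog_free[OF m_pos that] by (force simp: atoms_prog_def atoms_rule_def)
    then show ?thesis
      by (auto simp: M_def base_def length_cells length_args length_free_vars intro!: exI[of _ "args m 0 free_vars"])
  qed
  ultimately have "open_answer_set prog UNIV M" by (simp add: open_answer_set_def universe_def)
  moreover have "(pname pg, cells m [0, 0, 0, 0]) \<in> M" using M_iff[of pg "[0, 0, 0, 0]"] pg Rg by simp
  ultimately show ?thesis unfolding satisfiable_def by blast
qed

end


section \<open>Constraints that describe a computation\<close>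

type_synonym instr = "(nat \<times> nat list) \<times> (nat \<times> (nat \<times> move) list)"

text \<open>Every predicate has four slots, in general a time, its successor, a position and its successor;
  unused slots are filled with 0. \<open>Grd\<close> is the guard, \<open>Scc\<close> the successor relation. \<open>Inp\<close> relates
  \<open>2 ^ j - 1\<close>, whose bits below \<open>j\<close> are set, to \<open>j\<close>; so a rule that is printed for split index \<open>j\<close>
  can refer to the position \<open>j\<close>. \<open>Blk\<close> holds for the positions behind the input. \<open>Cel k a\<close>,
  \<open>Hed k\<close>, \<open>Sta s\<close> and \<open>Ins d\<close> say that tape \<open>k\<close> contains \<open>a\<close> at a given time and position, where
  its head is, which state the machine is in, and which instruction it executes.\<close>

datatype pr = Grd | Scc | Inp | Blk | Cel nat nat | Hed nat | Sta nat | Ins instr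

instance pr :: countable by countable_datatype

abbreviation zz :: slot where "zz \<equiv> (Val False, Val False, Val False)"
abbreviation vv :: "nat \<Rightarrow> slot" where "vv k \<equiv> (Fam k, Fam k, Fam k)"
abbreviation set0 :: "nat \<Rightarrow> slot" where "set0 k \<equiv> (Fam k, Val False, Fam k)"
abbreviation set1 :: "nat \<Rightarrow> slot" where "set1 k \<equiv> (Fam k, Val True, Fam k)"
abbreviation low0 :: slot where "low0 \<equiv> (Val True, Val False, Val False)"
abbreviation low1 :: slot where "low1 \<equiv> (Val True, Val True, Val False)"
abbreviation high0 :: "nat \<Rightarrow> slot" where "high0 k \<equiv> (Val True, Val False, Fam k)"
abbreviation high1 :: "nat \<Rightarrow> slot" where "high1 k \<equiv> (Val False, Val True, Fam k)"

section \<open>Arithmetic of the slots that are used\<close>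

lemma bit_less: "bit x i \<Longrightarrow> x < 2 ^ m \<Longrightarrow> i < m" for x :: nat
  using not_bit_nat not_le by blast

lemma sval_zz [simp]: "sval m j \<rho> zz = 0"
  by (rule bit_eqI) (simp add: bit_sval)

lemma sval_vv [simp]: "\<rho> k < 2 ^ m \<Longrightarrow> sval m j \<rho> (vv k) = \<rho> k"
  by (rule bit_eqI) (auto simp: bit_sval dest: bit_less)

lemma sval_set0: "\<rho> k < 2 ^ m \<Longrightarrow> sval m j \<rho> (set0 k) = unset_bit j (\<rho> k)"
  by (rule bit_eqI) (auto simp: bit_sval bit_unset_bit_iff dest: bit_less)

lemma sval_set1: "\<rho> k < 2 ^ m \<Longrightarrow> j < m \<Longrightarrow> sval m j \<rho> (set1 k) = set_bit j (\<rho> k)"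
  by (rule bit_eqI) (auto simp: bit_sval bit_set_bit_iff dest: bit_less)

lemma sval_low0 [simp]: "j < m \<Longrightarrow> sval m j \<rho> low0 = 2 ^ j - 1"
  unfolding mask_eq_exp_minus_1[symmetric] by (rule bit_eqI) (auto simp: bit_sval bit_mask_iff)

lemma sval_low1 [simp]: "j < m \<Longrightarrow> sval m j \<rho> low1 = 2 ^ Suc j - 1"
  unfolding mask_eq_exp_minus_1[symmetric] by (rule bit_eqI) (auto simp: bit_sval bit_mask_iff)

text \<open>This is the carry: incrementing turns the trailing ones into zeros and the zero at
  \<open>j\<close> into a one. Halving both numbers reduces \<open>j\<close> by one.\<close>

lemma succ_bits:
  fixes x y :: nat
  assumes "\<And>i. i < j \<Longrightarrow> bit x i \<and> \<not> bit y i" "\<not> bit x j" "bit y j" "\<And>i. i > j \<Longrightarrow> bit x i = bit y i"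
  shows "y = Suc x"
  using assms
proof (induction j arbitrary: x y)
  case 0
  have "x div 2 = y div 2" by (rule bit_eqI) (use 0(4) in \<open>simp flip: bit_Suc\<close>)
  moreover have "even x" "odd y" using 0(2,3) by (auto simp: bit_0)
  ultimately show ?case by presburger
next
  case (Suc j)
  have "y div 2 = Suc (x div 2)"
    by (rule Suc.IH) (use Suc.prems in \<open>auto simp flip: bit_Suc\<close>)
  moreover have "odd x" "even y" using Suc.prems(1)[of 0] by (auto simp: bit_0)
  ultimately show ?case by presburger
qed

lemma sval_high: "j < m \<Longrightarrow> sval m j \<rho> (high1 k) = Suc (sval m j \<rho> (high0 k))"
  by (rule succ_bits[of j]) (auto simp: bit_sval)

text \<open>The split index at which the successor rule applies to \<open>x\<close> is its lowest
  zero bit, which exists below \<open>m\<close> because \<open>x\<close> is not the largest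
  number.\<close>

lemma sval_high0:
  assumes "Suc x < 2 ^ m"
  obtains j where "j < m" "\<And>\<rho> k. \<rho> k = x \<Longrightarrow> sval m j \<rho> (high0 k) = x"
proof -
  have "\<exists>i<m. \<not> bit x i"
  proof (rule ccontr)
    assume a: "\<not> ?thesis"
    have "x = mask m" by (rule bit_eqI) (use a assms in \<open>auto simp: bit_mask_iff intro: bit_less[of x _ m]\<close>)
    then show False using assms by (simp add: mask_eq_exp_minus_1)
  qed
  then obtain j where j: "\<not> bit x j" "j < m" "\<And>i. i < j \<Longrightarrow> bit x i"
    using exists_least_iff[of "\<lambda>i. \<not> bit x i"] by (metis order.strict_trans linorder_neqE_nat)
  have "sval m j \<rho> (high0 k) = x" if "\<rho> k = x" for \<rho> k
    by (rule bit_eqI) (use j that assms in \<open>auto simp: bit_sval intro: bit_less[of x _ m]\<close>)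
  then show ?thesis using that j(2) by blast
qed

text \<open>A number arises from 0 by setting its ones, the highest bit last; the induction is on
  the number of bits.\<close>

lemma all_by_set_bit:
  assumes "Q 0" "\<And>x j. \<lbrakk>j < m; x < 2 ^ m; Q x\<rbrakk> \<Longrightarrow> Q (set_bit j x)" "x < (2 :: nat) ^ m"
  shows "Q x"
proof -
  have "\<forall>x<2 ^ k. Q x" if "k \<le> m" for k
    using that
  proof (induction k)
    case (Suc k)
    show ?case
    proof (intro allI impI)
      fix x :: nat assume x: "x < 2 ^ Suc k"
      show "Q x"
      proof (cases "x < 2 ^ k")
        case False
        then have "x - 2 ^ k < 2 ^ k" using x by simp
        moreover from this have "set_bit k (x - 2 ^ k) = x"
          using False not_bit_nat[of "x - 2 ^ k" k k] by (simp add: set_bit_eq)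
        moreover have "(2 :: nat) ^ k \<le> 2 ^ m" using Suc.prems by (intro power_increasing) auto
        ultimately show ?thesis using assms(2)[of k "x - 2 ^ k"] Suc by (metis Suc_le_lessD less_imp_le_nat order_less_le_trans)
      qed (use Suc in auto)
    qed
  qed (use assms in auto)
  then show ?thesis using assms(3) by blast
qed

section \<open>The constraints for a machine and an input\<close>

text \<open>The constraint that \<open>as\<close> implies the disjunction of \<open>bs\<close>, with the body guard.\<close>

definition cn :: "pr tatom list \<Rightarrow> pr tatom list \<Rightarrow> pr tatom lit list" where
  "cn as bs = Pos (Grd, free_vars) # map Pos as @ map Naf bs"

abbreviation sS :: "slot \<Rightarrow> slot \<Rightarrow> pr tatom" where "sS x y \<equiv> (Scc, [zz, zz, x, y])"
abbreviation sInp :: "slot \<Rightarrow> slot \<Rightarrow> pr tatom" where "sInp x y \<equiv> (Inp, [x, zz, y, zz])"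
abbreviation sBlk :: "slot \<Rightarrow> pr tatom" where "sBlk x \<equiv> (Blk, [zz, zz, x, zz])"
abbreviation sC :: "nat \<Rightarrow> nat \<Rightarrow> slot \<Rightarrow> slot \<Rightarrow> pr tatom" where "sC k a t x \<equiv> (Cel k a, [t, zz, x, zz])"
abbreviation sH :: "nat \<Rightarrow> slot \<Rightarrow> slot \<Rightarrow> pr tatom" where "sH k t x \<equiv> (Hed k, [t, zz, x, zz])"
abbreviation sSt :: "nat \<Rightarrow> slot \<Rightarrow> pr tatom" where "sSt s t \<equiv> (Sta s, [t, zz, zz, zz])"
abbreviation sIn :: "instr \<Rightarrow> slot \<Rightarrow> pr tatom" where "sIn d t \<equiv> (Ins d, [t, zz, zz, zz])"

text \<open>The predecessor is expressed by the successor relation read backwards. It does not exist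
  at position 0, where a left move leaves the head in place; hence the second constraint for
  \<open>Left\<close>.\<close>

fun moves :: "instr \<Rightarrow> nat \<Rightarrow> move \<Rightarrow> pr tatom lit list list" where
  "moves d k Stay = [cn [sIn d (vv 0), sH k (vv 0) (vv 2), sS (vv 0) (vv 1)] [sH k (vv 1) (vv 2)]]"
| "moves d k Right = [cn [sIn d (vv 0), sH k (vv 0) (vv 2), sS (vv 0) (vv 1), sS (vv 2) (vv 3)] [sH k (vv 1) (vv 3)]]"
| "moves d k Left = [cn [sIn d (vv 0), sH k (vv 0) (vv 3), sS (vv 0) (vv 1), sS (vv 2) (vv 3)] [sH k (vv 1) (vv 2)],
     cn [sIn d (vv 0), sH k (vv 0) zz, sS (vv 0) (vv 1)] [sH k (vv 1) zz]]"

definition instr_constraints :: "nat \<Rightarrow> instr \<Rightarrow> pr tatom lit list list" where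
  "instr_constraints K d = (case d of ((s, as), (s', bs)) \<Rightarrow>
     [cn [sIn d (vv 0)] [sSt s (vv 0)], cn [sIn d (vv 0), sS (vv 0) (vv 1)] [sSt s' (vv 1)]]
     @ map (\<lambda>k. cn [sIn d (vv 0), sH k (vv 0) (vv 2)] [sC k (as ! k) (vv 0) (vv 2)]) [0..<K]
     @ map (\<lambda>k. cn [sIn d (vv 0), sH k (vv 0) (vv 2), sS (vv 0) (vv 1)] [sC k (fst (bs ! k)) (vv 1) (vv 2)]) [0..<K]
     @ concat (map (\<lambda>k. moves d k (snd (bs ! k))) [0..<K]))"

text \<open>The relations may contain more than the computation, and surplus atoms could falsify it:
  a second head position exempts a cell from the frame constraint, a second symbol or state admits a
  wrong instruction or early acceptance. The uniqueness constraints exclude this. Different head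
  positions differ in some bit \<open>j\<close>, which is 0 in one and 1 in the other; each split
  index forbids this for its own bit.\<close>

definition common_constraints ::
  "nat \<Rightarrow> nat \<Rightarrow> nat \<Rightarrow> instr list \<Rightarrow> nat list \<Rightarrow> nat list \<Rightarrow> pr tatom lit list list" where
  "common_constraints K ini acc D Q \<Gamma> =
     [[Naf (Grd, [zz, zz, zz, zz])]]
     @ map (\<lambda>k. cn [] [(Grd, free_vars[k := set1 k])]) [0..<4]
     @ [cn [] [sS (high0 2) (high1 2)],
        cn [] [sInp zz zz], cn [sInp low0 (vv 2), sS (vv 2) (vv 3)] [sInp low1 (vv 3)],
        cn [sBlk (vv 2), sS (vv 2) (vv 3)] [sBlk (vv 3)], cn [sBlk (vv 2)] [sC 0 0 zz (vv 2)],
        cn [] [sSt ini zz]]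
     @ map (\<lambda>k. cn [] [sH k zz zz]) [0..<K]
     @ map (\<lambda>k. cn [] [sC k 0 zz (vv 2)]) [1..<K]
     @ [cn [sC k a (vv 0) (vv 2), sC k b (vv 0) (vv 2)] []. k \<leftarrow> [0..<K], a \<leftarrow> \<Gamma>, b \<leftarrow> \<Gamma>, a \<noteq> b]
     @ [cn [sSt s (vv 0), sSt s' (vv 0)] []. s \<leftarrow> Q, s' \<leftarrow> Q, s \<noteq> s']
     @ map (\<lambda>k. cn [sH k (vv 0) (set0 2), sH k (vv 0) (set1 3)] []) [0..<K]
     @ [cn [] (sSt acc (vv 0) # map (\<lambda>d. sIn d (vv 0)) D)]
     @ [cn [sC k a (vv 0) (vv 2), sS (vv 0) (vv 1)] [sH k (vv 0) (vv 2), sC k a (vv 1) (vv 2)]. k \<leftarrow> [0..<K], a \<leftarrow> \<Gamma>]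
     @ concat (map (instr_constraints K) D)"

text \<open>The binary digits of \<open>j\<close> do not follow the pattern below, at and above
  \<open>j\<close>, but those of \<open>2 ^ j - 1\<close> do, and \<open>Inp\<close> translates.
  \<open>None\<close> belongs to a position behind the input; one such position below
  \<open>m\<close> suffices, as \<open>Blk\<close> is propagated from there.\<close>

definition input_constraint :: "nat option \<Rightarrow> pr tatom lit list" where
  "input_constraint x = (case x of Some a \<Rightarrow> cn [sInp low0 (vv 2)] [sC 0 a zz (vv 2)]
     | None \<Rightarrow> cn [sInp low0 (vv 2)] [sBlk (vv 2)])"

text \<open>The bound on \<open>Suc t\<close> makes a reachable time and its successor numbers below
  \<open>2 ^ m\<close>. Head positions and their successors are then covered too, as a head is at
  most \<open>t\<close> cells away from the left end after \<open>t\<close> steps.\<close>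

locale computation =
  fixes M :: tm and D :: "instr list" and Q \<Gamma> :: "nat list" and w :: word and m :: nat
  assumes wf: "wf_tm M" and D: "set D = delta M"
    and Q: "start M \<in> set Q" "accept M \<in> set Q"
      "\<And>s as s' bs. ((s, as), (s', bs)) \<in> delta M \<Longrightarrow> s \<in> set Q \<and> s' \<in> set Q"
    and \<Gamma>: "0 \<in> set \<Gamma>" "set w \<subseteq> set \<Gamma>"
      "\<And>s as s' bs. ((s, as), (s', bs)) \<in> delta M \<Longrightarrow> set as \<subseteq> set \<Gamma> \<and> fst ` set bs \<subseteq> set \<Gamma>"
    and m: "length w < m" "\<And>t c. (init M w, c) \<in> step M ^^ t \<Longrightarrow> Suc t < 2 ^ m"
begin

definition Cs :: "nat \<Rightarrow> pr tatom lit list list" where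
  "Cs j = common_constraints (tapes M) (start M) (accept M) D Q \<Gamma>
     @ [input_constraint (if j < length w then Some (w ! j) else None)]"

text \<open>By induction on \<open>t\<close>, either acceptance is reachable or the relations at
  time \<open>t\<close> describe a configuration reached in exactly \<open>t\<close> steps. In the
  latter case a non-accepting state forces an instruction, whose constraints yield the next
  configuration.\<close>

lemma relations_imp_accepts:
  assumes R: "\<forall>j<m. \<forall>c\<in>set (Cs j). \<forall>\<rho>. \<not> (\<forall>l\<in>set c. tsat R m j \<rho> l)"
  shows "\<exists>c. (init M w, c) \<in> (step M)\<^sup>* \<and> fst c = accept M"
proof -
  let ?N = "2 ^ m :: nat"
  define rho :: "nat \<Rightarrow> nat \<Rightarrow> nat \<Rightarrow> nat \<Rightarrow> nat \<Rightarrow> nat" where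
    "rho a b c d = (\<lambda>k. if k = 0 then a else if k = 1 then b else if k = 2 then c else d)" for a b c d
  have rho: "rho a b c d 0 = a" "rho a b c d (Suc 0) = b" "rho a b c d 1 = b" "rho a b c d 2 = c"
    "rho a b c d 3 = d" for a b c d
    by (auto simp: rho_def)
  have mp: "m > 0" using m(1) by simp
  have fv: "free_vars = [vv 0, vv 1, vv 2, vv 3]" by (simp add: free_vars_def upt_rec)
  have G0: "R Grd [0, 0, 0, 0]"
    using R[rule_format, OF mp, of "[Naf (Grd, [zz, zz, zz, zz])]" "rho 0 0 0 0"]
    by (auto simp: Cs_def common_constraints_def)
  have cl: "cn [] [(Grd, free_vars[k := set1 k])] \<in> set (Cs j)" if "k < 4" for k j
    using that by (auto simp: Cs_def common_constraints_def)
  have Gset: "R Grd (map (sval m j (rho a b c d)) (free_vars[k := set1 k]))"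
    if "R Grd [a, b, c, d]" "j < m" "k < 4" "a < ?N" "b < ?N" "c < ?N" "d < ?N" for a b c d j k
    using R[rule_format, OF that(2) cl[OF that(3)], of "rho a b c d"] that(1,4-)
    by (auto simp: cn_def fv rho)
  have G: "R Grd [a, b, c, d]" if "a < ?N" "b < ?N" "c < ?N" "d < ?N" for a b c d
  proof -
    have "R Grd [a, 0, 0, 0]"
      by (rule all_by_set_bit[OF _ _ that(1)]) (use G0 Gset[where k = 0] in \<open>auto simp: fv rho sval_set1\<close>)
    note 1 = this
    have "R Grd [a, b, 0, 0]"
      by (rule all_by_set_bit[OF _ _ that(2)]) (use 1 Gset[where k = 1] that in \<open>auto simp: fv rho sval_set1\<close>)
    note 2 = this
    have "R Grd [a, b, c, 0]"
      by (rule all_by_set_bit[OF _ _ that(3)]) (use 2 Gset[where k = 2] that in \<open>auto simp: fv rho sval_set1\<close>)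
    note 3 = this
    show "R Grd [a, b, c, d]"
      by (rule all_by_set_bit[OF _ _ that(4)]) (use 3 Gset[where k = 3] that in \<open>auto simp: fv rho sval_set1\<close>)
  qed
  have imp: "\<exists>(p, sl)\<in>set bs. R p (map (sval m j (rho a b c d)) sl)"
    if "cn as bs \<in> set (Cs j)" "j < m" "a < ?N" "b < ?N" "c < ?N" "d < ?N"
      "\<forall>(p, sl)\<in>set as. R p (map (sval m j (rho a b c d)) sl)" for as bs a b c d j
    using R[rule_format, OF that(2,1), of "rho a b c d"] that(3-) G[OF that(3-6)]
    by (fastforce simp: cn_def fv rho)
  have com: "c \<in> set (Cs j)" if "c \<in> set (common_constraints (tapes M) (start M) (accept M) D Q \<Gamma>)" for c j
    using that by (simp add: Cs_def)
  note cc = com[unfolded common_constraints_def]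
  have N0: "0 < ?N" by simp
  have succ: "R Scc [0, 0, x, Suc x]" if x: "Suc x < ?N" for x
  proof -
    obtain j where j: "j < m" "\<And>\<rho> k. \<rho> k = x \<Longrightarrow> sval m j \<rho> (high0 k) = x" using sval_high0[OF x] by blast
    have "cn [] [sS (high0 2) (high1 2)] \<in> set (Cs j)" by (rule cc) simp
    from imp[OF this j(1), of 0 0 x 0] show ?thesis using x j by (simp add: sval_high rho)
  qed
  have inp0: "R Inp [0, 0, 0, 0]"
  proof -
    have "cn [] [sInp zz zz] \<in> set (Cs 0)" by (rule cc) simp
    from imp[OF this mp N0 N0 N0 N0] show ?thesis by simp
  qed
  have mN: "i < ?N" if "i \<le> m" for i using that less_exp[of m] by (meson le_less_trans)
  have inp: "R Inp [2 ^ i - 1, 0, i, 0]" if "i \<le> m" for i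
    using that
  proof (induction i)
    case (Suc i)
    have "cn [sInp low0 (vv 2), sS (vv 2) (vv 3)] [sInp low1 (vv 3)] \<in> set (Cs i)" by (rule cc) simp
    from imp[OF this, of 0 0 i "Suc i"] show ?case
      using Suc mN[of i] mN[of "Suc i"] succ[of i] by (simp add: rho)
  qed (use inp0 in simp)
  have inc: "R (Cel 0 (w ! i)) [0, 0, i, 0]" if "i < length w" for i
  proof -
    have "cn [sInp low0 (vv 2)] [sC 0 (w ! i) zz (vv 2)] \<in> set (Cs i)"
      using that by (auto simp: Cs_def input_constraint_def)
    from imp[OF this, of 0 0 i 0] show ?thesis using that m(1) mN[of i] inp[of i] by (simp add: rho)
  qed
  have blk0: "R Blk [0, 0, length w, 0]"
  proof -
    have "cn [sInp low0 (vv 2)] [sBlk (vv 2)] \<in> set (Cs (length w))"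
      by (auto simp: Cs_def input_constraint_def)
    from imp[OF this, of 0 0 "length w" 0] show ?thesis
      using m(1) mN[of "length w"] inp[of "length w"] by (simp add: rho)
  qed
  have blk: "R Blk [0, 0, x, 0]" if "length w \<le> x" "x < ?N" for x
    using that
  proof (induction x rule: dec_induct)
    case (step x)
    have "cn [sBlk (vv 2), sS (vv 2) (vv 3)] [sBlk (vv 3)] \<in> set (Cs 0)" by (rule cc) simp
    from imp[OF this mp, of 0 0 x "Suc x"] show ?case using step succ[of x] by (simp add: rho)
  qed (rule blk0)
  have ini0: "R (Cel 0 (contents w x)) [0, 0, x, 0]" if "x < ?N" for x
  proof (cases "x < length w")
    case False
    have "cn [sBlk (vv 2)] [sC 0 0 zz (vv 2)] \<in> set (Cs 0)" by (rule cc) simp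
    from imp[OF this mp, of 0 0 x 0] show ?thesis
      using that False blk[of x] by (simp add: rho contents_def)
  qed (simp add: inc contents_def)
  have inik: "R (Cel k 0) [0, 0, x, 0]" if "x < ?N" "0 < k" "k < tapes M" for x k
  proof -
    have "cn [] [sC k 0 zz (vv 2)] \<in> set (Cs 0)" by (rule cc) (use that in auto)
    from imp[OF this mp, of 0 0 x 0] show ?thesis using that by (simp add: rho)
  qed
  have inih: "R (Hed k) [0, 0, 0, 0]" if "k < tapes M" for k
  proof -
    have "cn [] [sH k zz zz] \<in> set (Cs 0)" by (rule cc) (use that in auto)
    from imp[OF this mp, of 0 0 0 0] show ?thesis by simp
  qed
  have inis: "R (Sta (start M)) [0, 0, 0, 0]"
  proof -
    have "cn [] [sSt (start M) zz] \<in> set (Cs 0)" by (rule cc) simp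
    from imp[OF this mp, of 0 0 0 0] show ?thesis by simp
  qed
  have cel_unique: "a = b" if "R (Cel k a) [t, 0, x, 0]" "R (Cel k b) [t, 0, x, 0]" "k < tapes M"
    "a \<in> set \<Gamma>" "b \<in> set \<Gamma>" "t < ?N" "x < ?N" for k a b t x
  proof (rule ccontr)
    assume "a \<noteq> b"
    then have "cn [sC k a (vv 0) (vv 2), sC k b (vv 0) (vv 2)] [] \<in>
        set [cn [sC k a (vv 0) (vv 2), sC k b (vv 0) (vv 2)] []. k \<leftarrow> [0..<tapes M], a \<leftarrow> \<Gamma>, b \<leftarrow> \<Gamma>, a \<noteq> b]"
      using that by force
    then have "cn [sC k a (vv 0) (vv 2), sC k b (vv 0) (vv 2)] [] \<in> set (Cs 0)"
      by (intro cc) simp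
    from imp[OF this mp, of t 0 x 0] show False using that by (simp add: rho)
  qed
  have sta_unique: "s = s'" if "R (Sta s) [t, 0, 0, 0]" "R (Sta s') [t, 0, 0, 0]"
    "s \<in> set Q" "s' \<in> set Q" "t < ?N" for s s' t
  proof (rule ccontr)
    assume "s \<noteq> s'"
    then have "cn [sSt s (vv 0), sSt s' (vv 0)] [] \<in> set (Cs 0)" by (intro cc) (use that in auto)
    from imp[OF this mp, of t 0 0 0] show False using that by (simp add: rho)
  qed
  \<comment> \<open>At split index \<open>j\<close>, clearing bit \<open>j\<close> of
    \<open>x\<close> and setting bit \<open>j\<close> of \<open>y\<close> changes neither number in
    the forbidden case, so the constraint applies to the two positions themselves.\<close>
  have hed_bit: "bit y j \<longrightarrow> bit x j" if "R (Hed k) [t, 0, x, 0]" "R (Hed k) [t, 0, y, 0]" "k < tapes M"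
    "t < ?N" "x < ?N" "y < ?N" "j < m" for k t x y j
  proof (rule ccontr)
    assume b: "\<not> (bit y j \<longrightarrow> bit x j)"
    then have "unset_bit j x = x" "set_bit j y = y" by (auto intro!: bit_eqI simp: bit_unset_bit_iff bit_set_bit_iff)
    moreover have "cn [sH k (vv 0) (set0 2), sH k (vv 0) (set1 3)] [] \<in> set (Cs j)"
      by (rule cc) (use that in auto)
    note imp[OF this \<open>j < m\<close>, of t 0 x y]
    ultimately show False using that by (simp add: rho sval_set0 sval_set1)
  qed
  have hed_unique: "x = y" if "R (Hed k) [t, 0, x, 0]" "R (Hed k) [t, 0, y, 0]" "k < tapes M"
    "t < ?N" "x < ?N" "y < ?N" for k t x y
  proof (rule bit_eqI)
    fix i
    show "bit x i = bit y i"
      using hed_bit[OF that, of i] hed_bit[OF that(2,1,3,4,6,5), of i]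
        bit_less[OF _ that(5)] bit_less[OF _ that(6)] by blast
  qed
  have choice: "R (Sta (accept M)) [t, 0, 0, 0] \<or> (\<exists>d\<in>delta M. R (Ins d) [t, 0, 0, 0])" if "t < ?N" for t
  proof -
    have "cn [] (sSt (accept M) (vv 0) # map (\<lambda>d. sIn d (vv 0)) D) \<in> set (Cs 0)" by (rule cc) simp
    from imp[OF this mp, of t 0 0 0] show ?thesis using that D by (auto simp: rho)
  qed
  have frame: "R (Cel k a) [Suc t, 0, x, 0]"
    if "R (Cel k a) [t, 0, x, 0]" "\<not> R (Hed k) [t, 0, x, 0]" "k < tapes M" "a \<in> set \<Gamma>"
      "Suc t < ?N" "x < ?N" for k a t x
  proof -
    have "cn [sC k a (vv 0) (vv 2), sS (vv 0) (vv 1)] [sH k (vv 0) (vv 2), sC k a (vv 1) (vv 2)] \<in>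
        set [cn [sC k a (vv 0) (vv 2), sS (vv 0) (vv 1)] [sH k (vv 0) (vv 2), sC k a (vv 1) (vv 2)].
          k \<leftarrow> [0..<tapes M], a \<leftarrow> \<Gamma>]"
      using that by force
    then have "cn [sC k a (vv 0) (vv 2), sS (vv 0) (vv 1)] [sH k (vv 0) (vv 2), sC k a (vv 1) (vv 2)] \<in> set (Cs 0)"
      by (intro cc) simp
    from imp[OF this mp, of t "Suc t" x 0] show ?thesis using that succ[of t] by (simp add: rho)
  qed
  have ic: "c \<in> set (Cs 0)" if "c \<in> set (instr_constraints (tapes M) d)" "d \<in> delta M" for c d
    by (rule cc) (use that D in auto)
  note ii = ic[unfolded instr_constraints_def]
  \<comment> \<open>The bound on the head positions keeps them among the representable cells;
    membership in \<open>\<Gamma>\<close> is what the uniqueness of cell contents requires.\<close>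
  define good where "good t s tps \<longleftrightarrow> length tps = tapes M \<and> s \<in> set Q \<and> R (Sta s) [t, 0, 0, 0] \<and>
    (\<forall>k<tapes M. snd (tps ! k) \<le> t \<and> R (Hed k) [t, 0, snd (tps ! k), 0] \<and>
      (\<forall>x. fst (tps ! k) x \<in> set \<Gamma>) \<and> (\<forall>x<?N. R (Cel k (fst (tps ! k) x)) [t, 0, x, 0]))" for t s tps
  have step: "\<exists>s' tps'. ((s, tps), (s', tps')) \<in> step M \<and> good (Suc t) s' tps'"
    if gd: "good t s tps" and t: "Suc t < ?N" and na: "s \<noteq> accept M" for t s tps
  proof -
    have tps: "length tps = tapes M" using gd by (simp add: good_def)
    have sat: "\<not> R (Sta (accept M)) [t, 0, 0, 0]"
      using sta_unique[of s t "accept M"] gd t na Q by (auto simp: good_def)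
    then obtain d where d: "d \<in> delta M" "R (Ins d) [t, 0, 0, 0]" using choice[of t] t by auto
    obtain s0 as s' bs where d_eq: "d = ((s0, as), (s', bs))" by (cases d) auto
    have len: "length as = tapes M" "length bs = tapes M"
      using wf d(1) unfolding wf_tm_def d_eq by blast+
    note i' = ii[OF _ d(1), unfolded d_eq split]
    have s0: "s0 = s"
    proof -
      have "cn [sIn d (vv 0)] [sSt s0 (vv 0)] \<in> set (Cs 0)" unfolding d_eq by (rule i') simp
      from imp[OF this mp, of t 0 0 0] have "R (Sta s0) [t, 0, 0, 0]" using t d(2) by (simp add: rho)
      then show ?thesis using sta_unique[of s t s0] gd t Q d(1) by (auto simp: good_def d_eq)
    qed
    have s': "R (Sta s') [Suc t, 0, 0, 0]"
    proof -
      have "cn [sIn d (vv 0), sS (vv 0) (vv 1)] [sSt s' (vv 1)] \<in> set (Cs 0)" unfolding d_eq by (rule i') simp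
      from imp[OF this mp, of t "Suc t" 0 0] show ?thesis using t d(2) succ[of t] by (simp add: rho)
    qed
    \<comment> \<open>The head is at most at \<open>t\<close>, so even the cell to its right is
      representable and a right move finds its successor.\<close>
    have hN: "snd (tps ! k) < ?N" "Suc (snd (tps ! k)) < ?N" if "k < tapes M" for k
      using gd t that unfolding good_def by (metis Suc_le_mono order.strict_trans1 Suc_lessD)+
    have as: "as = map read tps"
    proof (rule nth_equalityI)
      fix k assume k: "k < length as"
      have "cn [sIn d (vv 0), sH k (vv 0) (vv 2)] [sC k (as ! k) (vv 0) (vv 2)] \<in> set (Cs 0)"
        unfolding d_eq by (rule i') (use k len in auto)
      from imp[OF this mp, of t 0 "snd (tps ! k)" 0]
      have "R (Cel k (as ! k)) [t, 0, snd (tps ! k), 0]"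
        using t d(2) gd k len hN[of k] by (simp add: rho good_def)
      moreover have "R (Cel k (fst (tps ! k) (snd (tps ! k)))) [t, 0, snd (tps ! k), 0]"
        "fst (tps ! k) (snd (tps ! k)) \<in> set \<Gamma>"
        using gd k len hN[of k] by (auto simp: good_def)
      moreover have "as ! k \<in> set \<Gamma>" using \<Gamma>(3)[of s0 as s' bs] d(1) k unfolding d_eq by (meson nth_mem subsetD)
      ultimately have "as ! k = fst (tps ! k) (snd (tps ! k))"
        using cel_unique[of k] k len t hN[of k] by simp
      then show "as ! k = map read tps ! k" using k len tps by (cases "tps ! k") simp
    qed (simp add: len tps)
    define tps' where "tps' = map2 act tps bs"
    have "((s, tps), (s', tps')) \<in> step M"
      using d(1) unfolding step_def tps'_def d_eq s0 as by blast
    moreover have "good (Suc t) s' tps'"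
      unfolding good_def
    proof (intro conjI allI impI)
      show "length tps' = tapes M" by (simp add: tps'_def tps len)
      show "s' \<in> set Q" using Q(3)[of s0 as s' bs] d(1) by (simp add: d_eq)
      show "R (Sta s') [Suc t, 0, 0, 0]" by (rule s')
      fix k assume k: "k < tapes M"
      obtain f h where fh: "tps ! k = (f, h)" by (cases "tps ! k")
      obtain b mv where b: "bs ! k = (b, mv)" by (cases "bs ! k")
      have tk: "tps' ! k = act (f, h) (b, mv)" using k by (simp add: tps'_def tps len fh b)
      have h: "h \<le> t" "Suc h < ?N" "h < ?N" "R (Hed k) [t, 0, h, 0]" and f: "\<And>x. f x \<in> set \<Gamma>"
        "\<And>x. x < ?N \<Longrightarrow> R (Cel k (f x)) [t, 0, x, 0]"
        using gd k hN[of k] fh by (auto simp: good_def)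
      show "snd (tps' ! k) \<le> Suc t" using h(1) by (auto simp: tk split: move.splits)
      have "b \<in> set \<Gamma>" using \<Gamma>(3)[of s0 as s' bs] d(1) k len b unfolding d_eq by (metis fst_conv image_eqI nth_mem subsetD)
      then show "fst (tps' ! k) x \<in> set \<Gamma>" for x using f(1) by (simp add: tk)
      show "R (Cel k (fst (tps' ! k) x)) [Suc t, 0, x, 0]" if x: "x < ?N" for x
      proof (cases "x = h")
        case True
        have "cn [sIn d (vv 0), sH k (vv 0) (vv 2), sS (vv 0) (vv 1)] [sC k (fst (bs ! k)) (vv 1) (vv 2)] \<in> set (Cs 0)"
          unfolding d_eq by (rule i') (use k in auto)
        from imp[OF this mp, of t "Suc t" h 0] show ?thesis
          using True t d(2) h succ[of t] by (simp add: rho tk b)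
      next
        case False
        then have "\<not> R (Hed k) [t, 0, x, 0]" using hed_unique[of k t x h] h k t x by auto
        then show ?thesis using frame[of k "f x" t x] f x k t False by (simp add: tk)
      qed
      have mv: "c \<in> set (Cs 0)" if "c \<in> set (moves d k mv)" for c
        unfolding d_eq by (rule i') (use k b that in \<open>force simp: d_eq\<close>)
      show "R (Hed k) [Suc t, 0, snd (tps' ! k), 0]"
      proof (cases mv)
        case Stay
        have "cn [sIn d (vv 0), sH k (vv 0) (vv 2), sS (vv 0) (vv 1)] [sH k (vv 1) (vv 2)] \<in> set (Cs 0)"
          by (rule mv) (simp add: Stay)
        from imp[OF this mp, of t "Suc t" h 0] show ?thesis
          using Stay t d(2) h succ[of t] by (simp add: rho tk)
      next
        case Right
        have "cn [sIn d (vv 0), sH k (vv 0) (vv 2), sS (vv 0) (vv 1), sS (vv 2) (vv 3)] [sH k (vv 1) (vv 3)] \<in> set (Cs 0)"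
          by (rule mv) (simp add: Right)
        from imp[OF this mp, of t "Suc t" h "Suc h"] show ?thesis
          using Right t d(2) h succ[of t] succ[of h] by (simp add: rho tk)
      next
        case Left
        show ?thesis
        proof (cases h)
          case 0
          have "cn [sIn d (vv 0), sH k (vv 0) zz, sS (vv 0) (vv 1)] [sH k (vv 1) zz] \<in> set (Cs 0)"
            by (rule mv) (simp add: Left)
          from imp[OF this mp, of t "Suc t" 0 0] show ?thesis
            using Left t d(2) h succ[of t] 0 by (simp add: rho tk)
        next
          case (Suc h')
          have "cn [sIn d (vv 0), sH k (vv 0) (vv 3), sS (vv 0) (vv 1), sS (vv 2) (vv 3)] [sH k (vv 1) (vv 2)] \<in> set (Cs 0)"
            by (rule mv) (simp add: Left)
          from imp[OF this mp, of t "Suc t" h' h] show ?thesis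
            using Left t d(2) h succ[of t] succ[of h'] Suc by (simp add: rho tk)
        qed
      qed
    qed
    ultimately show ?thesis by blast
  qed
  have "good 0 (fst (init M w)) (snd (init M w))"
  proof -
    have "tapes M \<ge> 1" using wf by (simp add: wf_tm_def)
    moreover have "contents w x \<in> set \<Gamma>" for x using \<Gamma>(1,2) by (auto simp: contents_def)
    ultimately show ?thesis using ini0 inik inih inis Q(1) \<Gamma>(1)
      by (auto simp: good_def init_def nth_Cons split: nat.splits)
  qed
  note good0 = this
  have "(\<exists>c. (init M w, c) \<in> (step M)\<^sup>* \<and> fst c = accept M) \<or>
      (\<exists>s tps. (init M w, (s, tps)) \<in> step M ^^ t \<and> good t s tps)" for t
  proof (induction t)
    case 0
    then show ?case using good0 by (cases "init M w") auto
  next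
    case (Suc t)
    then show ?case
    proof (elim disjE exE conjE)
      fix s tps assume r: "(init M w, (s, tps)) \<in> step M ^^ t" "good t s tps"
      show ?thesis
      proof (cases "s = accept M")
        case True
        then show ?thesis using relpow_imp_rtrancl[OF r(1)] by auto
      next
        case False
        then show ?thesis using step[OF r(2) m(2)[OF r(1)]] r(1) by (meson relpow_Suc_I)
      qed
    qed auto
  qed
  \<comment> \<open>No computation has \<open>2 ^ m\<close> steps, so the second alternative is
    impossible at this time.\<close>
  from this[of "2 ^ m"] show ?thesis using m(2) by fastforce
qed

text \<open>The relations are read off from an accepting computation of length \<open>T\<close> that
  is prolonged by repeating its last configuration. From time \<open>T\<close> on no instruction is
  executed, and the accepting state satisfies the choice constraint.\<close>

lemma accepts_imp_relations:
  assumes "(init M w, c) \<in> (step M)\<^sup>*" "fst c = accept M"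
  shows "\<exists>R. R Grd [0, 0, 0, 0] \<and> (\<forall>j<m. \<forall>c\<in>set (Cs j). \<forall>\<rho>. (\<forall>k. \<rho> k < 2 ^ m) \<longrightarrow>
    \<not> (\<forall>l\<in>set c. tsat R m j \<rho> l))"
proof -
  obtain T cs where cs: "cs 0 = init M w" "cs T = c" "\<And>i. i < T \<Longrightarrow> (cs i, cs (Suc i)) \<in> step M"
    using assms(1) unfolding rtrancl_power relpow_fun_conv by blast
  define cf where "cf t = cs (min t T)" for t
  define app where "app d t \<longleftrightarrow> (\<exists>s tps s' bs. d = ((s, map read tps), (s', bs)) \<and> d \<in> delta M \<and>
    cf t = (s, tps) \<and> cf (Suc t) = (s', map2 act tps bs))" for d t
  \<comment> \<open>A step guarantees only that some instruction leads to the next configuration;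
    one is fixed for each time. The value is arbitrary from \<open>T\<close> on, so
    \<open>Ins\<close> below is restricted to times before \<open>T\<close>.\<close>
  define dd where "dd t = (SOME d. app d t)" for t
  have app: "app (dd t) t" if "t < T" for t
  proof -
    have "\<exists>d. app d t" using cs(3)[OF that] that by (auto simp: step_def cf_def app_def min_def)
    then show ?thesis unfolding dd_def by (rule someI_ex)
  qed
  have idle: "cf (Suc t) = cf t" "fst (cf t) = accept M" if "\<not> t < T" for t
    using that assms(2) cs(2) by (simp_all add: cf_def min_def)
  have len: "length (snd (cf t)) = tapes M" for t
  proof (induction t)
    case 0
    then show ?case using wf cs(1) by (simp add: cf_def init_def wf_tm_def)
  next
    case (Suc t)
    show ?case
    proof (cases "t < T")
      case True
      then obtain s tps s' bs where "((s, map read tps), (s', bs)) \<in> delta M" "cf t = (s, tps)"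
        "cf (Suc t) = (s', map2 act tps bs)" using app unfolding app_def by metis
      then show ?thesis using Suc wf unfolding wf_tm_def by auto
    qed (use Suc idle in simp)
  qed
  \<comment> \<open>The guard may hold everywhere, since representability of the arguments is
    ensured when the relations are turned into atoms.\<close>
  define R where "R p ns = (case p of Grd \<Rightarrow> True | Scc \<Rightarrow> ns ! 3 = Suc (ns ! 2)
    | Inp \<Rightarrow> Suc (ns ! 0) = 2 ^ (ns ! 2) | Blk \<Rightarrow> length w \<le> ns ! 2
    | Cel k a \<Rightarrow> fst (snd (cf (ns ! 0)) ! k) (ns ! 2) = a
    | Hed k \<Rightarrow> snd (snd (cf (ns ! 0)) ! k) = ns ! 2
    | Sta s \<Rightarrow> fst (cf (ns ! 0)) = s
    | Ins d \<Rightarrow> ns ! 0 < T \<and> dd (ns ! 0) = d)" for p and ns :: "nat list"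
  define ok where "ok j \<rho> c \<longleftrightarrow> \<not> (\<forall>l\<in>set c. tsat R m j \<rho> l)" for j \<rho> and c :: "pr tatom lit list"
  have cn_ok: "ok j \<rho> (cn as bs)"
    if "\<forall>(p, sl)\<in>set as. R p (map (sval m j \<rho>) sl) \<Longrightarrow> \<exists>(p, sl)\<in>set bs. R p (map (sval m j \<rho>) sl)" for as bs j \<rho>
    unfolding ok_def
  proof
    assume a: "\<forall>l\<in>set (cn as bs). tsat R m j \<rho> l"
    then have "\<forall>(p, sl)\<in>set as. R p (map (sval m j \<rho>) sl)" by (force simp: cn_def)
    from that[OF this] obtain p sl where "(p, sl) \<in> set bs" "R p (map (sval m j \<rho>) sl)" by blast
    moreover from this(1) have "Naf (p, sl) \<in> set (cn as bs)" by (auto simp: cn_def)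
    ultimately show False using a by fastforce
  qed
  have cf0: "cf 0 = init M w" using cs(1) by (simp add: cf_def)
  have D_ok: "\<forall>c\<in>set (instr_constraints (tapes M) d). ok j \<rho> c"
    if c: "d \<in> delta M" and r: "\<forall>k. \<rho> k < 2 ^ m" for d j \<rho>
  proof -
    have sv: "sval m j \<rho> (vv k) = \<rho> k" for j k using r by simp
    obtain s as s' bs where d: "d = ((s, as), (s', bs))" by (cases d) auto
    have ap: "as = map read (snd (cf t))" "fst (cf t) = s" "fst (cf (Suc t)) = s'"
      "snd (cf (Suc t)) = map2 act (snd (cf t)) bs" if "t < T" "dd t = d" for t
      using app[OF that(1)] that(2) unfolding app_def d by auto
    have lb: "length bs = tapes M" using wf c unfolding wf_tm_def d by blast
    have tp: "snd (cf (Suc t)) ! k = act (snd (cf t) ! k) (bs ! k)" "as ! k = read (snd (cf t) ! k)"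
      if "t < T" "dd t = d" "k < tapes M" for t k
      using ap[OF that(1,2)] that(3) len[of t] lb by auto
    have rd: "read u = fst u (snd u)" for u by (cases u) simp
    have ac1: "fst (act u v) (snd u) = fst v" for u v
      by (cases u, cases v) simp
    have ac2: "snd (act u v) = (case snd v of Left \<Rightarrow> snd u - 1 | Stay \<Rightarrow> snd u | Right \<Rightarrow> snd u + 1)" for u v
      using act.simps[of "fst u" "snd u" "fst v" "snd v"] by (simp del: act.simps)
    have tw: "fst (snd (cf (Suc t)) ! k) x = fst (bs ! k)"
      "snd (snd (cf (Suc t)) ! k) = (case snd (bs ! k) of Left \<Rightarrow> x - 1 | Stay \<Rightarrow> x | Right \<Rightarrow> x + 1)"
      if "t < T" "dd t = d" "k < tapes M" "snd (snd (cf t) ! k) = x" for t k x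
      using tp(1)[OF that(1-3)] ac1[of "snd (cf t) ! k"] ac2[of "snd (cf t) ! k"] that(4) by auto
    have mv: "\<forall>c\<in>set (moves d k (snd (bs ! k))). ok j \<rho> c" if k: "k < tapes M" for k
      using tw(2)[OF _ _ k] by (cases "snd (bs ! k)") (auto simp: R_def sv intro!: cn_ok)
    show ?thesis
      unfolding instr_constraints_def d split set_append ball_Un
    proof (intro conjI, unfold d[symmetric])
      show "\<forall>c\<in>set [cn [sIn d (vv 0)] [sSt s (vv 0)], cn [sIn d (vv 0), sS (vv 0) (vv 1)] [sSt s' (vv 1)]]. ok j \<rho> c"
        using ap by (auto simp: R_def sv intro!: cn_ok)
      show "\<forall>c\<in>set (map (\<lambda>k. cn [sIn d (vv 0), sH k (vv 0) (vv 2)] [sC k (as ! k) (vv 0) (vv 2)]) [0..<tapes M]). ok j \<rho> c"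
        using tp(2) by (auto simp: R_def sv rd intro!: cn_ok)
      show "\<forall>c\<in>set (map (\<lambda>k. cn [sIn d (vv 0), sH k (vv 0) (vv 2), sS (vv 0) (vv 1)]
          [sC k (fst (bs ! k)) (vv 1) (vv 2)]) [0..<tapes M]). ok j \<rho> c"
        using tw(1) by (auto simp: R_def sv intro!: cn_ok)
      show "\<forall>c\<in>set (concat (map (\<lambda>k. moves d k (snd (bs ! k))) [0..<tapes M])). ok j \<rho> c"
        using mv by auto
    qed
  qed
  have Dl: "\<exists>d\<in>delta M. dd t = d" if "t < T" for t using app[OF that] unfolding app_def by blast
  have frame: "fst (snd (cf (Suc t)) ! k) x = fst (snd (cf t) ! k) x"
    if "k < tapes M" "snd (snd (cf t) ! k) \<noteq> x" for t k x
  proof (cases "t < T")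
    case True
    then obtain s tps s' bs where d: "((s, map read tps), (s', bs)) \<in> delta M" "cf t = (s, tps)"
        "cf (Suc t) = (s', map2 act tps bs)" using app unfolding app_def by metis
    then have "length bs = tapes M" using wf unfolding wf_tm_def by blast
    moreover have "fst (act u v) x = fst u x" if "snd u \<noteq> x" for u v using that by (cases u; cases v) auto
    ultimately show ?thesis using d that len[of t] by auto
  qed (simp add: idle)
  have "\<forall>c\<in>set (Cs j). ok j \<rho> c" if j: "j < m" and r: "\<forall>k. \<rho> k < 2 ^ m" for j \<rho>
  proof -
    have sv: "sval m j \<rho> (vv k) = \<rho> k" for j k using r by simp
    show ?thesis
      unfolding Cs_def common_constraints_def set_append ball_Un
    proof (intro conjI)
      show "\<forall>c\<in>set [[Naf (Grd, [zz, zz, zz, zz])]]. ok j \<rho> c" by (simp add: ok_def R_def)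
      show "\<forall>c\<in>set (map (\<lambda>k. cn [] [(Grd, free_vars[k := set1 k])]) [0..<4]). ok j \<rho> c"
        by (auto simp: R_def intro!: cn_ok)
      have "ok j \<rho> (cn [sInp low0 (vv 2), sS (vv 2) (vv 3)] [sInp low1 (vv 3)])"
      proof (rule cn_ok)
        have "Suc (2 ^ Suc j - 1) = 2 ^ Suc j" for j by simp
        moreover assume "\<forall>(p, sl)\<in>set [sInp low0 (vv 2), sS (vv 2) (vv 3)]. R p (map (sval m j \<rho>) sl)"
        \<comment> \<open>At \<open>low0\<close> the relation \<open>Inp\<close> reads
          \<open>2 ^ j = 2 ^ \<rho> 2\<close>, which determines the position.\<close>
        then have "\<rho> 2 = j" "\<rho> 3 = Suc j" using j by (auto simp: R_def sv)
        ultimately show "\<exists>(p, sl)\<in>set [sInp low1 (vv 3)]. R p (map (sval m j \<rho>) sl)"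
          using j by (simp add: R_def sv del: power_Suc)
      qed
      then show "\<forall>c\<in>set [cn [] [sS (high0 2) (high1 2)],
          cn [] [sInp zz zz], cn [sInp low0 (vv 2), sS (vv 2) (vv 3)] [sInp low1 (vv 3)],
          cn [sBlk (vv 2), sS (vv 2) (vv 3)] [sBlk (vv 3)], cn [sBlk (vv 2)] [sC 0 0 zz (vv 2)],
          cn [] [sSt (start M) zz]]. ok j \<rho> c"
        using j by (auto simp: R_def sv cf0 init_def contents_def sval_high intro!: cn_ok)
      show "\<forall>c\<in>set (map (\<lambda>k. cn [] [sH k zz zz]) [0..<tapes M]). ok j \<rho> c"
        "\<forall>c\<in>set (map (\<lambda>k. cn [] [sC k 0 zz (vv 2)]) [1..<tapes M]). ok j \<rho> c"
        by (auto simp: R_def cf0 init_def nth_Cons split: nat.splits intro!: cn_ok)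
      show "\<forall>c\<in>set [cn [sC k a (vv 0) (vv 2), sC k b (vv 0) (vv 2)] []. k \<leftarrow> [0..<tapes M], a \<leftarrow> \<Gamma>, b \<leftarrow> \<Gamma>, a \<noteq> b]. ok j \<rho> c"
        "\<forall>c\<in>set [cn [sSt s (vv 0), sSt s' (vv 0)] []. s \<leftarrow> Q, s' \<leftarrow> Q, s \<noteq> s']. ok j \<rho> c"
        by (auto simp: R_def sv intro!: cn_ok)
      have "set_bit j y \<noteq> unset_bit j x" for x y :: nat
        by (metis bit_set_bit_iff bit_unset_bit_iff possible_bit_nat)
      then show "\<forall>c\<in>set (map (\<lambda>k. cn [sH k (vv 0) (set0 2), sH k (vv 0) (set1 3)] []) [0..<tapes M]). ok j \<rho> c"
        using r j by (auto simp: R_def sv sval_set0 sval_set1 intro!: cn_ok)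
      show "\<forall>c\<in>set [cn [] (sSt (accept M) (vv 0) # map (\<lambda>d. sIn d (vv 0)) D)]. ok j \<rho> c"
        using Dl[of "\<rho> 0"] idle(2)[of "\<rho> 0"] D
        by (cases "\<rho> 0 < T") (auto simp: R_def sv intro!: cn_ok)
      show "\<forall>c\<in>set [cn [sC k a (vv 0) (vv 2), sS (vv 0) (vv 1)] [sH k (vv 0) (vv 2), sC k a (vv 1) (vv 2)].
          k \<leftarrow> [0..<tapes M], a \<leftarrow> \<Gamma>]. ok j \<rho> c"
        by (auto simp: R_def sv intro!: cn_ok) (metis frame)
      show "\<forall>c\<in>set (concat (map (instr_constraints (tapes M)) D)). ok j \<rho> c"
        using D_ok[OF _ r] D by auto
      show "\<forall>c\<in>set [input_constraint (if j < length w then Some (w ! j) else None)]. ok j \<rho> c"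
        using j by (auto simp: R_def sv cf0 init_def contents_def input_constraint_def intro!: cn_ok)
    qed
  qed
  then show ?thesis by (intro exI[of _ R]) (auto simp: R_def ok_def)
qed

end


section \<open>Printing the program\<close>

lemma runs_Wr: "runs N (Wr k a) \<sigma> (\<sigma>(k := act (\<sigma> k) (a, Stay)))"
  unfolding runs_def by (intro exI[of _ 1]) auto

lemma runs_Mv: "runs N (Mv k d) \<sigma> (\<sigma>(k := act (\<sigma> k) (read (\<sigma> k), d)))"
  unfolding runs_def by (intro exI[of _ 1]) auto

lemma runs_Seq:
  assumes "runs N c \<sigma> \<sigma>'" "runs N c' \<sigma>' \<sigma>''"
  shows "runs N (Seq c c') \<sigma> \<sigma>''"
proof -
  obtain t where t: "t \<le> cost N c" "\<And>ks. (stp ^^ t) (c # ks, \<sigma>) = (ks, \<sigma>')"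
    using assms(1) unfolding runs_def by blast
  obtain t' where t': "t' \<le> cost N c'" "\<And>ks. (stp ^^ t') (c' # ks, \<sigma>') = (ks, \<sigma>'')"
    using assms(2) unfolding runs_def by blast
  have "(stp ^^ (t' + (t + 1))) (Seq c c' # ks, \<sigma>) = (ks, \<sigma>'')" for ks
    by (simp only: funpow_add comp_apply funpow.simps(2) One_nat_def funpow.simps(1) id_apply
        stp.simps t(2) t'(2))
  then show ?thesis using t(1) t'(1) unfolding runs_def by (intro exI[of _ "t' + (t + 1)"]) auto
qed

lemma runs_Cond:
  assumes "read (\<sigma> k) = a \<Longrightarrow> runs N c \<sigma> \<sigma>'" "read (\<sigma> k) \<noteq> a \<Longrightarrow> runs N c' \<sigma> \<sigma>'"
  shows "runs N (Cond k a c c') \<sigma> \<sigma>'"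
proof -
  let ?c = "if read (\<sigma> k) = a then c else c'"
  have "runs N ?c \<sigma> \<sigma>'" using assms by auto
  then obtain t where t: "t \<le> cost N ?c" "\<And>ks. (stp ^^ t) (?c # ks, \<sigma>) = (ks, \<sigma>')"
    unfolding runs_def by blast
  have "(stp ^^ (t + 1)) (Cond k a c c' # ks, \<sigma>) = (ks, \<sigma>')" for ks
    by (simp only: funpow_add comp_apply funpow.simps(2) One_nat_def funpow.simps(1) id_apply
        stp.simps t(2))
  then show ?thesis using t(1) unfolding runs_def
    by (intro exI[of _ "t + 1"]) (auto split: if_splits)
qed

lemma runs_Loop:
  assumes "l \<le> N" "\<And>i. i < l \<Longrightarrow> read (s i k) \<noteq> 0" "\<And>i. i < l \<Longrightarrow> runs N c (s i) (s (Suc i))"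
    and "read (s l k) = 0"
  shows "runs N (Loop k c) (s 0) (s l)"
proof -
  have "\<exists>t\<le>(l - i) * (cost N c + 1) + 1. \<forall>ks. (stp ^^ t) (Loop k c # ks, s i) = (ks, s l)" if "i \<le> l" for i
    using that
  proof (induction i rule: inc_induct)
    case base
    show ?case using assms(4) by (intro exI[of _ 1]) auto
  next
    case (step i)
    obtain t where t: "t \<le> (l - Suc i) * (cost N c + 1) + 1"
      "\<And>ks. (stp ^^ t) (Loop k c # ks, s (Suc i)) = (ks, s l)" using step.IH by blast
    obtain t' where t': "t' \<le> cost N c" "\<And>ks. (stp ^^ t') (c # ks, s i) = (ks, s (Suc i))"
      using assms(3)[of i] step unfolding runs_def by auto
    have "(stp ^^ (t + (t' + 1))) (Loop k c # ks, s i) = (ks, s l)" for ks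
      using assms(2)[of i] step(2)
      by (simp only: funpow_add comp_apply funpow.simps(2) One_nat_def funpow.simps(1) id_apply
          stp.simps t(2) t'(2) if_False)
    moreover have "l - i = Suc (l - Suc i)" using step by simp
    ultimately show ?case using t(1) t'(1) by (intro exI[of _ "t + (t' + 1)"]) auto
  qed
  from this[of 0] obtain t where "t \<le> l * (cost N c + 1) + 1"
    "\<forall>ks. (stp ^^ t) (Loop k c # ks, s 0) = (ks, s l)" by auto
  moreover have "l * (cost N c + 1) \<le> N * (cost N c + 1)" using assms(1) by (rule mult_le_mono1)
  ultimately show ?thesis unfolding runs_def by (intro exI[of _ t]) auto
qed

definition skip :: cmd where
  "skip = Mv 0 Stay"

lemma runs_skip: "runs N skip \<sigma> \<sigma>"
  using runs_Mv[of N 0 Stay \<sigma>] by (simp add: skip_def act_read)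

fun seqs :: "cmd list \<Rightarrow> cmd" where
  "seqs [] = skip"
| "seqs (c # cs) = Seq c (seqs cs)"

lemma runs_seqs_map:
  assumes "\<And>i. i < length xs \<Longrightarrow> runs N (f (xs ! i)) (s i) (s (Suc i))"
  shows "runs N (seqs (map f xs)) (s 0) (s (length xs))"
  using assms
proof (induction xs arbitrary: s)
  case (Cons x xs)
  have "runs N (seqs (map f xs)) (s (Suc 0)) (s (Suc (length xs)))"
    using Cons.IH[of "\<lambda>i. s (Suc i)"] Cons.prems[of "Suc i" for i] by simp
  then show ?case using Cons.prems[of 0] by (auto intro: runs_Seq)
qed (simp add: runs_skip)

lemma runs_each:
  assumes "\<And>k \<tau>. \<lbrakk>a \<le> k; k < b; \<tau> k = \<sigma> k\<rbrakk> \<Longrightarrow> runs N (f k) \<tau> (\<tau>(k := y k))"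
  shows "runs N (seqs (map f [a..<b])) \<sigma> (\<lambda>k. if a \<le> k \<and> k < b then y k else \<sigma> k)"
proof -
  let ?s = "\<lambda>i k. if a \<le> k \<and> k < a + i then y k else \<sigma> k"
  have "runs N (f ([a..<b] ! i)) (?s i) (?s (Suc i))" if "i < length [a..<b]" for i
  proof -
    have "runs N (f (a + i)) (?s i) ((?s i)(a + i := y (a + i)))"
      using that by (intro assms) auto
    moreover have "(?s i)(a + i := y (a + i)) = ?s (Suc i)" by auto
    ultimately show ?thesis using that by simp
  qed
  from runs_seqs_map[of "[a..<b]" N f ?s, OF this]
  have "runs N (seqs (map f [a..<b])) (?s 0) (?s (b - a))" by simp
  moreover have "?s 0 = \<sigma>" "?s (b - a) = (\<lambda>k. if a \<le> k \<and> k < b then y k else \<sigma> k)"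
    by (auto simp: fun_eq_iff)
  ultimately show ?thesis by simp
qed

section \<open>Work tapes, output tape and loops over words\<close>

text \<open>The blank in cell 0 lets a loop that moves to the left stop there.\<close>

definition wt :: "word \<Rightarrow> nat \<Rightarrow> tape" where
  "wt u h = (contents (0 # u), h)"

text \<open>The result has to start in cell 0 of the last tape, so this tape has no blank in front;
  its head only moves to the right.\<close>

definition ot :: "word \<Rightarrow> tape" where
  "ot u = (contents u, length u)"

lemma read_wt: "read (wt u (Suc i)) = contents u i" "read (wt u 0) = 0"
  by (auto simp: wt_def contents_def)

lemma contents_nonzero: "0 \<notin> set u \<Longrightarrow> contents u i = 0 \<longleftrightarrow> length u \<le> i"
  by (metis contents_def linorder_not_less nth_mem)

lemma contents_append: "(contents u)(length u := a) = contents (u @ [a])"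
  by (auto simp: contents_def nth_append)

lemma runs_left: "\<sigma> k = wt u (Suc h) \<Longrightarrow> runs N (Mv k Left) \<sigma> (\<sigma>(k := wt u h))"
  using runs_Mv[of N k Left \<sigma>] by (simp add: wt_def)

lemma runs_right: "\<sigma> k = wt u h \<Longrightarrow> runs N (Mv k Right) \<sigma> (\<sigma>(k := wt u (Suc h)))"
  using runs_Mv[of N k Right \<sigma>] by (simp add: wt_def)

definition put :: "nat \<Rightarrow> nat \<Rightarrow> cmd" where
  "put k a = Seq (Wr k a) (Mv k Right)"

lemma runs_put_ot: "\<sigma> k = ot u \<Longrightarrow> runs N (put k a) \<sigma> (\<sigma>(k := ot (u @ [a])))"
  using runs_Seq[OF runs_Wr[of N k a \<sigma>] runs_Mv[of N k Right]]
  by (simp add: put_def ot_def contents_append)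

text \<open>A work tape with the head just behind its word \<open>u\<close> is the output tape of
  \<open>0 # u\<close>.\<close>

lemma runs_put_wt:
  "\<sigma> k = wt u (Suc (length u)) \<Longrightarrow> runs N (put k a) \<sigma> (\<sigma>(k := wt (u @ [a]) (Suc (length (u @ [a])))))"
  using runs_put_ot[of \<sigma> k "0 # u" N a] by (simp add: ot_def wt_def)

definition rewind :: "nat \<Rightarrow> cmd" where
  "rewind k = Loop k (Mv k Left)"

lemma runs_rewind:
  assumes "\<sigma> k = wt u h" "0 \<notin> set u" "h \<le> length u" "h \<le> N"
  shows "runs N (rewind k) \<sigma> (\<sigma>(k := wt u 0))"
proof -
  have "runs N (Loop k (Mv k Left)) (\<sigma>(k := wt u (h - 0))) (\<sigma>(k := wt u (h - h)))"
  proof (rule runs_Loop[where s = "\<lambda>i. \<sigma>(k := wt u (h - i))"])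
    show "read ((\<sigma>(k := wt u (h - i))) k) \<noteq> 0" if "i < h" for i
    proof -
      have "h - i = Suc (h - Suc i)" using that by simp
      then show ?thesis using assms(2,3) that by (simp add: read_wt contents_nonzero)
    qed
    show "runs N (Mv k Left) (\<sigma>(k := wt u (h - i))) (\<sigma>(k := wt u (h - Suc i)))" if "i < h" for i
      using that runs_left[of "\<sigma>(k := wt u (h - i))" k u "h - Suc i" N] by (simp add: Suc_diff_Suc)
  qed (use assms in \<open>auto simp: read_wt\<close>)
  moreover have "\<sigma>(k := wt u h) = \<sigma>" using assms(1) by auto
  ultimately show ?thesis by (simp add: rewind_def)
qed

text \<open>The loop ends on the blank behind the word, where \<open>rewind\<close> would stop at
  once; hence the left move before it.\<close>

definition for_each :: "nat \<Rightarrow> cmd \<Rightarrow> cmd" where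
  "for_each k c = seqs [Mv k Right, Loop k (Seq c (Mv k Right)), Mv k Left, rewind k]"

lemma runs_for_each:
  assumes "0 \<notin> set u" "length u \<le> N" "\<And>i. i \<le> length u \<Longrightarrow> s i k = wt u 0"
    and "\<And>i. i < length u \<Longrightarrow> runs N c ((s i)(k := wt u (Suc i))) ((s (Suc i))(k := wt u (Suc i)))"
  shows "runs N (for_each k c) (s 0) (s (length u))"
proof -
  let ?l = "length u"
  have "runs N (Mv k Right) (s 0) ((s 0)(k := wt u (Suc 0)))"
    using assms(3) by (intro runs_right) auto
  moreover have "runs N (Loop k (Seq c (Mv k Right))) ((s 0)(k := wt u (Suc 0))) ((s ?l)(k := wt u (Suc ?l)))"
  proof (rule runs_Loop[where s = "\<lambda>i. (s i)(k := wt u (Suc i))"])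
    fix i assume i: "i < ?l"
    have "runs N (Mv k Right) ((s (Suc i))(k := wt u (Suc i))) ((s (Suc i))(k := wt u (Suc (Suc i))))"
      using runs_right[of "(s (Suc i))(k := wt u (Suc i))" k] by simp
    then show "runs N (Seq c (Mv k Right)) ((s i)(k := wt u (Suc i))) ((s (Suc i))(k := wt u (Suc (Suc i))))"
      using assms(4)[OF i] runs_Seq by blast
  qed (use assms in \<open>auto simp: read_wt contents_nonzero\<close>)
  moreover have "runs N (Mv k Left) ((s ?l)(k := wt u (Suc ?l))) ((s ?l)(k := wt u ?l))"
    using runs_left[of "(s ?l)(k := wt u (Suc ?l))" k u ?l] by simp
  moreover have "runs N (rewind k) ((s ?l)(k := wt u ?l)) (s ?l)"
    using runs_rewind[of "(s ?l)(k := wt u ?l)" k u ?l N] assms by (simp add: fun_upd_idem)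
  ultimately show ?thesis unfolding for_each_def seqs.simps by (blast intro: runs_Seq runs_skip)
qed

section \<open>Commands that append to the output\<close>

text \<open>All other tapes are restored, so such commands can be chained with an unchanged
  \<open>\<sigma>\<close>.\<close>

definition emits :: "nat \<Rightarrow> nat \<Rightarrow> cmd \<Rightarrow> store \<Rightarrow> word \<Rightarrow> bool" where
  "emits out N c \<sigma> u \<longleftrightarrow> (\<forall>v. runs N c (\<sigma>(out := ot v)) (\<sigma>(out := ot (v @ u))))"

lemma emits_Seq: "\<lbrakk>emits out N c \<sigma> u; emits out N c' \<sigma> u'\<rbrakk> \<Longrightarrow> emits out N (Seq c c') \<sigma> (u @ u')"
  unfolding emits_def by (metis append.assoc runs_Seq)

lemma emits_skip: "emits out N skip \<sigma> []"
  by (simp add: emits_def runs_skip)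

lemma emits_seqs:
  "(\<And>x. x \<in> set xs \<Longrightarrow> emits out N (f x) \<sigma> (g x)) \<Longrightarrow> emits out N (seqs (map f xs)) \<sigma> (concat (map g xs))"
  by (induction xs) (auto intro: emits_Seq emits_skip)

lemma emits_Cond:
  "\<lbrakk>k \<noteq> out; read (\<sigma> k) = a \<Longrightarrow> emits out N c \<sigma> u; read (\<sigma> k) \<noteq> a \<Longrightarrow> emits out N c' \<sigma> u\<rbrakk> \<Longrightarrow>
    emits out N (Cond k a c c') \<sigma> u"
  unfolding emits_def by (auto intro!: runs_Cond)

lemma emits_for_each:
  assumes "k \<noteq> out" "0 \<notin> set u" "length u \<le> N" "\<sigma> k = wt u 0"
    and "\<And>i. i < length u \<Longrightarrow> emits out N c (\<sigma>(k := wt u (Suc i))) (g i)"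
  shows "emits out N (for_each k c) \<sigma> (concat (map g [0..<length u]))"
  unfolding emits_def
proof
  fix v
  let ?s = "\<lambda>i. \<sigma>(out := ot (v @ concat (map g [0..<i])))"
  have "runs N (for_each k c) (?s 0) (?s (length u))"
  proof (rule runs_for_each[of u N ?s])
    fix i assume "i < length u"
    from assms(5)[OF this, unfolded emits_def, rule_format, of "v @ concat (map g [0..<i])"]
    show "runs N c ((?s i)(k := wt u (Suc i))) ((?s (Suc i))(k := wt u (Suc i)))"
      using assms(1) by (simp add: fun_upd_twist)
  qed (use assms in auto)
  then show "runs N (for_each k c) (\<sigma>(out := ot v)) (\<sigma>(out := ot (v @ concat (map g [0..<length u]))))"
    by simp
qed

definition outs :: "nat \<Rightarrow> word \<Rightarrow> cmd" where
  "outs out u = seqs (map (put out) u)"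

lemma emits_outs: "emits out N (outs out u) \<sigma> u"
proof -
  have "emits out N (put out a) \<sigma> [a]" for a
    unfolding emits_def using runs_put_ot[of "\<sigma>(out := ot v)" out v N a for v] by simp
  then have "emits out N (outs out u) \<sigma> (concat (map (\<lambda>a. [a]) u))"
    unfolding outs_def by (intro emits_seqs) auto
  then show ?thesis by simp
qed

text \<open>Tape 1 holds the input padded to length \<open>m\<close>. The symbols 3, 2, 1 on tape 2 mark the
  indices below, at and above the split index. Tape 3 is used to print indices in unary.\<close>

definition marks :: "nat \<Rightarrow> nat \<Rightarrow> word" where
  "marks m j = map (\<lambda>i. if i < j then 3 else if i = j then 2 else 1) [0..<m]"

text \<open>The head position on tape 2 is the number to print. The first loop walks to the blank in
  cell 0, printing one symbol per cell and counting on tape 3; the second loop uses this count to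
  bring both heads back.\<close>

definition unary :: "nat \<Rightarrow> cmd" where
  "unary out = Seq (Loop 2 (seqs [put out 2, Mv 2 Left, Mv 3 Right])) (Loop 3 (seqs [Mv 3 Left, Mv 2 Right]))"

lemma emits_unary:
  assumes out: "out > 3" and \<sigma>: "\<sigma> 2 = wt x (Suc i)" "\<sigma> 3 = wt y 0"
    and "i < length x" "i < length y" "0 \<notin> set x" "0 \<notin> set y" "Suc i \<le> N"
  shows "emits out N (unary out) \<sigma> (replicate (Suc i) 2)"
  unfolding emits_def
proof
  fix v
  let ?s = "\<lambda>r. \<sigma>(out := ot (v @ replicate r 2), 2 := wt x (Suc i - r), 3 := wt y r)"
  have "runs N (Loop 2 (seqs [put out 2, Mv 2 Left, Mv 3 Right])) (?s 0) (?s (Suc i))"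
  proof (rule runs_Loop[where s = ?s])
    fix r assume r: "r < Suc i"
    then show "read (?s r 2) \<noteq> 0"
      using assms(4,6) by (simp add: Suc_diff_le read_wt contents_nonzero)
    have "runs N (put out 2) (?s r) ((?s r)(out := ot (v @ replicate (Suc r) 2)))"
      using runs_put_ot[of "?s r" out "v @ replicate r 2" N 2] out by (simp add: replicate_append_same)
    moreover have "runs N (Mv 2 Left) ((?s r)(out := ot (v @ replicate (Suc r) 2)))
        ((?s r)(out := ot (v @ replicate (Suc r) 2), 2 := wt x (i - r)))"
      using r out by (intro runs_left) (simp add: Suc_diff_le)
    moreover have "runs N (Mv 3 Right) ((?s r)(out := ot (v @ replicate (Suc r) 2), 2 := wt x (i - r)))
        ((?s r)(out := ot (v @ replicate (Suc r) 2), 2 := wt x (i - r), 3 := wt y (Suc r)))"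
      using out by (intro runs_right) simp
    moreover have "(?s r)(out := ot (v @ replicate (Suc r) 2), 2 := wt x (i - r), 3 := wt y (Suc r)) = ?s (Suc r)"
      using out by auto
    ultimately show "runs N (seqs [put out 2, Mv 2 Left, Mv 3 Right]) (?s r) (?s (Suc r))"
      unfolding seqs.simps by (auto intro: runs_Seq runs_skip)
  qed (use assms(8) in \<open>auto simp: read_wt\<close>)
  moreover let ?t = "\<lambda>r. \<sigma>(out := ot (v @ replicate (Suc i) 2), 2 := wt x r, 3 := wt y (Suc i - r))"
  have "runs N (Loop 3 (seqs [Mv 3 Left, Mv 2 Right])) (?t 0) (?t (Suc i))"
  proof (rule runs_Loop[where s = ?t])
    fix r assume r: "r < Suc i"
    then show "read (?t r 3) \<noteq> 0"
      using assms(5,7) by (simp add: Suc_diff_le read_wt contents_nonzero)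
    have "runs N (Mv 3 Left) (?t r) ((?t r)(3 := wt y (i - r)))"
      using r by (intro runs_left) (simp add: Suc_diff_le)
    moreover have "runs N (Mv 2 Right) ((?t r)(3 := wt y (i - r))) ((?t r)(3 := wt y (i - r), 2 := wt x (Suc r)))"
      by (intro runs_right) simp
    moreover have "(?t r)(3 := wt y (i - r), 2 := wt x (Suc r)) = ?t (Suc r)" by auto
    ultimately show "runs N (seqs [Mv 3 Left, Mv 2 Right]) (?t r) (?t (Suc r))"
      unfolding seqs.simps by (auto intro: runs_Seq runs_skip)
  qed (use assms(8) in \<open>auto simp: read_wt\<close>)
  moreover have "?s (Suc i) = ?t 0" by auto
  moreover have "?s 0 = \<sigma>(out := ot v)" "?t (Suc i) = \<sigma>(out := ot (v @ replicate (Suc i) 2))"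
    using \<sigma> out by (auto simp: fun_eq_iff)
  ultimately show "runs N (unary out) (\<sigma>(out := ot v)) (\<sigma>(out := ot (v @ replicate (Suc i) 2)))"
    unfolding unary_def by (auto intro: runs_Seq)
qed

fun emit_sym :: "nat \<Rightarrow> sym \<Rightarrow> cmd" where
  "emit_sym out (Val b) = outs out (enc_trm (Const [b]))"
| "emit_sym out (Fam k) = Seq (outs out (4 # replicate k 1)) (unary out)"

definition emit_args :: "nat \<Rightarrow> slot list \<Rightarrow> cmd" where
  "emit_args out sl = for_each 2
     (Cond 2 3 (seqs (map (\<lambda>s. emit_sym out (fst s)) sl))
     (Cond 2 2 (seqs (map (\<lambda>s. emit_sym out (fst (snd s))) sl))
       (seqs (map (\<lambda>s. emit_sym out (snd (snd s))) sl))))"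

fun emit_lit :: "nat \<Rightarrow> 'p :: countable tatom lit \<Rightarrow> cmd" where
  "emit_lit out (Pos (p, sl)) = Seq (outs out (7 # 5 # enc_name (pname p))) (emit_args out sl)"
| "emit_lit out (Naf (p, sl)) = Seq (outs out (8 # 5 # enc_name (pname p))) (emit_args out sl)"

definition emit_rule :: "nat \<Rightarrow> 'p :: countable trule \<Rightarrow> cmd" where
  "emit_rule out r = Seq (Seq (outs out [9]) (seqs (map (emit_lit out) (fst r))))
     (Seq (outs out [10]) (seqs (map (emit_lit out) (snd r))))"

definition ready :: "nat \<Rightarrow> nat \<Rightarrow> store \<Rightarrow> bool" where
  "ready m j \<sigma> \<longleftrightarrow> \<sigma> 2 = wt (marks m j) 0 \<and> \<sigma> 3 = wt (replicate m 1) 0"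

lemma length_marks: "length (marks m j) = m" and marks_nonzero: "0 \<notin> set (marks m j)"
  by (auto simp: marks_def)

lemma emits_args:
  assumes out: "out > 3" and r: "ready m j \<sigma>" and m: "m \<le> N"
  shows "emits out N (emit_args out sl) \<sigma> (concat (map enc_trm (args m j sl)))"
proof -
  have sym: "emits out N (emit_sym out s) (\<sigma>(2 := wt (marks m j) (Suc i))) (enc_trm (inst i s))"
    if "i < m" for i s
  proof (cases s)
    case (Fam k)
    have "emits out N (unary out) (\<sigma>(2 := wt (marks m j) (Suc i))) (replicate (Suc i) 2)"
      using that r out m
      by (intro emits_unary[of _ _ "marks m j" _ "replicate m 1"])
        (auto simp: ready_def length_marks marks_nonzero)
    from emits_Seq[OF emits_outs[of out N "4 # replicate k 1"] this] show ?thesis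
      by (simp add: Fam vname_def enc_name_def)
  qed (simp add: emits_outs)
  have "emits out N (emit_args out sl) \<sigma>
      (concat (map (\<lambda>i. concat (map (\<lambda>s. enc_trm (inst i (sel j i s))) sl)) [0..<length (marks m j)]))"
    unfolding emit_args_def
  proof (rule emits_for_each)
    fix i assume "i < length (marks m j)"
    then have i: "i < m" by (simp add: length_marks)
    have rd: "read ((\<sigma>(2 := wt (marks m j) (Suc i))) 2) = (if i < j then 3 else if i = j then 2 else 1)"
      using i by (simp add: read_wt contents_def length_marks) (simp add: marks_def)
    have e: "emits out N (seqs (map (\<lambda>s. emit_sym out (h s)) sl)) (\<sigma>(2 := wt (marks m j) (Suc i)))
        (concat (map (\<lambda>s. enc_trm (inst i (h s))) sl))" for h
      by (intro emits_seqs sym i)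
    have sel: "sel j i = (if i < j then fst else if i = j then (\<lambda>s. fst (snd s)) else (\<lambda>s. snd (snd s)))"
      by (auto simp: fun_eq_iff)
    show "emits out N (Cond 2 3 (seqs (map (\<lambda>s. emit_sym out (fst s)) sl))
        (Cond 2 2 (seqs (map (\<lambda>s. emit_sym out (fst (snd s))) sl))
          (seqs (map (\<lambda>s. emit_sym out (snd (snd s))) sl)))) (\<sigma>(2 := wt (marks m j) (Suc i)))
        (concat (map (\<lambda>s. enc_trm (inst i (sel j i s))) sl))"
      by (intro emits_Cond; (unfold rd sel)?) (use out e in \<open>auto split: if_splits\<close>)
  qed (use r out m in \<open>auto simp: ready_def length_marks marks_nonzero\<close>)
  moreover have "concat (map enc_trm (concat xss)) = concat (map (\<lambda>xs. concat (map enc_trm xs)) xss)" for xss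
    by (induction xss) auto
  ultimately show ?thesis by (simp add: length_marks args_def comp_def)
qed

lemma emits_lit:
  assumes "out > 3" "ready m j \<sigma>" "m \<le> N"
  shows "emits out N (emit_lit out l) \<sigma> (enc_lit (tlit m j l))"
proof -
  have e: "emits out N (Seq (outs out u) (emit_args out sl)) \<sigma> (u @ concat (map enc_trm (args m j sl)))" for u sl
    by (rule emits_Seq[OF emits_outs emits_args[OF assms]])
  show ?thesis
  proof (cases l)
    case (Pos a)
    then show ?thesis using e[of "7 # 5 # enc_name (pname (fst a))" "snd a"]
      by (cases a) (simp add: tlit_def)
  next
    case (Naf a)
    then show ?thesis using e[of "8 # 5 # enc_name (pname (fst a))" "snd a"]
      by (cases a) (simp add: tlit_def)
  qed
qed

lemma emits_rule:
  assumes "out > 3" "ready m j \<sigma>" "m \<le> N"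
  shows "emits out N (emit_rule out r) \<sigma> (enc_rule (trule m j r))"
proof -
  have "emits out N (seqs (map (emit_lit out) ls)) \<sigma> (concat (map enc_lit (map (tlit m j) ls)))" for ls
    using emits_seqs[of ls out N "emit_lit out" \<sigma> "\<lambda>l. enc_lit (tlit m j l)", OF emits_lit[OF assms]]
    by (simp add: comp_def)
  note lits = this
  show ?thesis
    using emits_Seq[OF emits_Seq[OF emits_outs[of out N "[9]" \<sigma>] lits[of "fst r"]]
        emits_Seq[OF emits_outs[of out N "[10]" \<sigma>] lits[of "snd r"]]]
    by (cases r) (simp add: emit_rule_def trule_def)
qed

section \<open>The loop over the split index\<close>

text \<open>The marks are searched from right to left because the new mark 2 is put to the right of
  the old one and so is not met again. When the old mark is the last symbol, the cell behind it is
  blank and no new mark is written.\<close>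

definition advance :: cmd where
  "advance = seqs [Mv 2 Right, Loop 2 (Mv 2 Right), Mv 2 Left,
     Loop 2 (Seq (Cond 2 2 (seqs [Wr 2 3, Mv 2 Right, Cond 2 0 skip (Wr 2 2), Mv 2 Left]) skip) (Mv 2 Left))]"

lemma contents_marks: "contents (0 # marks m j) i =
    (if i = 0 \<or> m < i then 0 else if i \<le> j then 3 else if i = Suc j then 2 else 1)"
  by (cases i) (auto simp: contents_def marks_def)

lemma runs_advance:
  assumes \<sigma>: "\<sigma> 2 = wt (marks m j) 0" and j: "j < m" "m \<le> N"
  shows "runs N advance \<sigma> (\<sigma>(2 := wt (marks m (Suc j)) 0))"
proof -
  let ?s = "\<lambda>i. \<sigma>(2 := wt (marks m j) (Suc i))"
  have 1: "runs N (Mv 2 Right) \<sigma> (?s 0)" using \<sigma> by (intro runs_right)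
  have 2: "runs N (Loop 2 (Mv 2 Right)) (?s 0) (?s m)"
  proof (rule runs_Loop[where s = ?s])
    show "runs N (Mv 2 Right) (?s i) (?s (Suc i))" for i
      using runs_right[of "?s i" 2 "marks m j" "Suc i" N] by simp
  qed (use j in \<open>auto simp: read_wt contents_nonzero marks_nonzero length_marks\<close>)
  \<comment> \<open>After \<open>r\<close> moves to the left from the last mark the head is on cell
    \<open>m - r\<close>; the mark on cell \<open>Suc j\<close> has been treated once
    \<open>r\<close> reaches \<open>m - j\<close>.\<close>
  let ?t = "\<lambda>r. \<sigma>(2 := wt (marks m (if r < m - j then j else Suc j)) (m - r))"
  have 3: "runs N (Mv 2 Left) (?s m) (?t 0)" using runs_left[of "?s m" 2 "marks m j" m N] j by simp
  let ?c = "Cond 2 2 (seqs [Wr 2 3, Mv 2 Right, Cond 2 0 skip (Wr 2 2), Mv 2 Left]) skip"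
  have 4: "runs N (Loop 2 (Seq ?c (Mv 2 Left))) (?t 0) (?t m)"
  proof (rule runs_Loop[where s = ?t])
    fix r assume r: "r < m"
    then obtain h where h: "m - r = Suc h" "h < m" by (cases "m - r") auto
    show "read (?t r 2) \<noteq> 0" using h by (simp add: read_wt contents_nonzero marks_nonzero length_marks)
    let ?u = "\<sigma>(2 := wt (marks m (if Suc r < m - j then j else Suc j)) (m - r))"
    have "runs N ?c (?t r) ?u"
    proof (rule runs_Cond)
      assume "read (?t r 2) = 2"
      then have hj: "h = j" "r < m - j" "\<not> Suc r < m - j"
        using h r by (auto simp: wt_def contents_marks split: if_splits)
      let ?f = "contents (0 # marks m j)"
      let ?f' = "?f(Suc j := 3)"
      let ?f'' = "if Suc j < m then ?f'(Suc (Suc j) := 2) else ?f'"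
      have "?f'' = contents (0 # marks m (Suc j))"
        using j(1) by (auto simp: fun_eq_iff contents_marks)
      then have u: "?u = \<sigma>(2 := (?f'', Suc j))" using h hj by (simp add: wt_def)
      have t: "?t r = \<sigma>(2 := (?f, Suc j))" using h hj by (simp add: wt_def)
      have "runs N (Wr 2 3) (?t r) (\<sigma>(2 := (?f', Suc j)))"
        using runs_Wr[of N 2 3 "?t r"] by (simp add: t)
      moreover have "runs N (Mv 2 Right) (\<sigma>(2 := (?f', Suc j))) (\<sigma>(2 := (?f', Suc (Suc j))))"
        using runs_Mv[of N 2 Right "\<sigma>(2 := (?f', Suc j))"] by simp
      moreover have "runs N (Cond 2 0 skip (Wr 2 2)) (\<sigma>(2 := (?f', Suc (Suc j)))) (\<sigma>(2 := (?f'', Suc (Suc j))))"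
      proof (rule runs_Cond)
        assume "read ((\<sigma>(2 := (?f', Suc (Suc j)))) 2) = 0"
        then have "?f'' = ?f'" by (auto simp: contents_marks split: if_splits)
        then show "runs N skip (\<sigma>(2 := (?f', Suc (Suc j)))) (\<sigma>(2 := (?f'', Suc (Suc j))))"
          by (simp only: runs_skip)
      next
        assume "read ((\<sigma>(2 := (?f', Suc (Suc j)))) 2) \<noteq> 0"
        then have "?f'' = ?f'(Suc (Suc j) := 2)" by (auto simp: contents_marks split: if_splits)
        then show "runs N (Wr 2 2) (\<sigma>(2 := (?f', Suc (Suc j)))) (\<sigma>(2 := (?f'', Suc (Suc j))))"
          using runs_Wr[of N 2 2 "\<sigma>(2 := (?f', Suc (Suc j)))"] by simp
      qed
      moreover have "runs N (Mv 2 Left) (\<sigma>(2 := (?f'', Suc (Suc j)))) ?u"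
        using runs_Mv[of N 2 Left "\<sigma>(2 := (?f'', Suc (Suc j)))"] by (simp add: u)
      ultimately show "runs N (seqs [Wr 2 3, Mv 2 Right, Cond 2 0 skip (Wr 2 2), Mv 2 Left]) (?t r) ?u"
        unfolding seqs.simps by (meson runs_Seq runs_skip)
    next
      assume "read (?t r 2) \<noteq> 2"
      then have "h \<noteq> j \<or> \<not> r < m - j" using h r by (auto simp: wt_def contents_marks split: if_splits)
      then have "?u = ?t r" using h r by auto
      then show "runs N skip (?t r) ?u" by (simp only: runs_skip)
    qed
    moreover have mh: "m - Suc r = h" using h r by arith
    have "runs N (Mv 2 Left) ?u (?t (Suc r))"
      using runs_left[of ?u 2 "marks m (if Suc r < m - j then j else Suc j)" h N] h
      by (simp add: mh del: diff_Suc split del: if_split)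
    ultimately show "runs N (Seq ?c (Mv 2 Left)) (?t r) (?t (Suc r))" by (rule runs_Seq)
  qed (use j in \<open>auto simp: read_wt\<close>)
  have "?t m = \<sigma>(2 := wt (marks m (Suc j)) 0)" using j by auto
  moreover have "runs N advance \<sigma> (?t m)"
    using runs_Seq[OF 1 runs_Seq[OF 2 runs_Seq[OF 3 runs_Seq[OF 4 runs_skip]]]]
    by (simp only: advance_def seqs.simps)
  ultimately show ?thesis by (simp only:)
qed

fun by_symbol :: "nat \<Rightarrow> (nat option \<Rightarrow> cmd) \<Rightarrow> nat list \<Rightarrow> cmd" where
  "by_symbol k F [] = F None"
| "by_symbol k F (a # as) = Cond k a (F (Some a)) (by_symbol k F as)"

lemma runs_by_symbol:
  "runs N (F (if read (\<sigma> k) \<in> set as then Some (read (\<sigma> k)) else None)) \<sigma> \<sigma>' \<Longrightarrow> runs N (by_symbol k F as) \<sigma> \<sigma>'"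
  by (induction as) (auto intro!: runs_Cond split: if_splits)

text \<open>Tape 1 and the marks on tape 2 advance together, so the symbol under the head of tape 1
  belongs to the current split index. The padding symbol is outside \<open>as\<close> and selects
  \<open>T None\<close>.\<close>

definition emit_split :: "nat \<Rightarrow> nat list \<Rightarrow> (nat option \<Rightarrow> 'p :: countable trule list) \<Rightarrow> cmd" where
  "emit_split out as T = for_each 1 (Seq (by_symbol 1 (\<lambda>x. seqs (map (emit_rule out) (T x))) as) advance)"

lemma runs_emit_split:
  assumes out: "out > 3" and \<sigma>: "\<sigma> 1 = wt (w @ replicate k b) 0" "ready m 0 \<sigma>" "\<sigma> out = ot []"
    and m: "m = length w + k" "m \<le> N" and w: "set w \<subseteq> set as" "0 \<notin> set as" and b: "b \<notin> set as" "b \<noteq> 0"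
  shows "runs N (emit_split out as T) \<sigma> (\<sigma>(2 := wt (marks m m) 0, out :=
    ot (concat (map enc_rule (tprog m (\<lambda>j. T (if j < length w then Some (w ! j) else None)))))))"
proof -
  let ?x = "\<lambda>j. if j < length w then Some (w ! j) else None"
  let ?u = "\<lambda>j. concat (map enc_rule (map (trule m j) (T (?x j))))"
  let ?s = "\<lambda>j. \<sigma>(2 := wt (marks m j) 0, out := ot (concat (map ?u [0..<j])))"
  let ?w = "w @ replicate k b"
  have "runs N (emit_split out as T) (?s 0) (?s (length ?w))"
    unfolding emit_split_def
  proof (rule runs_for_each[of ?w N ?s])
    fix j assume "j < length ?w"
    then have j: "j < m" by (simp add: m)
    let ?t = "(?s j)(1 := wt ?w (Suc j))"
    have "read (?t 1) = (if j < length w then w ! j else b)"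
      using j out m by (simp add: read_wt contents_def nth_append)
    moreover have "w ! j \<in> set as" if "j < length w" using w(1) that nth_mem by blast
    ultimately have x: "(if read (?t 1) \<in> set as then Some (read (?t 1)) else None) = ?x j" using b(1) by auto
    have "ready m j ?t" using \<sigma>(2) out by (simp add: ready_def)
    then have "emits out N (seqs (map (emit_rule out) (T (?x j)))) ?t
        (concat (map (\<lambda>r. enc_rule (trule m j r)) (T (?x j))))"
      using out m(2) by (intro emits_seqs emits_rule)
    from this[unfolded emits_def, rule_format, of "concat (map ?u [0..<j])"]
    have "runs N (seqs (map (emit_rule out) (T (?x j)))) ?t (?t(out := ot (concat (map ?u [0..<Suc j]))))"
      using out by (simp add: comp_def fun_upd_twist)
    then have "runs N (by_symbol 1 (\<lambda>x. seqs (map (emit_rule out) (T x))) as) ?t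
        (?t(out := ot (concat (map ?u [0..<Suc j]))))"
      by (intro runs_by_symbol) (simp only: x)
    moreover have "runs N advance (?t(out := ot (concat (map ?u [0..<Suc j]))))
        (?t(out := ot (concat (map ?u [0..<Suc j])), 2 := wt (marks m (Suc j)) 0))"
      using out m(2) j by (intro runs_advance) auto
    moreover have "?t(out := ot (concat (map ?u [0..<Suc j])), 2 := wt (marks m (Suc j)) 0) =
        (?s (Suc j))(1 := wt ?w (Suc j))" using out by (auto simp: fun_eq_iff)
    ultimately show "runs N (Seq (by_symbol 1 (\<lambda>x. seqs (map (emit_rule out) (T x))) as) advance) ?t
        ((?s (Suc j))(1 := wt ?w (Suc j)))" by (auto intro: runs_Seq)
  qed (use \<sigma> out m w b in auto)
  moreover have "?s 0 = \<sigma>" using \<sigma> by (auto simp: ready_def fun_eq_iff)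
  moreover have "concat (map enc_rule (tprog m (\<lambda>j. T (?x j)))) = concat (map ?u [0..<m])"
  proof -
    have "concat (map enc_rule (concat xss)) = concat (map (\<lambda>xs. concat (map enc_rule xs)) xss)" for xss
      by (induction xss) auto
    then show ?thesis by (simp add: tprog_def comp_def)
  qed
  ultimately show ?thesis using m(1) by simp
qed

section \<open>Preparing the work tapes\<close>

fun nested :: "nat \<Rightarrow> cmd \<Rightarrow> cmd" where
  "nested 0 c = c"
| "nested (Suc e) c = for_each (4 + e) (nested e c)"

definition pad :: "nat \<Rightarrow> cmd" where
  "pad b = seqs (map (\<lambda>k. put k (if k = 1 then b else 1)) [1..<4])"

abbreviation ap :: "word \<Rightarrow> tape" where
  "ap u \<equiv> wt u (Suc (length u))"

definition padded :: "nat \<Rightarrow> word \<Rightarrow> nat \<Rightarrow> nat \<Rightarrow> store \<Rightarrow> store" where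
  "padded b w n i \<sigma> = (\<lambda>k. if k = 1 then ap (w @ replicate i b) else if k = 2 \<or> k = 3 then ap (replicate (n + i) 1) else \<sigma> k)"

lemma padded_id: "\<lbrakk>\<sigma> 1 = ap w; \<sigma> 2 = ap (replicate n 1); \<sigma> 3 = ap (replicate n 1)\<rbrakk> \<Longrightarrow> padded b w n 0 \<sigma> = \<sigma>"
  by (auto simp: padded_def fun_eq_iff)

lemma runs_pad: "runs N (pad b) (padded b w n i \<sigma>) (padded b w n (Suc i) \<sigma>)"
proof -
  let ?y = "\<lambda>k. if k = 1 then ap (w @ replicate (Suc i) b) else ap (replicate (Suc (n + i)) 1)"
  have "runs N (pad b) (padded b w n i \<sigma>) (\<lambda>k. if 1 \<le> k \<and> k < 4 then ?y k else padded b w n i \<sigma> k)"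
    unfolding pad_def
  proof (rule runs_each)
    fix k \<tau> assume k: "1 \<le> k" "k < (4 :: nat)" and \<tau>: "\<tau> k = padded b w n i \<sigma> k"
    show "runs N (put k (if k = 1 then b else 1)) \<tau> (\<tau>(k := ?y k))"
    proof (cases "k = 1")
      case True
      then show ?thesis using runs_put_wt[of \<tau> k "w @ replicate i b" N b] \<tau>
        by (simp add: padded_def replicate_append_same)
    next
      case False
      then have "k = 2 \<or> k = 3" using k by auto
      then show ?thesis using runs_put_wt[of \<tau> k "replicate (n + i) 1" N 1] \<tau> False
        by (simp add: padded_def replicate_append_same)
    qed
  qed
  moreover have "(\<lambda>k. if 1 \<le> k \<and> k < 4 then ?y k else padded b w n i \<sigma> k) = padded b w n (Suc i) \<sigma>"
    by (auto simp: padded_def fun_eq_iff)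
  ultimately show ?thesis by simp
qed

lemma runs_nested:
  assumes "l \<le> N" "\<And>k. k < e \<Longrightarrow> \<sigma> (4 + k) = wt (replicate l 1) 0"
  shows "runs N (nested e (pad b)) (padded b w n i \<sigma>) (padded b w n (i + l ^ e) \<sigma>)"
  using assms
proof (induction e arbitrary: i \<sigma>)
  case 0
  then show ?case using runs_pad by simp
next
  case (Suc e)
  let ?s = "\<lambda>r. padded b w n (i + r * l ^ e) \<sigma>"
  let ?u = "replicate l (1 :: nat)"
  have "runs N (nested (Suc e) (pad b)) (?s 0) (?s (length ?u))"
    unfolding nested.simps
  proof (rule runs_for_each[of ?u N ?s])
    fix r assume "r < length ?u"
    have r1: "i + Suc r * l ^ e = i + r * l ^ e + l ^ e" by simp
    \<comment> \<open>Padding touches tapes 1 to 3 only, so it commutes with moving the head of a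
      loop tape.\<close>
    have *: "(padded b w n x \<sigma>)(4 + e := wt ?u (Suc r)) = padded b w n x (\<sigma>(4 + e := wt ?u (Suc r)))" for x
      by (auto simp: padded_def fun_eq_iff)
    have "runs N (nested e (pad b)) (padded b w n (i + r * l ^ e) (\<sigma>(4 + e := wt ?u (Suc r))))
        (padded b w n (i + r * l ^ e + l ^ e) (\<sigma>(4 + e := wt ?u (Suc r))))"
      using Suc.prems by (intro Suc.IH) auto
    then show "runs N (nested e (pad b)) ((?s r)(4 + e := wt ?u (Suc r))) ((?s (Suc r))(4 + e := wt ?u (Suc r)))"
      by (simp only: * r1)
  qed (use Suc.prems in \<open>auto simp: padded_def\<close>)
  then show ?case by simp
qed

text \<open>Tapes 4 to \<open>3 + d\<close> receive words of length \<open>length w + a\<close> and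
  drive the nested loops, which append \<open>(length w + a) ^ d\<close> symbols to each of tapes 1
  to 3. These already hold \<open>length w\<close> symbols from the copying, which explains the
  value of \<open>m\<close>. Tape 2 then consists of ones, and a 2 in cell 1 turns it into the marks
  for split index 0.\<close>

definition prepare :: "nat \<Rightarrow> nat list \<Rightarrow> nat \<Rightarrow> nat \<Rightarrow> cmd" where
  "prepare d as b a = seqs [
     seqs (map (\<lambda>k. Mv k Right) [1..<4 + d]),
     Loop 0 (Seq (by_symbol 0 (\<lambda>x. put 1 (case x of Some y \<Rightarrow> y | None \<Rightarrow> b)) as)
       (Seq (seqs (map (\<lambda>k. put k 1) [2..<4 + d])) (Mv 0 Right))),
     seqs (map (\<lambda>k. Seq (seqs (map (put k) (replicate a 1))) (Seq (Mv k Left) (rewind k))) [4..<4 + d]),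
     nested d (pad b),
     seqs (map (\<lambda>k. Seq (Mv k Left) (rewind k)) [1..<4]),
     Mv 2 Right, Wr 2 2, Mv 2 Left]"

lemma runs_puts_wt: "\<sigma> k = ap u \<Longrightarrow> runs N (seqs (map (put k) v)) \<sigma> (\<sigma>(k := ap (u @ v)))"
proof (induction v arbitrary: u \<sigma>)
  case Nil
  then show ?case by (simp add: runs_skip fun_upd_idem)
next
  case (Cons x v)
  have "runs N (seqs (map (put k) v)) (\<sigma>(k := ap (u @ [x]))) (\<sigma>(k := ap (u @ [x]), k := ap ((u @ [x]) @ v)))"
    by (rule Cons.IH) simp
  then have "runs N (seqs (map (put k) v)) (\<sigma>(k := ap (u @ [x]))) (\<sigma>(k := ap (u @ x # v)))"
    by (simp only: fun_upd_upd append_assoc append.simps)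
  from runs_Seq[OF runs_put_wt[of \<sigma> k u N x, OF Cons.prems] this] show ?case by (simp only: list.map seqs.simps)
qed

lemma runs_end:
  assumes "\<sigma> k = ap u" "0 \<notin> set u" "length u \<le> N"
  shows "runs N (Seq (Mv k Left) (rewind k)) \<sigma> (\<sigma>(k := wt u 0))"
proof -
  have "runs N (rewind k) (\<sigma>(k := wt u (length u))) (\<sigma>(k := wt u 0))"
    using runs_rewind[of "\<sigma>(k := wt u (length u))" k u "length u" N] assms by simp
  then show ?thesis using runs_left[of \<sigma> k u "length u" N, OF assms(1)] by (rule runs_Seq[rotated])
qed

lemma runs_prepare:
  assumes w: "set w \<subseteq> set as" "0 \<notin> set as" and b: "b \<noteq> 0" and d: "d > 0" and a: "a > 0"
    and m: "m = length w + (length w + a) ^ d"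
  shows "\<exists>\<sigma>. runs m (prepare d as b a) (initial w) \<sigma> \<and> \<sigma> 1 = wt (w @ replicate ((length w + a) ^ d) b) 0 \<and>
    ready m 0 \<sigma> \<and> \<sigma> (4 + d) = ot []"
proof -
  let ?n = "length w"
  let ?bl = "(\<lambda>_. 0, 0) :: tape"
  \<comment> \<open>Every loop runs over a word of length at most \<open>m\<close>, so
    \<open>m\<close> itself serves as the bound on iterations.\<close>
  have "?n + a \<le> (?n + a) ^ d" using a d self_le_power[of "?n + a" d] by simp
  then have nm: "?n \<le> m" "?n + a \<le> m" using m by auto
  have w0: "0 \<notin> set w" using w by auto
  have bl: "wt [] 0 = ?bl" "ot [] = ?bl" by (auto simp: wt_def ot_def contents_def)
  let ?s = "\<lambda>i k. if k = 0 then (contents w, i) else if k = 1 then ap (take i w)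
    else if k < 4 + d then ap (replicate i 1) else ?bl"
  let ?y = "\<lambda>k :: nat. ap []"
  have "runs m (seqs (map (\<lambda>k. Mv k Right) [1..<4 + d])) (initial w)
      (\<lambda>k. if 1 \<le> k \<and> k < 4 + d then ?y k else initial w k)"
  proof (rule runs_each)
    show "runs m (Mv k Right) \<tau> (\<tau>(k := ?y k))" if "1 \<le> k" "\<tau> k = initial w k" for k \<tau>
      using runs_right[of \<tau> k "[]" 0 m] that by (simp add: initial_def bl)
  qed
  moreover have "(\<lambda>k. if 1 \<le> k \<and> k < 4 + d then ?y k else initial w k) = ?s 0"
    by (auto simp: initial_def fun_eq_iff)
  ultimately have 1: "runs m (seqs (map (\<lambda>k. Mv k Right) [1..<4 + d])) (initial w) (?s 0)" by simp
  let ?copy = "by_symbol 0 (\<lambda>x. put 1 (case x of Some y \<Rightarrow> y | None \<Rightarrow> b)) as"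
  have 2: "runs m (Loop 0 (Seq ?copy (Seq (seqs (map (\<lambda>k. put k 1) [2..<4 + d])) (Mv 0 Right)))) (?s 0) (?s ?n)"
  proof (rule runs_Loop[where s = ?s])
    fix i assume i: "i < ?n"
    have rd: "read (?s i 0) = w ! i" using i by (simp add: contents_def)
    have wi: "w ! i \<in> set as" using i w(1) nth_mem by blast
    then show "read (?s i 0) \<noteq> 0" unfolding rd using w(2) by metis
    have "runs m ?copy (?s i) ((?s i)(1 := ap (take i w @ [w ! i])))"
      by (rule runs_by_symbol) (use runs_put_wt[of "?s i" 1 "take i w" m "w ! i"] in \<open>simp only: rd wi if_True option.case, simp\<close>)
    moreover have "(?s i)(1 := ap (take i w @ [w ! i])) = (?s i)(1 := ap (take (Suc i) w))"
      using i by (simp add: take_Suc_conv_app_nth)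
    moreover have "runs m (seqs (map (\<lambda>k. put k 1) [2..<4 + d])) ((?s i)(1 := ap (take (Suc i) w)))
       (\<lambda>k. if 2 \<le> k \<and> k < 4 + d then ap (replicate (Suc i) 1) else ((?s i)(1 := ap (take (Suc i) w))) k)"
    proof (rule runs_each)
      show "runs m (put k 1) \<tau> (\<tau>(k := ap (replicate (Suc i) 1)))"
        if "2 \<le> k" "k < 4 + d" "\<tau> k = ((?s i)(1 := ap (take (Suc i) w))) k" for k \<tau>
        using runs_put_wt[of \<tau> k "replicate i 1" m 1] that by (simp add: replicate_append_same)
    qed
    moreover have "(\<lambda>k. if 2 \<le> k \<and> k < 4 + d then ap (replicate (Suc i) 1)
        else ((?s i)(1 := ap (take (Suc i) w))) k) = (?s (Suc i))(0 := (contents w, i))"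
      by (auto simp: fun_eq_iff)
    moreover have "runs m (Mv 0 Right) ((?s (Suc i))(0 := (contents w, i))) (?s (Suc i))"
      using runs_Mv[of m 0 Right "(?s (Suc i))(0 := (contents w, i))"] by (simp add: fun_upd_idem)
    ultimately show "runs m (Seq ?copy (Seq (seqs (map (\<lambda>k. put k 1) [2..<4 + d])) (Mv 0 Right))) (?s i) (?s (Suc i))"
      by (simp only:) (rule runs_Seq, assumption, rule runs_Seq)
  qed (use nm in \<open>auto simp: contents_def\<close>)
  let ?t = "\<lambda>k. if 4 \<le> k \<and> k < 4 + d then wt (replicate (?n + a) 1) 0 else ?s ?n k"
  have 3: "runs m (seqs (map (\<lambda>k. Seq (seqs (map (put k) (replicate a 1))) (Seq (Mv k Left) (rewind k))) [4..<4 + d]))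
      (?s ?n) ?t"
  proof (rule runs_each)
    fix k \<tau> assume k: "4 \<le> k" "k < 4 + d" "\<tau> k = ?s ?n k"
    have "runs m (seqs (map (put k) (replicate a 1))) \<tau> (\<tau>(k := ap (replicate ?n 1 @ replicate a 1)))"
      using k by (intro runs_puts_wt) simp
    moreover have "runs m (Seq (Mv k Left) (rewind k)) (\<tau>(k := ap (replicate (?n + a) 1)))
        (\<tau>(k := ap (replicate (?n + a) 1), k := wt (replicate (?n + a) 1) 0))"
      using nm by (intro runs_end) auto
    ultimately show "runs m (Seq (seqs (map (put k) (replicate a 1))) (Seq (Mv k Left) (rewind k))) \<tau>
        (\<tau>(k := wt (replicate (?n + a) 1) 0))"
      by (auto simp: replicate_add intro: runs_Seq)
  qed
  have "padded b w ?n 0 ?t = ?t" by (rule padded_id) auto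
  then have 4: "runs m (nested d (pad b)) ?t (padded b w ?n ((?n + a) ^ d) ?t)"
    using runs_nested[of "?n + a" m d ?t b w ?n 0] nm by simp
  let ?p = "padded b w ?n ((?n + a) ^ d) ?t"
  let ?z = "\<lambda>k. if k = 1 then wt (w @ replicate ((?n + a) ^ d) b) 0 else wt (replicate m 1) 0"
  let ?q = "\<lambda>k. if 1 \<le> k \<and> k < 4 then ?z k else ?p k"
  have 5: "runs m (seqs (map (\<lambda>k. Seq (Mv k Left) (rewind k)) [1..<4])) ?p ?q"
  proof (rule runs_each)
    fix k \<tau> assume k: "1 \<le> k" "k < (4 :: nat)" "\<tau> k = ?p k"
    then consider "k = 1" | "k = 2 \<or> k = 3" by linarith
    then show "runs m (Seq (Mv k Left) (rewind k)) \<tau> (\<tau>(k := ?z k))"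
    proof cases
      case 1
      then show ?thesis using runs_end[of \<tau> k "w @ replicate ((?n + a) ^ d) b" m] k(3) w0 b m
        by (simp add: padded_def)
    next
      case 2
      then show ?thesis using runs_end[of \<tau> k "replicate m 1" m] k(3) m
        by (auto simp: padded_def)
    qed
  qed
  have mp: "m > 0" using nm a by simp
  let ?f = "?q(2 := wt (marks m 0) 0)"
  have 6: "runs m (Mv 2 Right) ?q (?q(2 := wt (replicate m 1) 1))"
    using runs_right[of ?q 2 "replicate m 1" 0 m] by simp
  have "(contents (0 # replicate m 1))(1 := 2) = contents (0 # marks m 0)"
    using mp by (auto simp: fun_eq_iff contents_def marks_def nth_Cons split: nat.splits)
  then have 7: "runs m (Wr 2 2) (?q(2 := wt (replicate m 1) 1)) (?q(2 := wt (marks m 0) 1))"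
    using runs_Wr[of m 2 2 "?q(2 := wt (replicate m 1) 1)"] by (simp add: wt_def)
  have 8: "runs m (Mv 2 Left) (?q(2 := wt (marks m 0) 1)) ?f"
    using runs_left[of "?q(2 := wt (marks m 0) 1)" 2 "marks m 0" 0 m] by simp
  have "runs m (prepare d as b a) (initial w) ?f"
    unfolding prepare_def
    using runs_Seq[OF 1 runs_Seq[OF 2 runs_Seq[OF 3 runs_Seq[OF 4 runs_Seq[OF 5 runs_Seq[OF 6
      runs_Seq[OF 7 runs_Seq[OF 8 runs_skip]]]]]]]]
    by (simp only: seqs.simps)
  moreover have "?f 1 = wt (w @ replicate ((?n + a) ^ d) b) 0" "ready m 0 ?f" "?f (4 + d) = ot []"
    by (auto simp: ready_def padded_def bl)
  ultimately show ?thesis by blast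
qed

section \<open>The complete generator and its running time\<close>

definition generate :: "nat \<Rightarrow> nat list \<Rightarrow> nat \<Rightarrow> nat \<Rightarrow> (nat option \<Rightarrow> 'p :: countable trule list) \<Rightarrow> name \<Rightarrow> cmd" where
  "generate d as b a T q = Seq (prepare d as b a)
     (Seq (emit_split (4 + d) as T) (outs (4 + d) (11 # enc_name q)))"

lemma runs_generate:
  assumes w: "set w \<subseteq> set as" "0 \<notin> set as" and b: "b \<notin> set as" "b \<noteq> 0" and d: "d > 0" and a: "a > 0"
    and m: "m = length w + (length w + a) ^ d"
  shows "\<exists>\<sigma>. runs m (generate d as b a T q) (initial w) \<sigma> \<and> fst (\<sigma> (4 + d)) =
    contents (enc_instance (tprog m (\<lambda>j. T (if j < length w then Some (w ! j) else None))) q)"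
proof -
  obtain \<sigma> where \<sigma>: "runs m (prepare d as b a) (initial w) \<sigma>"
    "\<sigma> 1 = wt (w @ replicate ((length w + a) ^ d) b) 0" "ready m 0 \<sigma>" "\<sigma> (4 + d) = ot []"
    using runs_prepare[OF w b(2) d a m] by blast
  let ?u = "concat (map enc_rule (tprog m (\<lambda>j. T (if j < length w then Some (w ! j) else None))))"
  let ?\<sigma> = "\<sigma>(2 := wt (marks m m) 0, 4 + d := ot ?u)"
  have "runs m (emit_split (4 + d) as T) \<sigma> ?\<sigma>"
    using \<sigma>(2-4) m w b by (intro runs_emit_split) auto
  moreover have "runs m (outs (4 + d) (11 # enc_name q)) ?\<sigma> (\<sigma>(2 := wt (marks m m) 0, 4 + d := ot (?u @ 11 # enc_name q)))"
    using emits_outs[of "4 + d" m "11 # enc_name q" "\<sigma>(2 := wt (marks m m) 0)"] by (simp add: emits_def)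
  ultimately have "runs m (generate d as b a T q) (initial w)
      (\<sigma>(2 := wt (marks m m) 0, 4 + d := ot (?u @ 11 # enc_name q)))"
    unfolding generate_def using \<sigma>(1) by (blast intro: runs_Seq)
  then show ?thesis
    by (intro exI[of _ "\<sigma>(2 := wt (marks m m) 0, 4 + d := ot (?u @ 11 # enc_name q))"] conjI)
      (simp_all add: ot_def enc_instance_def)
qed

lemma tapes_of_seqs: "tapes_of (seqs cs) = insert 0 (\<Union> (tapes_of ` set cs))"
  by (induction cs) (auto simp: skip_def)

lemma tapes_of_outs: "tapes_of (outs k u) \<subseteq> {0, k}"
  by (auto simp: outs_def tapes_of_seqs put_def)

lemma tapes_of_by_symbol: "tapes_of (by_symbol k F as) \<subseteq> insert k (\<Union>x. tapes_of (F x))"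
  by (induction as) auto

lemma tapes_of_nested: "tapes_of (nested e c) \<subseteq> {..<4 + e} \<union> tapes_of c"
  by (induction e) (auto simp: for_each_def rewind_def tapes_of_seqs skip_def)

lemma tapes_of_emit_rule: "tapes_of (emit_rule k r) \<subseteq> {0, 2, 3, k}"
proof -
  have sym: "tapes_of (emit_sym k s) \<subseteq> {0, 2, 3, k}" for s
    using tapes_of_outs[of k] by (cases s) (fastforce simp: unary_def tapes_of_seqs put_def skip_def)+
  have "tapes_of (emit_args k sl) \<subseteq> {0, 2, 3, k}" for sl
    using sym by (fastforce simp: emit_args_def for_each_def rewind_def tapes_of_seqs skip_def)
  then have "tapes_of (emit_lit k l) \<subseteq> {0, 2, 3, k}" for l
    using tapes_of_outs[of k] by (cases "(k, l)" rule: emit_lit.cases) fastforce+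
  then show ?thesis
    using tapes_of_outs[of k] by (fastforce simp: emit_rule_def tapes_of_seqs)
qed

lemma tapes_of_generate: "tapes_of (generate d as b a T q) \<subseteq> {..4 + d}"
proof -
  have "tapes_of (by_symbol 1 (\<lambda>x. seqs (map (emit_rule (4 + d)) (T x))) as) \<subseteq> {..4 + d}"
    by (rule subset_trans[OF tapes_of_by_symbol]) (auto simp: tapes_of_seqs dest!: subsetD[OF tapes_of_emit_rule])
  then have "tapes_of (emit_split (4 + d) as T) \<subseteq> {..4 + d}"
    by (simp add: emit_split_def for_each_def rewind_def tapes_of_seqs advance_def skip_def)
  moreover have "tapes_of (by_symbol 0 (\<lambda>x. put 1 (case x of Some y \<Rightarrow> y | None \<Rightarrow> b)) as) \<subseteq> {..4 + d}"
    by (rule subset_trans[OF tapes_of_by_symbol]) (auto simp: put_def)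
  moreover have "tapes_of (nested d (pad b)) \<subseteq> {..4 + d}"
    by (rule subset_trans[OF tapes_of_nested]) (auto simp: pad_def tapes_of_seqs put_def)
  ultimately have "tapes_of (emit_split (4 + d) as T) \<subseteq> {..4 + d}" "tapes_of (prepare d as b a) \<subseteq> {..4 + d}"
    by (auto simp: prepare_def tapes_of_seqs put_def rewind_def skip_def split: if_splits)
  moreover have "tapes_of (outs (4 + d) u) \<subseteq> {..4 + d}" for u using tapes_of_outs[of "4 + d" u] by auto
  ultimately show ?thesis by (simp add: generate_def)
qed

lemma zero_notin_enc_instance: "0 \<notin> set (enc_instance rs q)"
proof -
  have n: "0 \<notin> set (enc_name x)" for x by (auto simp: enc_name_def)
  then have t: "0 \<notin> set (enc_trm t)" for t by (cases t) auto
  then have "0 \<notin> set (enc_atom x)" for x using n by (cases x) auto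
  then have "0 \<notin> set (enc_lit l)" for l by (cases l) auto
  then have "0 \<notin> set (enc_rule r)" for r by (cases r) auto
  then show ?thesis using n by (auto simp: enc_instance_def)
qed

lemma polytime_generate:
  assumes "finite \<Sigma>" "0 \<notin> \<Sigma>" "d > 0" "a > 0" "set as = \<Sigma>"
    and f: "\<And>w. w \<in> lists \<Sigma> \<Longrightarrow> f w = enc_instance
      (tprog (length w + (length w + a) ^ d) (\<lambda>j. T (if j < length w then Some (w ! j) else None))) q"
  shows "polytime_computable \<Sigma> f"
proof -
  \<comment> \<open>The padding symbol has to be non-blank, so that loops do not stop at it, and
    different from all input symbols.\<close>
  obtain b where b: "b \<notin> insert 0 \<Sigma>" using ex_new_if_finite[of "insert 0 \<Sigma>"] assms(1) by auto
  have p: "poly ([:0, 1:] + [:a, 1:] ^ d) n = n + (n + a) ^ d" for n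
    by (simp add: poly_power add.commute)
  show ?thesis
  proof (rule polytime_computable_cmd[where q = "[:0, 1:] + [:a, 1:] ^ d", OF tapes_of_generate assms(1)])
    show "0 \<notin> set (f w) \<and> (\<exists>\<sigma>. runs (poly ([:0, 1:] + [:a, 1:] ^ d) (length w)) (generate d as b a T q) (initial w) \<sigma> \<and>
        fst (\<sigma> (4 + d)) = contents (f w))" if w: "w \<in> lists \<Sigma>" for w
      unfolding p f[OF w] using w assms(2-5) b zero_notin_enc_instance
      by (intro conjI runs_generate) (auto simp: in_lists_conv_set)
  qed simp
qed


section \<open>The reduction\<close>

text \<open>The summand 2 pays for a factor 4 between the given time bound and \<open>2 ^ m\<close>.
  In the induction, the enlarged base absorbs the new coefficient and one more factor absorbs the
  multiplication by \<open>n\<close>.\<close>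

lemma poly_le_power:
  fixes p :: "nat poly"
  shows "\<exists>d a. d > 0 \<and> a > 0 \<and> (\<forall>n. poly p n + 2 \<le> (n + a) ^ d)"
proof (induction p)
  case 0
  show ?case by (intro exI[of _ 1] exI[of _ 2]) auto
next
  case (pCons c p)
  then obtain d a where da: "d > 0" "a > 0" "\<And>n. poly p n + 2 \<le> (n + a) ^ d" by auto
  let ?a = "a + c + 2"
  have "poly (pCons c p) n + 2 \<le> (n + ?a) ^ Suc d" for n
  proof -
    define X where "X = (n + ?a) ^ d"
    have "poly p n \<le> (n + a) ^ d" using da(3)[of n] by simp
    also have "\<dots> \<le> X" unfolding X_def by (rule power_mono) auto
    finally have "n * poly p n \<le> n * X" by (rule mult_le_mono2)
    moreover have "?a * 1 \<le> ?a * X" by (rule mult_le_mono2) (simp add: X_def Suc_leI)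
    ultimately have "n * poly p n + ?a * 1 \<le> n * X + ?a * X" by (rule add_mono)
    then have "c + n * poly p n + 2 \<le> n * X + ?a * X" by (rule order_trans[rotated]) simp
    then show ?thesis by (simp only: poly_pCons power_Suc distrib_right X_def)
  qed
  then show ?case by (intro exI[of _ "Suc d"] exI[of _ ?a]) auto
qed

section \<open>The constraints as an instance of the templates\<close>

context computation
begin

text \<open>Neither the input nor \<open>m\<close> occurs here, so the list is the same for all
  inputs and can be built into the printing program.\<close>

definition preds :: "pr list" where
  "preds = [Grd, Scc, Inp, Blk] @ [Cel k a. k \<leftarrow> [0..<tapes M], a \<leftarrow> \<Gamma>] @ map Hed [0..<tapes M]
     @ map Sta Q @ map Ins D"

definition well_formed :: "pr tatom lit list \<Rightarrow> bool" where
  "well_formed c \<longleftrightarrow> c = [Naf (Grd, [zz, zz, zz, zz])] \<or> (\<exists>as bs. c = cn as bs \<and>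
     (\<forall>p sl. (p, sl) \<in> set as \<union> set bs \<longrightarrow> p \<in> set preds \<and> length sl = 4 \<and> (\<forall>s\<in>set sl. fams s \<subseteq> {..<4})))"

lemma well_formed_cn:
  "(\<And>p sl. (p, sl) \<in> set as \<union> set bs \<Longrightarrow> p \<in> set preds \<and> length sl = 4 \<and> (\<forall>s\<in>set sl. fams s \<subseteq> {..<4})) \<Longrightarrow>
    well_formed (cn as bs)"
  unfolding well_formed_def by blast

lemma preds_simps:
  "Grd \<in> set preds" "Scc \<in> set preds" "Inp \<in> set preds" "Blk \<in> set preds"
  "Cel k a \<in> set preds \<longleftrightarrow> k < tapes M \<and> a \<in> set \<Gamma>" "Hed k \<in> set preds \<longleftrightarrow> k < tapes M"
  "Sta s \<in> set preds \<longleftrightarrow> s \<in> set Q" "Ins d \<in> set preds \<longleftrightarrow> d \<in> delta M"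
  by (auto simp: preds_def D)

lemma tapes_pos: "0 < tapes M"
  using wf by (simp add: wf_tm_def)

lemma well_formed_instr:
  assumes "d \<in> delta M"
  shows "\<forall>c\<in>set (instr_constraints (tapes M) d). well_formed c"
proof -
  obtain s as s' bs where d: "d = ((s, as), (s', bs))" by (cases d) auto
  have Qs: "s \<in> set Q" "s' \<in> set Q" and G: "set as \<subseteq> set \<Gamma>" "fst ` set bs \<subseteq> set \<Gamma>"
    using Q(3) \<Gamma>(3) assms unfolding d by blast+
  have "length as = tapes M" "length bs = tapes M" using wf assms unfolding wf_tm_def d by blast+
  then have sy: "as ! k \<in> set \<Gamma>" "fst (bs ! k) \<in> set \<Gamma>" if "k < tapes M" for k
    using G that by (auto simp: image_subset_iff)
  have "\<forall>c\<in>set (moves d k v). well_formed c" if "k < tapes M" for k v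
    using that assms by (cases v) (auto simp: preds_simps intro!: well_formed_cn)
  then show ?thesis
    unfolding instr_constraints_def d split set_append ball_Un
    using assms Qs sy unfolding d
    by (intro conjI) (auto simp: preds_simps intro!: well_formed_cn)
qed

lemma well_formed_Cs:
  assumes "c \<in> set (Cs j)"
  shows "well_formed c"
proof -
  have "well_formed [Naf (Grd, [zz, zz, zz, zz])]" by (simp add: well_formed_def)
  moreover have "well_formed (input_constraint (if j < length w then Some (w ! j) else None))"
    using \<Gamma>(2) tapes_pos
    by (auto simp: input_constraint_def preds_simps subset_iff intro!: well_formed_cn)
  moreover have "well_formed (cn [] [(Grd, free_vars[k := set1 k])])" if "k < 4" for k
    using that by (intro well_formed_cn) (auto simp: preds_simps free_vars_def dest!: set_update_subset_insert[THEN subsetD])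
  ultimately have "\<forall>c\<in>set (Cs j). well_formed c"
    unfolding Cs_def common_constraints_def set_append ball_Un
    by (intro conjI) (auto simp: preds_simps D well_formed_instr tapes_pos Q(1,2) \<Gamma>(1) intro!: well_formed_cn)
  then show ?thesis using assms by blast
qed

sublocale constraint_templates m preds Grd Cs
proof
  show "Grd \<in> set preds" by (rule preds_simps)
next
  fix j c l p sl assume c: "c \<in> set (Cs j)" "l \<in> set c" "(p, sl) \<in> atoms_lit l"
  show "p \<in> set preds \<and> length sl = 4 \<and> (\<forall>s\<in>set sl. fams s \<subseteq> {..<4})"
    using well_formed_Cs[OF c(1)] unfolding well_formed_def
  proof (elim disjE exE conjE)
    assume "c = [Naf (Grd, [zz, zz, zz, zz])]"
    then show ?thesis using c(2,3) by (auto simp: preds_simps)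
  next
    fix as bs assume ab: "c = cn as bs" "\<forall>p sl. (p, sl) \<in> set as \<union> set bs \<longrightarrow>
      p \<in> set preds \<and> length sl = 4 \<and> (\<forall>s\<in>set sl. fams s \<subseteq> {..<4})"
    have "(p, sl) = (Grd, free_vars) \<or> (p, sl) \<in> set as \<union> set bs" using c(2,3) by (auto simp: ab(1) cn_def)
    moreover have "length free_vars = 4 \<and> (\<forall>s\<in>set free_vars. fams s \<subseteq> {..<4})"
      by (auto simp: free_vars_def)
    ultimately show ?thesis using ab(2) preds_simps(1) by blast
  qed
next
  fix j c assume "c \<in> set (Cs j)"
  then show "Pos (Grd, free_vars) \<in> set c \<or> (\<forall>l\<in>set c. \<forall>(p, sl)\<in>atoms_lit l. \<forall>s\<in>set sl. fams s = {})"
    using well_formed_Cs[of c j] by (auto simp: well_formed_def cn_def)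
next
  fix b
  \<comment> \<open>The bit \<open>True\<close> is supplied by the constraint that sets a bit in the
    first slot of the guard, the bit \<open>False\<close> by the ground constraint.\<close>
  let ?l = "if b then Naf (Grd, free_vars[0 := set1 0]) else Naf (Grd, [zz, zz, zz, zz])"
  let ?c = "if b then cn [] [(Grd, free_vars[0 := set1 0])] else [?l]"
  have "set1 0 \<in> set (free_vars[0 := set1 0])" by (simp add: free_vars_def set_update_memI)
  then have "?c \<in> set (Cs 0)" "?l \<in> set ?c" "\<exists>(p, sl)\<in>atoms_lit ?l. \<exists>s\<in>set sl. fst (snd s) = Val b"
    by (auto simp: Cs_def common_constraints_def cn_def intro!: bexI[of _ "set1 0"])
  then have "\<exists>c\<in>set (Cs 0). \<exists>l\<in>set c. \<exists>(p, sl)\<in>atoms_lit l. \<exists>s\<in>set sl. fst (snd s) = Val b" by blast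
  then show "\<exists>j<m. \<exists>c\<in>set (Cs j). \<exists>l\<in>set c. \<exists>(p, sl)\<in>atoms_lit l. \<exists>s\<in>set sl. fst (snd s) = Val b"
    using m(1) by (intro exI[of _ 0]) auto
qed

lemma satisfiable_iff_accepts:
  "satisfiable prog (pname Grd) \<longleftrightarrow> (\<exists>c. (init M w, c) \<in> (step M)\<^sup>* \<and> fst c = accept M)"
proof
  assume "satisfiable prog (pname Grd)"
  then show "\<exists>c. (init M w, c) \<in> (step M)\<^sup>* \<and> fst c = accept M"
    using satisfiable_imp_relations relations_imp_accepts by blast
next
  assume "\<exists>c. (init M w, c) \<in> (step M)\<^sup>* \<and> fst c = accept M"
  then obtain R where "R Grd [0, 0, 0, 0]" "\<forall>j<m. \<forall>c\<in>set (Cs j). \<forall>\<rho>. (\<forall>k. \<rho> k < 2 ^ m) \<longrightarrow>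
      \<not> (\<forall>l\<in>set c. tsat R m j \<rho> l)" using accepts_imp_relations by blast
  then show "satisfiable prog (pname Grd)" by (intro satisfiable_if_relations[of R]) blast+
qed

end

theorem theorem4p22:
  shows "NEXPTIME_hard loosely_guarded_instances satisfiable_loosely_guarded_instances"
  unfolding NEXPTIME_hard_def
proof (intro allI impI)
  fix \<Sigma> L assume "alphabet \<Sigma> \<and> L \<in> NEXPTIME \<Sigma>"
  then have \<Sigma>: "finite \<Sigma>" "0 \<notin> \<Sigma>" and "L \<in> NEXPTIME \<Sigma>" by (auto simp: alphabet_def)
  then obtain M and p :: "nat poly" where M: "wf_tm M" "decides_in_time M \<Sigma> L (\<lambda>n. 2 ^ poly p n)"
    by (auto simp: NEXPTIME_def)
  obtain d a where da: "d > 0" "a > 0" "\<And>n. poly p n + 2 \<le> (n + a) ^ d" using poly_le_power by blast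
  have fin: "finite (delta M)" using M(1) by (simp add: wf_tm_def)
  obtain D where D: "set D = delta M" using finite_list[OF fin] by blast
  obtain Q where Q: "set Q = {start M, accept M} \<union> (fst \<circ> fst) ` delta M \<union> (fst \<circ> snd) ` delta M"
    using finite_list[of "{start M, accept M} \<union> (fst \<circ> fst) ` delta M \<union> (fst \<circ> snd) ` delta M"] fin by auto
  obtain \<Gamma> where \<Gamma>: "set \<Gamma> = insert 0 \<Sigma> \<union> (\<Union>x\<in>delta M. set (snd (fst x))) \<union> (\<Union>x\<in>delta M. fst ` set (snd (snd x)))"
    using finite_list[of "insert 0 \<Sigma> \<union> (\<Union>x\<in>delta M. set (snd (fst x))) \<union> (\<Union>x\<in>delta M. fst ` set (snd (snd x)))"] fin \<Sigma>(1)
    by auto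
  obtain as where as: "set as = \<Sigma>" using finite_list[OF \<Sigma>(1)] by blast
  define m where "m w = length w + (length w + a) ^ d" for w :: word
  have comp: "computation M D Q \<Gamma> w (m w)" if w: "w \<in> lists \<Sigma>" for w
  proof
    show "set w \<subseteq> set \<Gamma>" using w \<Gamma> by auto
    show "s \<in> set Q \<and> s' \<in> set Q" if "((s, x), (s', y)) \<in> delta M" for s x s' y
      using that unfolding Q by force
    show "set x \<subseteq> set \<Gamma> \<and> fst ` set y \<subseteq> set \<Gamma>" if "((s, x), (s', y)) \<in> delta M" for s x s' y
      using that unfolding \<Gamma> by force
    show "length w < m w" using da(3)[of "length w"] unfolding m_def by linarith
    show "Suc t < 2 ^ m w" if "(init M w, c) \<in> step M ^^ t" for t c
    proof -
      have "t \<le> 2 ^ poly p (length w)" using M(2)[unfolded decides_in_time_def] w that by blast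
      moreover have "1 \<le> (2 :: nat) ^ poly p (length w)" by simp
      \<comment> \<open>The factor 4 accounts for the strict inequality and for the successor of the
        last time.\<close>
      ultimately have "Suc t < 4 * 2 ^ poly p (length w)" by linarith
      also have "\<dots> = 2 ^ (poly p (length w) + 2)" by (simp add: power_add)
      also have "\<dots> \<le> 2 ^ m w" using da(3)[of "length w"] by (intro power_increasing) (auto simp: m_def)
      finally show ?thesis .
    qed
  qed (use M D Q \<Gamma> in auto)
  \<comment> \<open>The word enters only through \<open>x\<close>, which is one input symbol or
    \<open>None\<close>; over a fixed alphabet this is a finite table of templates.\<close>
  define rules where "rules x = map free (computation.preds M D Q \<Gamma>) @ map (Pair [])
    (common_constraints (tapes M) (start M) (accept M) D Q \<Gamma> @ [input_constraint x])" for x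
  define rs where "rs w = tprog (m w) (\<lambda>j. rules (if j < length w then Some (w ! j) else None))" for w
  define f where "f w = enc_instance (rs w) (pname Grd)" for w
  have "polytime_computable \<Sigma> f"
    by (rule polytime_generate[OF \<Sigma> da(1,2) as]) (simp add: f_def rs_def m_def)
  moreover have "f w \<in> loosely_guarded_instances \<and> (w \<in> L \<longleftrightarrow> f w \<in> satisfiable_loosely_guarded_instances)"
    if w: "w \<in> lists \<Sigma>" for w
  proof -
    interpret computation M D Q \<Gamma> w "m w" by (rule comp[OF w])
    have prog: "program_of (rs w) = prog"
    proof -
      have "(\<lambda>j. rules (if j < length w then Some (w ! j) else None)) = templates"
        by (rule ext) (simp add: templates_def rules_def Cs_def)
      then show ?thesis by (simp add: prog_def rs_def)
    qed
    have "w \<in> L \<longleftrightarrow> satisfiable prog (pname Grd)"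
      using M(2) w unfolding satisfiable_iff_accepts decides_in_time_def by blast
    \<comment> \<open>Injectivity of the encoding ensures that \<open>f w\<close> encodes no other,
      satisfiable instance.\<close>
    then show ?thesis
      using is_program_prog loosely_guarded_prog preds_prog unfolding f_def loosely_guarded_instances_def
        satisfiable_loosely_guarded_instances_def
      by (auto simp: enc_instance_inject prog)
  qed
  ultimately show "\<exists>f. polytime_computable \<Sigma> f \<and> (\<forall>w\<in>lists \<Sigma>. f w \<in> loosely_guarded_instances \<and>
      (w \<in> L \<longleftrightarrow> f w \<in> satisfiable_loosely_guarded_instances))" by blast
qed

end
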